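(* Let $G$ be a group in the family $\mathcal{F}$ given by a presentation whose associated matrices satisfy $M_l\in\Gamma_{s_1,s_2}$ for $l=1,\ldots,n$, where $s_1,s_2\ge 0$ are integers with $s_1+s_2=s$. Then the complexity of the conjugacy search problem in $G$ is at most polynomial. That is, for each fixed such $G$ there is an algorithm which, given words in the generators representing two conjugate elements $g,g_1\in G$, outputs $h\in G$ with $hgh^{-1}=g_1$, in time polynomial in the lengths of $g$ and $g_1$.
   Context: The family $\mathcal{F}$ consists of the groups $G$ admitting a presentation $$G=\langle q_1,\ldots,q_n,b_1,\ldots,b_s\mid [q_l,q_t]=1,\ [b_i,b_j]=1,\ q_lb_jq_l^{-1}=b_1^{m_{l(1,j)}}b_2^{m_{l(2,j)}}\cdots b_s^{m_{l(s,j)}}\rangle$$ (relations for all $1\le l,t\le n$ and $1\le i,j\le s$), where $m_{l(i,j)}\in\mathbb{Z}$ and the integral $s\times s$ matrices $M_l=(m_{l(i,j)})_{i,j}$, $1\le l\le n$, are nonsingular and commute pairwise. For integers $s_1,s_2\ge0$ with $s=s_1+s_2$, $$\Gamma_{s_1,s_2}=\left\{\begin{pmatrix} I_{s_1}&A\\0&I_{s_2}\end{pmatrix}\ :\ A \text{ an integral } s_1\times s_2 \text{ matrix}\right\}\le SL(s,\mathbb{Z}).$$ The group $G$, with its presentation, is fixed and is not part of the input. Length means word length in the generators $q_l^{\pm1},b_j^{\pm1}$. The conjugacy search problem in $G$: given two elements $g,g_1\in G$ known to be conjugate, find $h\in G$ with $hgh^{-1}=g_1$. *)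

theory Defs
  imports
    "HOL-Algebra.Group"
    "HOL-Computational_Algebra.Polynomial"
    "Jordan_Normal_Form.Determinant"
begin

section \<open>Words and group presentations\<close>

text \<open>A letter is a generator with an exponent sign: \<open>(x, True)\<close> stands for \<open>x\<close> and
  \<open>(x, False)\<close> for its inverse.  The length of a word is the length of the list.\<close>

type_synonym 'a word = "('a \<times> bool) list"

definition words :: "'a set \<Rightarrow> 'a word set" where
  "words X = lists (X \<times> UNIV)"

definition word_val :: "('g, 'm) monoid_scheme \<Rightarrow> ('a \<Rightarrow> 'g) \<Rightarrow> 'a word \<Rightarrow> 'g" where
  "word_val G \<phi> w =
     foldr (\<lambda>(x, e) a. (if e then \<phi> x else inv\<^bsub>G\<^esub> \<phi> x) \<otimes>\<^bsub>G\<^esub> a) w \<one>\<^bsub>G\<^esub>"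

text \<open>The congruence on words whose quotient is the group with generators \<open>X\<close> and defining
  relations \<open>r = r'\<close> for \<open>(r, r') \<in> R\<close>.\<close>

inductive pres_eq :: "'a set \<Rightarrow> ('a word \<times> 'a word) set \<Rightarrow> 'a word \<Rightarrow> 'a word \<Rightarrow> bool"
  for X :: "'a set" and R :: "('a word \<times> 'a word) set" where
  cancel: "x \<in> X \<Longrightarrow> pres_eq X R (u @ [(x, e), (x, \<not> e)] @ v) (u @ v)"
| relation: "(r, r') \<in> R \<Longrightarrow> pres_eq X R (u @ r @ v) (u @ r' @ v)"
| refl: "pres_eq X R u u"
| sym: "pres_eq X R u v \<Longrightarrow> pres_eq X R v u"
| trans: "pres_eq X R u v \<Longrightarrow> pres_eq X R v w \<Longrightarrow> pres_eq X R u w"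

text \<open>\<open>G = \<langle>X | R\<rangle>\<close>, the generator \<open>x\<close> being the element \<open>\<phi> x\<close> of \<open>G\<close>.\<close>

definition has_presentation ::
  "('g, 'm) monoid_scheme \<Rightarrow> ('a \<Rightarrow> 'g) \<Rightarrow> 'a set \<Rightarrow> ('a word \<times> 'a word) set \<Rightarrow> bool" where
  "has_presentation G \<phi> X R \<longleftrightarrow>
     group G \<and> \<phi> ` X \<subseteq> carrier G \<and>
     (\<forall>g \<in> carrier G. \<exists>w \<in> words X. word_val G \<phi> w = g) \<and>
     (\<forall>u \<in> words X. \<forall>v \<in> words X. word_val G \<phi> u = word_val G \<phi> v \<longleftrightarrow> pres_eq X R u v)"

section \<open>The family and the matrix groups\<close>

text \<open>Generators and matrix entries are indexed from \<open>0\<close>.\<close>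

datatype gen = Q nat | B nat

definition gens :: "nat \<Rightarrow> nat \<Rightarrow> gen set" where
  "gens n s = Q ` {..<n} \<union> B ` {..<s}"

definition gen_power :: "'a \<Rightarrow> int \<Rightarrow> 'a word" where
  "gen_power x k = replicate (nat \<bar>k\<bar>) (x, k \<ge> 0)"

definition commutator_word :: "'a \<Rightarrow> 'a \<Rightarrow> 'a word" where
  "commutator_word x y = [(x, True), (y, True), (x, False), (y, False)]"

definition family_relations :: "nat \<Rightarrow> nat \<Rightarrow> (nat \<Rightarrow> int mat) \<Rightarrow> (gen word \<times> gen word) set" where
  "family_relations n s M =
     {(commutator_word (Q l) (Q t), []) | l t. l < n \<and> t < n} \<union>
     {(commutator_word (B i) (B j), []) | i j. i < s \<and> j < s} \<union>
     {([(Q l, True), (B j, True), (Q l, False)],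
       concat (map (\<lambda>i. gen_power (B i) (M l $$ (i, j))) [0..<s])) | l j. l < n \<and> j < s}"

definition family_presentation ::
  "('g, 'm) monoid_scheme \<Rightarrow> (gen \<Rightarrow> 'g) \<Rightarrow> nat \<Rightarrow> nat \<Rightarrow> (nat \<Rightarrow> int mat) \<Rightarrow> bool" where
  "family_presentation G \<phi> n s M \<longleftrightarrow>
     (\<forall>l<n. M l \<in> carrier_mat s s \<and> det (M l) \<noteq> 0) \<and>
     (\<forall>l<n. \<forall>t<n. M l * M t = M t * M l) \<and>
     has_presentation G \<phi> (gens n s) (family_relations n s M)"

definition Gamma :: "nat \<Rightarrow> nat \<Rightarrow> int mat set" where
  "Gamma s\<^sub>1 s\<^sub>2 =
     {four_block_mat (1\<^sub>m s\<^sub>1) A (0\<^sub>m s\<^sub>2 s\<^sub>1) (1\<^sub>m s\<^sub>2) | A. A \<in> carrier_mat s\<^sub>1 s\<^sub>2}"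

section \<open>Deterministic multitape Turing machines\<close>

text \<open>A tape is a head position together with the contents of a two-way infinite row of cells.\<close>

type_synonym 'c tape = "int \<times> (int \<Rightarrow> 'c)"

datatype 'a cell = Blank | Sep | Sym 'a | Aux nat

datatype move = Go_Left | Stay | Go_Right

primrec offset :: "move \<Rightarrow> int" where
  "offset Go_Left = - 1"
| "offset Stay = 0"
| "offset Go_Right = 1"

text \<open>\<open>delta\<close> maps a state and the list of the scanned symbols (one for each tape) to the new
  state and, for each tape, the symbol to be written and the move of the head.\<close>

record 'c tm =
  tapes :: nat
  states :: "nat set"
  alphabet :: "'c set"
  start :: nat
  final :: nat
  delta :: "nat \<Rightarrow> 'c list \<Rightarrow> nat \<times> ('c \<times> move) list"

definition wf_tm :: "'a cell tm \<Rightarrow> bool" where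
  "wf_tm M \<longleftrightarrow>
     tapes M \<ge> 1 \<and> finite (states M) \<and> finite (alphabet M) \<and> Blank \<in> alphabet M \<and>
     start M \<in> states M \<and> final M \<in> states M \<and>
     (\<forall>p \<in> states M. \<forall>cs. length cs = tapes M \<and> set cs \<subseteq> alphabet M \<longrightarrow>
        (case delta M p cs of (p', acts) \<Rightarrow>
           p' \<in> states M \<and> length acts = tapes M \<and> fst ` set acts \<subseteq> alphabet M))"

definition scan :: "'c tape \<Rightarrow> 'c" where
  "scan T = snd T (fst T)"

definition act :: "'c \<times> move \<Rightarrow> 'c tape \<Rightarrow> 'c tape" where
  "act a T = (fst T + offset (snd a), (snd T)(fst T := fst a))"

definition step :: "'c tm \<Rightarrow> nat \<times> 'c tape list \<Rightarrow> nat \<times> 'c tape list" where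
  "step M = (\<lambda>(p, ts).
     if p = final M then (p, ts)
     else case delta M p (map scan ts) of (p', acts) \<Rightarrow> (p', map2 act acts ts))"

definition input_tape :: "'a cell list \<Rightarrow> 'a cell tape" where
  "input_tape x = (0, \<lambda>i. if 0 \<le> i \<and> i < int (length x) then x ! nat i else Blank)"

definition init :: "'a cell tm \<Rightarrow> 'a cell list \<Rightarrow> nat \<times> 'a cell tape list" where
  "init M x = (start M, input_tape x # replicate (tapes M - 1) (input_tape []))"

text \<open>The word on a tape: the symbols from the head position up to the next blank.\<close>

definition tape_holds :: "'a cell tape \<Rightarrow> 'a list \<Rightarrow> bool" where
  "tape_holds T y \<longleftrightarrow>
     (\<forall>i < length y. snd T (fst T + int i) = Sym (y ! i)) \<and>
     snd T (fst T + int (length y)) = Blank"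

text \<open>Since \<open>step\<close> leaves halted configurations unchanged, the following says that \<open>M\<close> halts on
  input \<open>x\<close> after at most \<open>t\<close> steps and outputs \<open>y\<close> (on the first tape).\<close>

definition tm_outputs :: "'a cell tm \<Rightarrow> 'a cell list \<Rightarrow> nat \<Rightarrow> 'a list \<Rightarrow> bool" where
  "tm_outputs M x t y \<longleftrightarrow>
     (case (step M ^^ t) (init M x) of (p, ts) \<Rightarrow> p = final M \<and> tape_holds (hd ts) y)"

section \<open>The conjugacy search problem\<close>

definition encode_pair :: "'a list \<Rightarrow> 'a list \<Rightarrow> 'a cell list" where
  "encode_pair u v = map Sym u @ [Sep] @ map Sym v"

definition conjugate_in :: "('g, 'm) monoid_scheme \<Rightarrow> 'g \<Rightarrow> 'g \<Rightarrow> bool" where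
  "conjugate_in G g g\<^sub>1 \<longleftrightarrow> (\<exists>h \<in> carrier G. h \<otimes>\<^bsub>G\<^esub> g \<otimes>\<^bsub>G\<^esub> inv\<^bsub>G\<^esub> h = g\<^sub>1)"

text \<open>The machine and the polynomial may depend on the group and on its generating family; the
  only input is a pair of words.  Nothing is required on inputs that are not conjugate in \<open>G\<close>.\<close>

definition conj_search_poly_time ::
  "('g, 'm) monoid_scheme \<Rightarrow> ('a \<Rightarrow> 'g) \<Rightarrow> 'a set \<Rightarrow> bool" where
  "conj_search_poly_time G \<phi> X \<longleftrightarrow>
     (\<exists>(M :: ('a \<times> bool) cell tm) (p :: nat poly).
        wf_tm M \<and> insert Sep (Sym ` (X \<times> UNIV)) \<subseteq> alphabet M \<and>
        (\<forall>u \<in> words X. \<forall>v \<in> words X.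
           conjugate_in G (word_val G \<phi> u) (word_val G \<phi> v) \<longrightarrow>
           (\<exists>t w. t \<le> poly p (length u + length v) \<and> w \<in> words X \<and>
              tm_outputs M (encode_pair u v) t w \<and>
              word_val G \<phi> w \<otimes>\<^bsub>G\<^esub> word_val G \<phi> u \<otimes>\<^bsub>G\<^esub> inv\<^bsub>G\<^esub> word_val G \<phi> w
                = word_val G \<phi> v)))"

end

theory Submission
  imports Defs
begin

text \<open>
Write \<open>M\<^sub>l = I + N\<^sub>l\<close>.  The block shape of the matrices gives \<open>N\<^sub>l N\<^sub>t = 0\<close> for all \<open>l\<close> and \<open>t\<close>, so
\<open>G = \<int>\<^sup>s \<rtimes> \<int>\<^sup>n\<close> is nilpotent of class two, and everything about a word can be read off from sums:
its exponents in the \<open>Q l\<close>, and \<open>s\<close> integers to which every letter contributes a constant and every pair of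
letters (an earlier \<open>Q l\<close>, a later \<open>B j\<close>) contributes a column of \<open>\<plusminus>N\<^sub>l\<close>.  These coordinates
decide the word problem (\<open>word_val_eq_iff\<close>).

Comparing the coordinates of \<open>wu\<close> and \<open>vw\<close> shows that \<open>w\<close> conjugates \<open>u\<close> to \<open>v\<close> if and only if \<open>u\<close> and
\<open>v\<close> have the same exponents in the \<open>Q l\<close> and the exponent sums of the generators in \<open>w\<close> solve a system of
\<open>s\<close> linear equations over the integers (\<open>conjugator_iff\<close>).  The number of equations and unknowns depends on \<open>G\<close> only, and the coefficients are
quadratically bounded in the length of the input.  A solvable system of this kind has a
solution whose entries are bounded by a polynomial in the size of the coefficients
(\<open>small_integer_solution\<close>).  As there are only polynomially many integer vectors below this bound,
exhaustive search takes polynomial time, and the conjugator, which is a product of powers of generators,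
has polynomial length.

All numbers involved are polynomially bounded, so they may be kept in unary, as head positions on
tapes of their own.  The search is therefore written in a small language of while programs over such
counters.  A program becomes a Turing machine whose states are the finitely many lists of commands that can be
left to execute (\<open>compile\<close>); the running time is controlled by a Hoare logic for total
correctness in polynomial time (\<open>ptime\<close>).
\<close>

section \<open>Small integer solutions of linear systems\<close>

text \<open>The exponent in the bound for a system of \<open>d\<close> equations.  Eliminating one unknown turns a bound
  \<open>H\<close> for the data into \<open>H ^ 3\<close>, and recovering that unknown costs two further factors \<open>H\<close>.\<close>
primrec pivot_exponent :: "nat \<Rightarrow> nat" where
  "pivot_exponent 0 = 1"
| "pivot_exponent (Suc d) = 3 * pivot_exponent d + 2"

text \<open>The proof is Gaussian elimination with a pivot \<open>p\<close>, after which the unknown of the pivot has to be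
  recovered by an exact division by \<open>p\<close>.  That division succeeds if the other unknowns have not changed
  modulo \<open>p\<close>.  For this reason the claim also asks for a solution congruent to the given one modulo a
  prescribed \<open>D\<close>; the recursive call uses \<open>D * \<bar>p\<bar>\<close>.  In the end, with no equations left, reduction
  modulo \<open>D\<close> makes all remaining unknowns small.\<close>
lemma small_integer_solution:
  fixes a :: "nat \<Rightarrow> 'j \<Rightarrow> int"
  assumes "finite J" "2 \<le> H" "int (card J) \<le> H" "1 \<le> D" "D \<le> H"
    and "\<And>i j. i < d \<Longrightarrow> j \<in> J \<Longrightarrow> \<bar>a i j\<bar> \<le> H"
    and "\<And>i. i < d \<Longrightarrow> \<bar>t i\<bar> \<le> H"
    and "\<And>i. i < d \<Longrightarrow> (\<Sum>j\<in>J. a i j * x j) = t i"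
  shows "\<exists>x'. (\<forall>i<d. (\<Sum>j\<in>J. a i j * x' j) = t i) \<and>
              (\<forall>j\<in>J. D dvd x' j - x j) \<and> (\<forall>j\<in>J. \<bar>x' j\<bar> \<le> H ^ pivot_exponent d)"
  using assms
proof (induction d arbitrary: J a t H D x)
  case 0
  have "\<bar>x j mod D\<bar> \<le> H" for j
    using 0 pos_mod_bound[of D "x j"] pos_mod_sign[of D "x j"] by linarith
  moreover have "D dvd x j mod D - x j" for j
    by (simp add: mod_eq_dvd_iff[symmetric])
  ultimately show ?case
    by (intro exI[of _ "\<lambda>j. x j mod D"]) auto
next
  case (Suc d)
  let ?e = "pivot_exponent d"
  have H1: "1 \<le> H" using Suc.prems by simp
  show ?case
  proof (cases "\<forall>j\<in>J. a d j = 0")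
    case True
    obtain x' where x': "\<forall>i<d. (\<Sum>j\<in>J. a i j * x' j) = t i" "\<forall>j\<in>J. D dvd x' j - x j"
      "\<forall>j\<in>J. \<bar>x' j\<bar> \<le> H ^ ?e"
      using Suc.IH[of J H D a t x] Suc.prems by auto
    have "t d = 0" using Suc.prems(8)[of d] True by simp
    moreover have "(\<Sum>j\<in>J. a d j * x' j) = 0" using True by simp
    moreover have "H ^ ?e \<le> H ^ pivot_exponent (Suc d)"
      using H1 by (intro power_increasing) auto
    then have "\<forall>j\<in>J. \<bar>x' j\<bar> \<le> H ^ pivot_exponent (Suc d)"
      using x'(3) order_trans by blast
    ultimately show ?thesis
      using x' by (intro exI[of _ x']) (auto simp: less_Suc_eq simp del: pivot_exponent.simps)
  next
    case False
    then obtain k where k: "k \<in> J" "a d k \<noteq> 0" by auto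
    define p where "p = a d k"
    define K where "K = J - {k}"
    define b where "b i j = p * a i j - a i k * a d j" for i j
    define r where "r i = p * t i - a i k * t d" for i
    have p: "p \<noteq> 0" "1 \<le> \<bar>p\<bar>" "\<bar>p\<bar> \<le> H" using k Suc.prems(6)[of d k] by (auto simp: p_def)
    have split: "sum f J = f k + sum f K" for f :: "_ \<Rightarrow> int"
      unfolding K_def using Suc.prems(1) k(1) by (rule sum.remove)
    have cube: "2 * (H * H) \<le> H ^ 3"
      using Suc.prems(2) by (simp add: power3_eq_cube mult_right_mono)
    moreover have "0 \<le> H * H" using H1 by simp
    ultimately have "H * H \<le> H ^ 3" by linarith
    have "H \<le> H ^ 3" using H1 by (simp add: self_le_power)
    have prod: "\<bar>y * z\<bar> \<le> H * H" if "\<bar>y\<bar> \<le> H" "\<bar>z\<bar> \<le> H" for y z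
      using that H1 by (simp add: abs_mult mult_mono)
    have diff: "\<bar>y * z - y' * z'\<bar> \<le> H ^ 3"
      if "\<bar>y\<bar> \<le> H" "\<bar>z\<bar> \<le> H" "\<bar>y'\<bar> \<le> H" "\<bar>z'\<bar> \<le> H" for y z y' z'
      using prod[OF that(1,2)] prod[OF that(3,4)] cube by linarith
    have row: "(\<Sum>j\<in>K. b i j * y j) = p * (\<Sum>j\<in>J. a i j * y j) - a i k * (\<Sum>j\<in>J. a d j * y j)"
      for i y
      unfolding split b_def p_def
      by (simp add: algebra_simps sum_subtractf sum_distrib_left)
    have "\<exists>x'. (\<forall>i<d. (\<Sum>j\<in>K. b i j * x' j) = r i) \<and>
        (\<forall>j\<in>K. D * \<bar>p\<bar> dvd x' j - x j) \<and> (\<forall>j\<in>K. \<bar>x' j\<bar> \<le> (H ^ 3) ^ ?e)"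
    proof (rule Suc.IH)
      show "finite K" using Suc.prems(1) by (simp add: K_def)
      show "2 \<le> H ^ 3" using \<open>H \<le> H ^ 3\<close> Suc.prems(2) by linarith
      have "card K \<le> card J" unfolding K_def using Suc.prems(1) by (intro card_mono) auto
      then show "int (card K) \<le> H ^ 3" using Suc.prems(3) \<open>H \<le> H ^ 3\<close> by linarith
      show "1 \<le> D * \<bar>p\<bar>" using mult_mono[of 1 D 1 "\<bar>p\<bar>"] Suc.prems(4) p(2) by simp
      show "D * \<bar>p\<bar> \<le> H ^ 3" using prod[of D p] Suc.prems p(3) \<open>H * H \<le> H ^ 3\<close>
        by (simp add: abs_mult)
    next
      fix i j assume "i < d" "j \<in> K"
      then show "\<bar>b i j\<bar> \<le> H ^ 3"
        unfolding b_def using Suc.prems(6) k p(3) by (intro diff) (auto simp: K_def)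
    next
      fix i assume i: "i < d"
      then show "\<bar>r i\<bar> \<le> H ^ 3"
        unfolding r_def using Suc.prems(6,7) k p(3) by (intro diff) auto
      show "(\<Sum>j\<in>K. b i j * x j) = r i"
        using i Suc.prems(8) by (simp add: row r_def)
    qed
    then obtain y where y: "\<forall>i<d. (\<Sum>j\<in>K. b i j * y j) = r i"
      "\<forall>j\<in>K. D * \<bar>p\<bar> dvd y j - x j" "\<forall>j\<in>K. \<bar>y j\<bar> \<le> H ^ (3 * ?e)"
      by (auto simp: power_mult)
    have "\<forall>j\<in>K. \<exists>c. y j = x j + D * p * c"
    proof
      fix j assume "j \<in> K"
      then have "D * \<bar>p\<bar> dvd y j - x j" using y(2) by blast
      moreover have "D * p dvd D * \<bar>p\<bar>" by simp
      ultimately have "D * p dvd y j - x j" by (rule dvd_trans[rotated])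
      then obtain c where "y j - x j = D * p * c" by (elim dvdE)
      then show "\<exists>c. y j = x j + D * p * c" by (intro exI[of _ c]) simp
    qed
    then obtain c where c: "\<And>j. j \<in> K \<Longrightarrow> y j = x j + D * p * c j" by metis
    \<comment> \<open>This is the exact quotient \<open>(t d - (\<Sum>j\<in>K. a d j * y j)) div p\<close>, written so that it is
      visibly congruent to \<open>x k\<close> modulo \<open>D\<close>.\<close>
    define z where "z = x k - D * (\<Sum>j\<in>K. a d j * c j)"
    define x' where "x' = y(k := z)"
    have off: "(\<Sum>j\<in>K. f j * x' j) = (\<Sum>j\<in>K. f j * y j)" for f
      by (rule sum.cong) (auto simp: x'_def K_def)
    have "p * x k + (\<Sum>j\<in>K. a d j * x j) = t d"
      using Suc.prems(8)[of d] split[of "\<lambda>j. a d j * x j"] by (simp add: p_def)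
    moreover have "(\<Sum>j\<in>K. a d j * y j) = (\<Sum>j\<in>K. a d j * x j) + p * (D * (\<Sum>j\<in>K. a d j * c j))"
      by (simp add: c sum.distrib sum_distrib_left algebra_simps)
    ultimately have pz: "p * z + (\<Sum>j\<in>K. a d j * y j) = t d"
      by (simp add: z_def algebra_simps)
    have last: "(\<Sum>j\<in>J. a d j * x' j) = t d"
      using pz by (simp add: split off) (simp add: p_def x'_def)
    have sol: "(\<Sum>j\<in>J. a i j * x' j) = t i" if "i < Suc d" for i
    proof (cases "i = d")
      case True then show ?thesis using last by simp
    next
      case False
      then have "i < d" using that by simp
      then have "p * (\<Sum>j\<in>J. a i j * x' j) - a i k * t d = p * t i - a i k * t d"
        using row[of i x'] y(1) by (auto simp: off last r_def)
      then show ?thesis using p(1) by simp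
    qed
    have cong: "\<forall>j\<in>J. D dvd x' j - x j"
      using c by (auto simp: x'_def z_def K_def)
    have "\<bar>\<Sum>j\<in>K. a d j * y j\<bar> \<le> (\<Sum>j\<in>K. H * H ^ (3 * ?e))"
    proof (rule order_trans[OF sum_abs sum_mono])
      fix j assume "j \<in> K"
      then have "\<bar>a d j\<bar> \<le> H" "\<bar>y j\<bar> \<le> H ^ (3 * ?e)" using Suc.prems(6)[of d j] y(3) by (auto simp: K_def)
      then show "\<bar>a d j * y j\<bar> \<le> H * H ^ (3 * ?e)"
        using H1 by (simp add: abs_mult mult_mono)
    qed
    also have "\<dots> = int (card K) * (H * H ^ (3 * ?e))" by simp
    finally have "\<bar>\<Sum>j\<in>K. a d j * y j\<bar> \<le> int (card K) * (H * H ^ (3 * ?e))" .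
    moreover have "H + int (card K) * (H * H ^ (3 * ?e)) \<le> H * (H * H ^ (3 * ?e))"
    proof -
      have "int (card K) + 1 \<le> H"
        using Suc.prems(1,3) k(1) card_Suc_Diff1[of J k] by (simp add: K_def)
      then have "(int (card K) + 1) * (H * H ^ (3 * ?e)) \<le> H * (H * H ^ (3 * ?e))"
        using H1 by (intro mult_right_mono) auto
      moreover have "H * 1 \<le> H * H ^ (3 * ?e)" using H1 by (intro mult_left_mono one_le_power) auto
      ultimately show ?thesis by (simp add: distrib_right)
    qed
    ultimately have "\<bar>p * z\<bar> \<le> H * (H * H ^ (3 * ?e))"
      using pz Suc.prems(7)[of d] by simp
    moreover have "\<bar>z\<bar> \<le> \<bar>p * z\<bar>" using p(2) by (simp add: abs_mult mult_le_cancel_right1)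
    moreover have "H * (H * H ^ (3 * ?e)) = H ^ (3 * ?e + 2)" by (simp add: power_add power2_eq_square)
    moreover have "H ^ (3 * ?e + 2) \<le> H ^ pivot_exponent (Suc d)"
      using H1 by (intro power_increasing) auto
    moreover have "H ^ (3 * ?e) \<le> H ^ pivot_exponent (Suc d)"
      using H1 by (intro power_increasing) auto
    ultimately have "\<bar>z\<bar> \<le> H ^ pivot_exponent (Suc d)"
      and "\<forall>j\<in>K. \<bar>y j\<bar> \<le> H ^ pivot_exponent (Suc d)"
      using y(3) order_trans by (linarith, blast)
    then have "\<forall>j\<in>J. \<bar>x' j\<bar> \<le> H ^ pivot_exponent (Suc d)"
      by (auto simp: x'_def K_def simp del: pivot_exponent.simps)
    then show ?thesis using sol cong by blast
  qed
qed

section \<open>Coordinates of words\<close>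

definition sgn_of :: "bool \<Rightarrow> int" where
  "sgn_of e = (if e then 1 else - 1)"

text \<open>Collecting the letters of a word to a normal form in a group of class two: \<open>lin x\<close> is what a letter
  contributes by itself, and \<open>tw x y\<close> is the commutator that appears when \<open>x\<close> is moved past a later
  letter \<open>y\<close>.\<close>
fun coord :: "('l \<Rightarrow> 'i \<Rightarrow> int) \<Rightarrow> ('l \<Rightarrow> 'l \<Rightarrow> 'i \<Rightarrow> int) \<Rightarrow> 'l list \<Rightarrow> 'i \<Rightarrow> int" where
  "coord lin tw [] i = 0"
| "coord lin tw (x # w) i = lin x i + coord lin tw w i + (\<Sum>y\<leftarrow>w. tw x y i)"

lemma coord_append:
  "coord lin tw (u @ v) i = coord lin tw u i + coord lin tw v i + (\<Sum>x\<leftarrow>u. \<Sum>y\<leftarrow>v. tw x y i)"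
  by (induction u) (simp_all add: algebra_simps)

lemma coord_untwisted:
  assumes "\<And>x y. x \<in> set w \<Longrightarrow> y \<in> set w \<Longrightarrow> tw x y i = 0"
  shows "coord lin tw w i = (\<Sum>x\<leftarrow>w. lin x i)"
  using assms
proof (induction w)
  case (Cons x w)
  have "(\<Sum>y\<leftarrow>w. tw x y i) = (\<Sum>y\<leftarrow>w. 0)"
    using Cons.prems by (intro arg_cong[of _ _ sum_list] map_cong) auto
  then show ?case using Cons by simp
qed simp

fun q_exp :: "gen \<times> bool \<Rightarrow> nat \<Rightarrow> int" where
  "q_exp (Q l, e) t = (if l = t then sgn_of e else 0)"
| "q_exp (B j, e) t = 0"

fun b_exp :: "gen \<times> bool \<Rightarrow> nat \<Rightarrow> int" where
  "b_exp (Q l, e) i = 0"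
| "b_exp (B j, e) i = (if j = i then sgn_of e else 0)"

definition q_exps :: "gen word \<Rightarrow> nat \<Rightarrow> int" where
  "q_exps w t = (\<Sum>x\<leftarrow>w. q_exp x t)"

fun twist :: "(nat \<Rightarrow> nat \<Rightarrow> nat \<Rightarrow> int) \<Rightarrow> gen \<times> bool \<Rightarrow> gen \<times> bool \<Rightarrow> nat \<Rightarrow> int" where
  "twist N (Q l, e) (B j, e') i = sgn_of e * sgn_of e' * N l i j"
| "twist N (Q l, e) (Q t, e') i = 0"
| "twist N (B j, e) y i = 0"

abbreviation b_coord :: "(nat \<Rightarrow> nat \<Rightarrow> nat \<Rightarrow> int) \<Rightarrow> gen word \<Rightarrow> nat \<Rightarrow> int" where
  "b_coord N \<equiv> coord b_exp (twist N)"

text \<open>The matrix \<open>M l - I\<close>.  Entries out of range are set to zero, because the congruence generated by a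
  presentation also relates words with letters outside of the generating set, and the invariants below
  should hold for all words.\<close>
definition nilpart :: "nat \<Rightarrow> nat \<Rightarrow> (nat \<Rightarrow> int mat) \<Rightarrow> nat \<Rightarrow> nat \<Rightarrow> nat \<Rightarrow> int" where
  "nilpart n s M l i j = (if l < n \<and> i < s \<and> j < s then (M l - 1\<^sub>m s) $$ (i, j) else 0)"

lemma sgn_of_simps [simp]: "sgn_of True = 1" "sgn_of False = - 1" "sgn_of (\<not> e) = - sgn_of e"
  by (auto simp: sgn_of_def)

lemma twist_flip: "twist N x (y, \<not> e) i = - twist N x (y, e) i" "twist N (y, \<not> e) z i = - twist N (y, e) z i"
   apply (cases x; cases "fst x"; cases y; simp)
  apply (cases z; cases "fst z"; cases y; simp)
  done

lemma twist_False: 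
  "twist N x (y, False) i = - twist N x (y, True) i" "twist N (y, False) z i = - twist N (y, True) z i"
  using twist_flip(1)[of N x y True i] twist_flip(2)[of N y True z i] by auto

text \<open>The only nonzero entries are in the upper right block, so a row index of one such entry is never a
  column index of another; this is why products of these matrices vanish.\<close>
lemma nilpart_Gamma:
  assumes "M l \<in> Gamma s1 s2" "nilpart n (s1 + s2) M l i j \<noteq> 0"
  shows "i < s1" "s1 \<le> j"
  using assms by (auto simp: nilpart_def Gamma_def split: if_splits)

text \<open>Equality of the coordinates is not obviously preserved under multiplication, as the coordinates of a
  product also depend on the twists between the factors.  These are therefore part of the invariant.\<close>
definition indist :: "(nat \<Rightarrow> nat \<Rightarrow> nat \<Rightarrow> int) \<Rightarrow> gen word \<Rightarrow> gen word \<Rightarrow> bool" where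
  "indist N u v \<longleftrightarrow> q_exps u = q_exps v \<and> b_coord N u = b_coord N v \<and>
     (\<forall>z i. (\<Sum>x\<leftarrow>u. twist N x z i) = (\<Sum>x\<leftarrow>v. twist N x z i)) \<and>
     (\<forall>z i. (\<Sum>x\<leftarrow>u. twist N z x i) = (\<Sum>x\<leftarrow>v. twist N z x i))"

lemma sum_list_swap:
  fixes f :: "'a \<Rightarrow> 'b \<Rightarrow> int"
  shows "(\<Sum>x\<leftarrow>u. \<Sum>y\<leftarrow>v. f x y) = (\<Sum>y\<leftarrow>v. \<Sum>x\<leftarrow>u. f x y)"
  by (induction u) (simp_all add: sum_list_addf)

lemma indist_context:
  assumes "indist N r r'"
  shows "indist N (u @ r @ v) (u @ r' @ v)"
proof -
  have "(\<Sum>x\<leftarrow>r. \<Sum>y\<leftarrow>v. twist N x y i) = (\<Sum>x\<leftarrow>r'. \<Sum>y\<leftarrow>v. twist N x y i)" for i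
    using assms unfolding sum_list_swap[of _ v] indist_def by (simp del: split_paired_All)
  moreover have "(\<Sum>x\<leftarrow>u. \<Sum>y\<leftarrow>r. twist N x y i) = (\<Sum>x\<leftarrow>u. \<Sum>y\<leftarrow>r'. twist N x y i)" for i
    using assms unfolding indist_def by (simp del: split_paired_All)
  ultimately show ?thesis
    using assms unfolding indist_def q_exps_def fun_eq_iff
    by (simp add: coord_append sum_list_addf del: split_paired_All)
qed

lemma sum_list_gen_power:
  fixes f :: "'a \<times> bool \<Rightarrow> int"
  assumes "f (x, False) = - f (x, True)"
  shows "(\<Sum>y\<leftarrow>gen_power x k. f y) = k * f (x, True)"
  using assms by (cases "k \<ge> 0") (simp_all add: gen_power_def sum_list_replicate)

lemma sum_list_concat_upt:
  fixes f :: "'a \<Rightarrow> int"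
  shows "(\<Sum>y\<leftarrow>concat (map g [0..<s]). f y) = (\<Sum>i<s. \<Sum>y\<leftarrow>g i. f y)"
  by (induction s) simp_all

text \<open>The vanishing products enter in the relation for \<open>Q l\<close> and \<open>B j\<close>: its right side contains
  additional generators with exponents \<open>N\<^sub>l e\<^sub>j\<close>, and these must not be seen by a further \<open>Q t\<close>.\<close>
lemma indist_pres_eq:
  assumes nil: "\<And>l t i j k. l < n \<Longrightarrow> t < n \<Longrightarrow> nilpart n s M l i j * nilpart n s M t j k = 0"
    and carr: "\<And>l. l < n \<Longrightarrow> M l \<in> carrier_mat s s"
    and "pres_eq (gens n s) (family_relations n s M) u v"
  shows "indist (nilpart n s M) u v"
  using assms(3)
proof (induction rule: pres_eq.induct)
  case (cancel x u e v)
  have "indist (nilpart n s M) [(x, e), (x, \<not> e)] []"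
    by (cases x) (auto simp: indist_def q_exps_def fun_eq_iff twist_flip)
  then show ?case using indist_context[where r' = "[]"] by fastforce
next
  case (relation r r' u v)
  let ?N = "nilpart n s M"
  have "indist ?N r r'"
  proof -
    consider (q) l t where "r = commutator_word (Q l) (Q t)" "r' = []" 
      | (b) i j where "r = commutator_word (B i) (B j)" "r' = []"
      | (m) l j where "l < n" "j < s" "r = [(Q l, True), (B j, True), (Q l, False)]"
          "r' = concat (map (\<lambda>i. gen_power (B i) (M l $$ (i, j))) [0..<s])"
      using relation by (auto simp: family_relations_def)
    then show ?thesis
    proof cases
      case q
      have "twist ?N z (Q l, e) i = 0" for z l e i by (cases z; cases "fst z"; simp)
      then show ?thesis using q
        by (auto simp: commutator_word_def indist_def q_exps_def fun_eq_iff twist_False)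
    next
      case b
      then show ?thesis
        by (auto simp: commutator_word_def indist_def q_exps_def fun_eq_iff twist_False)
    next
      case m
      have sum: "(\<Sum>y\<leftarrow>r'. f y) = (\<Sum>i<s. M l $$ (i, j) * f (B i, True))"
        if "\<And>i. f (B i, False) = - f (B i, True)" for f :: "gen \<times> bool \<Rightarrow> int"
        using that by (simp add: m(4) sum_list_concat_upt sum_list_gen_power)
      have Bs: "fst y \<in> range B" if "y \<in> set r'" for y
        using that by (auto simp: m(4) gen_power_def)
      have M: "M l $$ (i, j) = ?N l i j + (if i = j then 1 else 0)" if "i < s" for i
        using that m carr[OF m(1)] by (auto simp: nilpart_def)
      have M': "(\<Sum>i<s. M l $$ (i, j) * f i) = f j + (\<Sum>i<s. ?N l i j * f i)" for f
      proof -
        have "(\<Sum>i<s. M l $$ (i, j) * f i) = (\<Sum>i<s. (if i = j then f i else 0) + ?N l i j * f i)"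
          by (rule sum.cong) (auto simp: M algebra_simps)
        also have "\<dots> = f j + (\<Sum>i<s. ?N l i j * f i)"
          using m(2) by (simp add: sum.distrib)
        finally show ?thesis .
      qed
      have "q_exps r t = q_exps r' t" for t
        using m(3) unfolding q_exps_def by (subst sum) auto
      moreover have "b_coord ?N r i = b_coord ?N r' i" for i
      proof -
        have "b_coord ?N r' i = (\<Sum>y\<leftarrow>r'. b_exp y i)"
          using Bs by (intro coord_untwisted) fastforce
        also have "\<dots> = (\<Sum>k<s. M l $$ (k, j) * b_exp (B k, True) i)" by (rule sum) simp
        also have "\<dots> = b_exp (B j, True) i + (\<Sum>k<s. ?N l k j * b_exp (B k, True) i)" by (rule M')
        also have "(\<Sum>k<s. ?N l k j * b_exp (B k, True) i) = ?N l i j"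
          using m(2) by (auto simp: if_distrib[of "times _"] nilpart_def cong: if_cong)
        finally show ?thesis using m(3) by simp
      qed
      moreover have "(\<Sum>x\<leftarrow>r. twist ?N x z i) = (\<Sum>x\<leftarrow>r'. twist ?N x z i)" for z i
        using m(3) by (cases z; cases "fst z"; subst sum) (auto simp: twist_False)
      moreover have "(\<Sum>x\<leftarrow>r. twist ?N z x i) = (\<Sum>x\<leftarrow>r'. twist ?N z x i)" for z i
      proof (cases "fst z")
        case (Q t)
        have "(\<Sum>x\<leftarrow>r'. twist ?N z x i) = (\<Sum>k<s. M l $$ (k, j) * twist ?N z (B k, True) i)"
          by (rule sum) (simp add: twist_False)
        also have "\<dots> = twist ?N z (B j, True) i + (\<Sum>k<s. ?N l k j * twist ?N z (B k, True) i)"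
          by (rule M')
        also have "(\<Sum>k<s. ?N l k j * twist ?N z (B k, True) i) = 0"
        proof (rule sum.neutral, rule ballI)
          fix k
          have "t < n \<Longrightarrow> ?N t i k * ?N l k j = 0" using nil m(1) by blast
          moreover have "\<not> t < n \<Longrightarrow> ?N t i k = 0" by (simp add: nilpart_def)
          ultimately show "?N l k j * twist ?N z (B k, True) i = 0"
            using Q by (cases z) (auto)
        qed
        finally show ?thesis using m(3) Q by (cases z) simp
      next
        case (B t)
        then show ?thesis using m(3) by (cases z) (simp add: sum)
      qed
      ultimately show ?thesis by (simp add: indist_def fun_eq_iff)
    qed
  qed
  then show ?case by (rule indist_context)
qed (auto simp: indist_def)


primrec cprod :: "('g, 'm) monoid_scheme \<Rightarrow> (nat \<Rightarrow> 'g) \<Rightarrow> nat \<Rightarrow> (nat \<Rightarrow> int) \<Rightarrow> 'g" where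
  "cprod G x 0 c = \<one>\<^bsub>G\<^esub>"
| "cprod G x (Suc k) c = cprod G x k c \<otimes>\<^bsub>G\<^esub> x k [^]\<^bsub>G\<^esub> c k"

lemma cprod_cong: "(\<And>i. i < k \<Longrightarrow> c i = d i) \<Longrightarrow> cprod G x k c = cprod G x k d"
  by (induction k) auto

lemma words_concat: "(\<And>w. w \<in> set ws \<Longrightarrow> w \<in> words X) \<Longrightarrow> concat ws \<in> words X"
  by (fastforce simp: words_def)

context group
begin

lemma conj_hom: "x \<in> carrier G \<Longrightarrow> group_hom G G (\<lambda>y. x \<otimes> y \<otimes> inv x)"
  by unfold_locales (auto simp: hom_def m_assoc inv_solve_left inv_solve_right)

lemma commute_conj: 
  assumes "x \<in> carrier G" "y \<in> carrier G"
  shows "x \<otimes> y \<otimes> inv x = y \<longleftrightarrow> x \<otimes> y = y \<otimes> x"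
  using assms by (metis inv_solve_right' m_closed)

lemma commute_int_pow:
  assumes "x \<in> carrier G" "y \<in> carrier G" "x \<otimes> y = y \<otimes> x"
  shows "x \<otimes> y [^] (k::int) = y [^] k \<otimes> x"
  using group_hom.hom_int_pow[OF conj_hom[OF assms(1)] assms(2), of k] assms
  by (metis commute_conj int_pow_closed)

lemma cprod_closed [simp]:
  "(\<And>i. i < k \<Longrightarrow> x i \<in> carrier G) \<Longrightarrow> cprod G x k c \<in> carrier G"
  by (induction k) auto

lemma commute_cprod:
  assumes "y \<in> carrier G" "\<And>i. i < k \<Longrightarrow> x i \<in> carrier G" "\<And>i. i < k \<Longrightarrow> y \<otimes> x i = x i \<otimes> y"
  shows "y \<otimes> cprod G x k c = cprod G x k c \<otimes> y"
  using assms
proof (induction k)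
  case (Suc k)
  then have xk: "x k \<in> carrier G" "y \<otimes> x k = x k \<otimes> y" by auto
  have cl: "cprod G x k c \<in> carrier G" using Suc.prems by auto
  have "y \<otimes> (cprod G x k c \<otimes> x k [^] c k) = (y \<otimes> cprod G x k c) \<otimes> x k [^] c k"
    using Suc.prems(1) cl xk by (simp add: m_assoc)
  also have "\<dots> = cprod G x k c \<otimes> (y \<otimes> x k [^] c k)"
    using Suc cl xk by (simp add: m_assoc)
  also have "\<dots> = cprod G x k c \<otimes> (x k [^] c k \<otimes> y)"
    using commute_int_pow[OF Suc.prems(1) xk] by simp
  finally show ?case using Suc.prems(1) cl xk by (simp add: m_assoc)
qed simp

lemma cprod_add:
  assumes "\<And>i. i < k \<Longrightarrow> x i \<in> carrier G"
    and "\<And>i j. i < k \<Longrightarrow> j < k \<Longrightarrow> x i \<otimes> x j = x j \<otimes> x i"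
  shows "cprod G x k (\<lambda>i. c i + d i) = cprod G x k c \<otimes> cprod G x k d"
  using assms
proof (induction k)
  case (Suc k)
  have xk: "x k \<in> carrier G" using Suc.prems by auto
  have cl: "cprod G x k c \<in> carrier G" "cprod G x k d \<in> carrier G" using Suc.prems by auto
  have comm: "x k [^] c k \<otimes> cprod G x k d = cprod G x k d \<otimes> x k [^] c k"
    using Suc.prems xk by (intro commute_cprod) (auto intro!: commute_int_pow[symmetric])
  have "cprod G x k c \<otimes> cprod G x k d \<otimes> (x k [^] c k \<otimes> x k [^] d k) =
      cprod G x k c \<otimes> (cprod G x k d \<otimes> x k [^] c k) \<otimes> x k [^] d k"
    using cl xk by (simp add: m_assoc)
  also have "\<dots> = cprod G x k c \<otimes> (x k [^] c k \<otimes> cprod G x k d) \<otimes> x k [^] d k"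
    unfolding comm ..
  finally have "cprod G x k c \<otimes> cprod G x k d \<otimes> (x k [^] c k \<otimes> x k [^] d k) =
      (cprod G x k c \<otimes> x k [^] c k) \<otimes> (cprod G x k d \<otimes> x k [^] d k)"
    using cl xk by (simp add: m_assoc)
  then show ?case using Suc xk by (simp add: int_pow_mult)
qed simp

lemma cprod_zero: "(\<And>i. i < k \<Longrightarrow> x i \<in> carrier G) \<Longrightarrow> cprod G x k (\<lambda>i. 0) = \<one>"
  by (induction k) auto

lemma cprod_unit:
  assumes "\<And>i. i < k \<Longrightarrow> x i \<in> carrier G" "j < k"
  shows "cprod G x k (\<lambda>i. if j = i then e else 0) = x j [^] e"
  using assms
proof (induction k)
  case (Suc k)
  show ?case
  proof (cases "j = k")
    case True
    have "cprod G x k (\<lambda>i. if j = i then e else 0) = cprod G x k (\<lambda>i. 0)"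
      using True by (intro cprod_cong) auto
    then show ?thesis using Suc.prems True by (simp add: cprod_zero)
  qed (use Suc in auto)
qed simp

lemma cprod_int_pow:
  assumes "\<And>i. i < k \<Longrightarrow> x i \<in> carrier G"
    and "\<And>i j. i < k \<Longrightarrow> j < k \<Longrightarrow> x i \<otimes> x j = x j \<otimes> x i"
  shows "cprod G x k c [^] (z::int) = cprod G x k (\<lambda>i. c i * z)"
  using assms
proof (induction k)
  case (Suc k)
  have xk: "x k \<in> carrier G" "cprod G x k c \<in> carrier G" using Suc.prems by auto
  have "x k [^] c k \<otimes> cprod G x k c = cprod G x k c \<otimes> x k [^] c k"
    using Suc.prems xk by (intro commute_cprod) (auto intro!: commute_int_pow[symmetric])
  then have "(cprod G x k c \<otimes> x k [^] c k) [^] z = cprod G x k c [^] z \<otimes> (x k [^] c k) [^] z"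
    using xk by (intro int_pow_mult_distrib) auto
  then show ?case using Suc xk by (simp add: int_pow_pow)
qed simp

lemma cprod_matrix:
  assumes "\<And>i. i < s \<Longrightarrow> x i \<in> carrier G"
    and "\<And>i j. i < s \<Longrightarrow> j < s \<Longrightarrow> x i \<otimes> x j = x j \<otimes> x i"
  shows "cprod G (\<lambda>j. cprod G x s (m j)) k c = cprod G x s (\<lambda>i. \<Sum>j<k. m j i * c j)"
  using assms by (induction k) (simp_all add: cprod_zero cprod_add cprod_int_pow)

lemma conj_cprod:
  assumes "y \<in> carrier G" "\<And>i. i < k \<Longrightarrow> x i \<in> carrier G"
    and "\<And>i. i < k \<Longrightarrow> y \<otimes> x i \<otimes> inv y = z i"
  shows "y \<otimes> cprod G x k c \<otimes> inv y = cprod G z k c"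
  using assms
proof (induction k)
  case (Suc k)
  interpret h: group_hom G G "\<lambda>u. y \<otimes> u \<otimes> inv y" using conj_hom Suc.prems(1) .
  have "y \<otimes> (cprod G x k c \<otimes> x k [^] c k) \<otimes> inv y = (y \<otimes> cprod G x k c \<otimes> inv y) \<otimes> (y \<otimes> x k [^] c k \<otimes> inv y)"
    using Suc.prems by (intro h.hom_mult) auto
  then show ?case using Suc h.hom_int_pow[of "x k" "c k"] by simp
qed simp

lemma word_val_closed:
  "\<phi> ` X \<subseteq> carrier G \<Longrightarrow> w \<in> words X \<Longrightarrow> word_val G \<phi> w \<in> carrier G"
  by (induction w) (auto simp: word_val_def words_def)

lemma word_val_append:
  assumes "\<phi> ` X \<subseteq> carrier G" "u \<in> words X" "v \<in> words X"
  shows "word_val G \<phi> (u @ v) = word_val G \<phi> u \<otimes> word_val G \<phi> v"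
  using assms(2)
proof (induction u)
  case Nil
  then show ?case using word_val_closed[OF assms(1,3)] by (simp add: word_val_def)
next
  case (Cons a u)
  have "u \<in> words X" using Cons.prems by (auto simp: words_def)
  then have cl: "word_val G \<phi> u \<in> carrier G" "word_val G \<phi> v \<in> carrier G"
    using word_val_closed[OF assms(1)] assms(3) by auto
  obtain x e where a: "a = (x, e)" by force
  have "\<phi> x \<in> carrier G" using Cons.prems assms(1) by (auto simp: a words_def)
  then show ?case using Cons.IH[OF \<open>u \<in> words X\<close>] cl
    by (simp add: word_val_def a m_assoc)
qed

lemma word_val_gen_power:
  assumes "\<phi> x \<in> carrier G"
  shows "word_val G \<phi> (gen_power x k) = \<phi> x [^] k"
proof -
  have pow: "word_val G \<phi> (replicate m (x, e)) = (if e then \<phi> x else inv (\<phi> x)) [^] m" for m e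
  proof (induction m)
    case (Suc m)
    then show ?case using assms nat_pow_Suc2[of "if e then \<phi> x else inv (\<phi> x)" m]
      by (simp add: word_val_def)
  qed (simp add: word_val_def)
  show ?thesis
  proof (cases "k \<ge> 0")
    case True
    then show ?thesis using int_pow_int[of G "\<phi> x" "nat k"] by (simp add: gen_power_def pow)
  next
    case False
    then show ?thesis using assms int_pow_neg_int[of "\<phi> x" "nat (- k)"] 
      by (simp add: gen_power_def pow int_pow_inv)
  qed
qed

lemma word_val_normal:
  assumes "\<phi> ` gens n s \<subseteq> carrier G" 
  shows "word_val G \<phi> (concat (map (\<lambda>i. gen_power (B i) (c i)) [0..<s])) = cprod G (\<lambda>i. \<phi> (B i)) s c"
proof -
  have gp: "gen_power (B i) k \<in> words (gens n s)" if "i < s" for i k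
    using that by (auto simp: gen_power_def words_def gens_def)
  have "word_val G \<phi> (concat (map (\<lambda>i. gen_power (B i) (c i)) [0..<k])) = cprod G (\<lambda>i. \<phi> (B i)) k c"
    if "k \<le> s" for k
    using that
  proof (induction k)
    case (Suc k)
    have "concat (map (\<lambda>i. gen_power (B i) (c i)) [0..<k]) \<in> words (gens n s)"
      using Suc.prems gp by (intro words_concat) auto
    moreover have "\<phi> (B k) \<in> carrier G" using assms Suc.prems by (auto simp: gens_def)
    ultimately show ?case using Suc gp[of k] word_val_append[OF assms]
      by (simp add: word_val_gen_power)
  qed (simp add: word_val_def)
  then show ?thesis by simp
qed


end

text \<open>The twists that enter the coordinates of a word lie in the image of some \<open>N\<^sub>t\<close> and are
  killed by \<open>N\<^sub>l\<close>.  Hence \<open>N\<^sub>l\<close> sees only the letters of the word, not their order.\<close>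
lemma nilpart_coord:
  assumes nil: "\<And>l t i j k. l < n \<Longrightarrow> t < n \<Longrightarrow> nilpart n s M l i j * nilpart n s M t j k = 0"
    and l: "l < n" and w: "w \<in> words (gens n s)"
  shows "(\<Sum>j<s. nilpart n s M l i j * b_coord (nilpart n s M) w j) =
    (\<Sum>y\<leftarrow>w. twist (nilpart n s M) (Q l, True) y i)"
  using w
proof (induction w)
  case (Cons x w)
  let ?N = "nilpart n s M"
  have "(\<Sum>j<s. ?N l i j * (\<Sum>y\<leftarrow>w. twist ?N x y j)) = 0"
  proof (intro sum.neutral ballI)
    fix j
    have "?N l i j * twist ?N x y j = 0" for y
    proof (cases "fst x"; cases "fst y")
      fix t k assume t: "fst x = Q t" "fst y = B k"
      then have "t < n" using Cons.prems by (auto simp: words_def gens_def)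
      then have "?N l i j * ?N t j k = 0" using nil l by blast
      then show ?thesis using t by (cases x; cases y) auto
    qed (cases x; cases y; simp)+
    then show "?N l i j * (\<Sum>y\<leftarrow>w. twist ?N x y j) = 0"
      by (simp add: sum_list_const_mult[symmetric] del: mult_eq_0_iff)
  qed
  moreover have "(\<Sum>j<s. ?N l i j * b_exp x j) = twist ?N (Q l, True) x i"
  proof (cases x)
    case (Pair g e)
    show ?thesis
    proof (cases g)
      case (B k)
      then have "k < s" using Cons.prems by (auto simp: words_def gens_def Pair)
      then show ?thesis by (simp add: Pair B if_distrib[of "times _"] cong: if_cong)
    qed (simp add: Pair)
  qed
  moreover have "w \<in> words (gens n s)" using Cons.prems by (auto simp: words_def)
  ultimately show ?case using Cons.IH by (simp add: distrib_left sum.distrib)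
qed simp

text \<open>The normal form \<open>b\<^sup>c q\<^sup>a\<close> of a word, by adding letters on the left: a letter \<open>B j\<close> joins the first
  factor, and a letter \<open>Q l\<close> is moved past the first factor by conjugation and joins the second.\<close>
lemma (in group) word_val_coordinates:
  assumes pres: "has_presentation G \<phi> (gens n s) (family_relations n s M)"
    and nil: "\<And>l t i j k. l < n \<Longrightarrow> t < n \<Longrightarrow> nilpart n s M l i j * nilpart n s M t j k = 0"
    and carr: "\<And>l. l < n \<Longrightarrow> M l \<in> carrier_mat s s"
    and w: "w \<in> words (gens n s)"
  shows "word_val G \<phi> w = cprod G (\<lambda>i. \<phi> (B i)) s (b_coord (nilpart n s M) w) \<otimes>
    cprod G (\<lambda>l. \<phi> (Q l)) n (q_exps w)"
proof -
  let ?N = "nilpart n s M"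
  let ?b = "\<lambda>i. \<phi> (B i)" and ?q = "\<lambda>l. \<phi> (Q l)"
  have gens: "\<phi> ` gens n s \<subseteq> carrier G" using pres by (simp add: has_presentation_def)
  have b: "?b i \<in> carrier G" if "i < s" for i using gens that by (auto simp: gens_def)
  have q: "?q l \<in> carrier G" if "l < n" for l using gens that by (auto simp: gens_def)
  have rel: "word_val G \<phi> r = word_val G \<phi> r'"
    if "(r, r') \<in> family_relations n s M" "r \<in> words (gens n s)" "r' \<in> words (gens n s)" for r r'
    using pres that pres_eq.relation[OF that(1), of "gens n s" "[]" "[]"]
    by (simp add: has_presentation_def)
  have comm: "\<phi> x \<otimes> \<phi> y = \<phi> y \<otimes> \<phi> x"
    if "(commutator_word x y, []) \<in> family_relations n s M" "x \<in> gens n s" "y \<in> gens n s" for x y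
  proof -
    have cl: "\<phi> x \<in> carrier G" "\<phi> y \<in> carrier G" using gens that by auto
    have "word_val G \<phi> (commutator_word x y) = word_val G \<phi> []"
      using that by (intro rel) (auto simp: words_def commutator_word_def)
    then have "(\<phi> x \<otimes> \<phi> y) \<otimes> inv (\<phi> y \<otimes> \<phi> x) = \<one>"
      using cl by (simp add: word_val_def commutator_word_def m_assoc inv_mult_group)
    then show ?thesis using cl by (metis inv_closed inv_equality inv_inv m_closed)
  qed
  have bb: "?b i \<otimes> ?b j = ?b j \<otimes> ?b i" if "i < s" "j < s" for i j
    using that by (intro comm) (auto simp: family_relations_def gens_def)
  have qq: "?q i \<otimes> ?q j = ?q j \<otimes> ?q i" if "i < n" "j < n" for i j
    using that by (intro comm) (auto simp: family_relations_def gens_def)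
  have conj_gen: "?q l \<otimes> ?b j \<otimes> inv (?q l) = cprod G ?b s (\<lambda>i. M l $$ (i, j))"
    if "l < n" "j < s" for l j
  proof -
    have "word_val G \<phi> [(Q l, True), (B j, True), (Q l, False)] =
      word_val G \<phi> (concat (map (\<lambda>i. gen_power (B i) (M l $$ (i, j))) [0..<s]))"
      using that by (intro rel) (auto simp: family_relations_def words_def gens_def gen_power_def)
    then show ?thesis using that b q
      by (simp add: word_val_normal[OF gens] m_assoc) (simp add: word_val_def m_assoc)
  qed
  have conj: "?q l \<otimes> cprod G ?b s c \<otimes> inv (?q l) = cprod G ?b s (\<lambda>i. c i + (\<Sum>j<s. ?N l i j * c j))"
    if l: "l < n" for l c
  proof -
    have "?q l \<otimes> cprod G ?b s c \<otimes> inv (?q l) = cprod G (\<lambda>j. cprod G ?b s (\<lambda>i. M l $$ (i, j))) s c"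
      using conj_gen l q b by (intro conj_cprod) auto
    also have "\<dots> = cprod G ?b s (\<lambda>i. \<Sum>j<s. M l $$ (i, j) * c j)"
      using b bb by (rule cprod_matrix)
    also have "\<dots> = cprod G ?b s (\<lambda>i. c i + (\<Sum>j<s. ?N l i j * c j))"
    proof (rule cprod_cong)
      fix i assume i: "i < s"
      have "(\<Sum>j<s. M l $$ (i, j) * c j) = (\<Sum>j<s. (if i = j then c j else 0) + ?N l i j * c j)"
        using carr[OF l] l i by (intro sum.cong) (auto simp: nilpart_def algebra_simps)
      then show "(\<Sum>j<s. M l $$ (i, j) * c j) = c i + (\<Sum>j<s. ?N l i j * c j)"
        using i by (simp add: sum.distrib)
    qed
    finally show ?thesis .
  qed
  have conj_inv: "inv (?q l) \<otimes> cprod G ?b s c \<otimes> ?q l = cprod G ?b s (\<lambda>i. c i - (\<Sum>j<s. ?N l i j * c j))"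
    (is "_ = cprod G ?b s ?c'") if l: "l < n" for l c
  proof -
    have "(\<Sum>j<s. ?N l i j * (\<Sum>k<s. ?N l j k * c k)) = 0" for i
      using nil[OF l l] by (intro sum.neutral ballI) (simp add: sum_distrib_left mult.assoc[symmetric] del: mult_eq_0_iff)
    then have "(\<lambda>i. ?c' i + (\<Sum>j<s. ?N l i j * ?c' j)) = c"
      by (simp add: right_diff_distrib sum_subtractf)
    then have "?q l \<otimes> cprod G ?b s ?c' \<otimes> inv (?q l) = cprod G ?b s c" using conj[OF l, of ?c'] by simp
    moreover have "cprod G ?b s ?c' \<in> carrier G" using b by simp
    moreover from this have "inv (?q l) \<otimes> (?q l \<otimes> cprod G ?b s ?c' \<otimes> inv (?q l)) \<otimes> ?q l =
        (inv (?q l) \<otimes> ?q l) \<otimes> cprod G ?b s ?c' \<otimes> (inv (?q l) \<otimes> ?q l)"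
      using q[OF l] by (simp only: m_assoc m_closed inv_closed)
    ultimately show ?thesis using q[OF l] by simp
  qed
  show ?thesis
    using w
  proof (induction w)
    case Nil
    have "q_exps [] = (\<lambda>l. 0)" "b_coord ?N [] = (\<lambda>i. 0)" by (auto simp: q_exps_def)
    then show ?case using b q by (simp add: cprod_zero word_val_def)
  next
    case (Cons x w)
    let ?c = "b_coord ?N w"
    have w: "w \<in> words (gens n s)" using Cons.prems by (auto simp: words_def)
    have cl: "cprod G ?b s c \<in> carrier G" "cprod G ?q n a \<in> carrier G" for c a using b q by auto
    have ih: "word_val G \<phi> w = cprod G ?b s ?c \<otimes> cprod G ?q n (q_exps w)" using Cons.IH w .
    obtain g e where x: "x = (g, e)" by force
    show ?case
    proof (cases g)
      case (B j)
      then have j: "j < s" using Cons.prems by (auto simp: words_def gens_def x)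
      have "cprod G ?b s (\<lambda>i. (if j = i then sgn_of e else 0) + ?c i) = ?b j [^] sgn_of e \<otimes> cprod G ?b s ?c"
        using b bb j by (simp add: cprod_add cprod_unit)
      moreover have "b_coord ?N (x # w) = (\<lambda>i. (if j = i then sgn_of e else 0) + ?c i)"
        by (auto simp: x B)
      moreover have "q_exps (x # w) = q_exps w" by (auto simp: q_exps_def x B)
      moreover have "word_val G \<phi> (x # w) = ?b j [^] sgn_of e \<otimes> word_val G \<phi> w"
        using b[OF j] by (cases e) (simp_all add: word_val_def x B int_pow_neg)
      ultimately show ?thesis using ih b[OF j] cl by (simp add: m_assoc)
    next
      case (Q l)
      then have l: "l < n" using Cons.prems by (auto simp: words_def gens_def x)
      define y where "y = (if e then ?q l else inv (?q l))"
      have y: "y \<in> carrier G" "y = ?q l [^] sgn_of e" using q[OF l] by (auto simp: y_def int_pow_neg)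
      have "y \<otimes> cprod G ?b s ?c \<otimes> inv y =
        cprod G ?b s (\<lambda>i. ?c i + sgn_of e * (\<Sum>j<s. ?N l i j * ?c j))"
        using conj[OF l] conj_inv[OF l] q[OF l] by (simp add: y_def)
      also have "(\<lambda>i. ?c i + sgn_of e * (\<Sum>j<s. ?N l i j * ?c j)) = b_coord ?N (x # w)"
      proof
        fix i
        have "sgn_of e * (\<Sum>y\<leftarrow>w. twist ?N (Q l, True) y i) = (\<Sum>y\<leftarrow>w. twist ?N x y i)"
          by (cases e) (simp_all add: x Q twist_False uminus_sum_list_map o_def)
        then show "?c i + sgn_of e * (\<Sum>j<s. ?N l i j * ?c j) = b_coord ?N (x # w) i"
          using nilpart_coord[OF nil l w] by (simp add: x Q)
      qed
      finally have 1: "y \<otimes> cprod G ?b s ?c \<otimes> inv y = cprod G ?b s (b_coord ?N (x # w))" .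
      have "q_exps (x # w) = (\<lambda>i. (if l = i then sgn_of e else 0) + q_exps w i)"
        by (auto simp: q_exps_def x Q)
      then have 2: "cprod G ?q n (q_exps (x # w)) = y \<otimes> cprod G ?q n (q_exps w)"
        using q qq l by (simp add: cprod_add cprod_unit y(2))
      have "word_val G \<phi> (x # w) = y \<otimes> word_val G \<phi> w"
        by (simp add: word_val_def x Q y_def)
      also have "\<dots> = y \<otimes> cprod G ?b s ?c \<otimes> (inv y \<otimes> (y \<otimes> cprod G ?q n (q_exps w)))"
        using cl y(1) by (simp add: ih m_assoc[symmetric])
      also have "\<dots> = (y \<otimes> cprod G ?b s ?c \<otimes> inv y) \<otimes> (y \<otimes> cprod G ?q n (q_exps w))"
        using cl y(1) by (simp only: m_assoc m_closed inv_closed)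
      finally show ?thesis unfolding 1 2 .
    qed
  qed
qed

text \<open>The coordinates are invariant under the defining relations, and the normal form can be computed from
  them.\<close>
lemma (in group) word_val_eq_iff:
  assumes pres: "has_presentation G \<phi> (gens n s) (family_relations n s M)"
    and nil: "\<And>l t i j k. l < n \<Longrightarrow> t < n \<Longrightarrow> nilpart n s M l i j * nilpart n s M t j k = 0"
    and carr: "\<And>l. l < n \<Longrightarrow> M l \<in> carrier_mat s s"
    and u: "u \<in> words (gens n s)" and v: "v \<in> words (gens n s)"
  shows "word_val G \<phi> u = word_val G \<phi> v \<longleftrightarrow> q_exps u = q_exps v \<and> 
    (\<forall>i<s. b_coord (nilpart n s M) u i = b_coord (nilpart n s M) v i)"
proof
  assume eq: "q_exps u = q_exps v \<and> (\<forall>i<s. b_coord (nilpart n s M) u i = b_coord (nilpart n s M) v i)"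
  have "cprod G (\<lambda>i. \<phi> (B i)) s (b_coord (nilpart n s M) u) = cprod G (\<lambda>i. \<phi> (B i)) s (b_coord (nilpart n s M) v)"
    by (rule cprod_cong) (rule conjunct2[OF eq, rule_format])
  moreover have "word_val G \<phi> u = cprod G (\<lambda>i. \<phi> (B i)) s (b_coord (nilpart n s M) u) \<otimes>
      cprod G (\<lambda>l. \<phi> (Q l)) n (q_exps u)"
    using nil carr u by (rule word_val_coordinates[OF pres])
  moreover have "word_val G \<phi> v = cprod G (\<lambda>i. \<phi> (B i)) s (b_coord (nilpart n s M) v) \<otimes>
      cprod G (\<lambda>l. \<phi> (Q l)) n (q_exps v)"
    using nil carr v by (rule word_val_coordinates[OF pres])
  ultimately show "word_val G \<phi> u = word_val G \<phi> v"
    using eq by (simp only:)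
next
  assume "word_val G \<phi> u = word_val G \<phi> v"
  then have "pres_eq (gens n s) (family_relations n s M) u v"
    using pres u v by (simp add: has_presentation_def)
  then have "indist (nilpart n s M) u v" using nil carr by (intro indist_pres_eq) auto
  then show "q_exps u = q_exps v \<and> 
    (\<forall>i<s. b_coord (nilpart n s M) u i = b_coord (nilpart n s M) v i)"
    by (simp add: indist_def)
qed

definition commutator_coord :: "('l \<Rightarrow> 'l \<Rightarrow> 'i \<Rightarrow> int) \<Rightarrow> 'l list \<Rightarrow> 'l list \<Rightarrow> 'l \<Rightarrow> 'i \<Rightarrow> int" where
  "commutator_coord tw u v x i = (\<Sum>y\<leftarrow>u. tw x y i) - (\<Sum>y\<leftarrow>v. tw y x i)"

text \<open>The equation is \<open>w u = v w\<close>.  The coordinates of \<open>w\<close> itself, the only part that is not linear in \<open>w\<close>,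
  occur on both sides and cancel.  What remains is affine in the letters of \<open>w\<close> and independent of
  their order.\<close>
lemma (in group) conjugator_iff:
  assumes pres: "has_presentation G \<phi> (gens n s) (family_relations n s M)"
    and nil: "\<And>l t i j k. l < n \<Longrightarrow> t < n \<Longrightarrow> nilpart n s M l i j * nilpart n s M t j k = 0"
    and carr: "\<And>l. l < n \<Longrightarrow> M l \<in> carrier_mat s s"
    and u: "u \<in> words (gens n s)" and v: "v \<in> words (gens n s)" and w: "w \<in> words (gens n s)"
  shows "word_val G \<phi> w \<otimes> word_val G \<phi> u \<otimes> inv (word_val G \<phi> w) = word_val G \<phi> v \<longleftrightarrow>
    q_exps u = q_exps v \<and> (\<forall>i<s. b_coord (nilpart n s M) u i - b_coord (nilpart n s M) v i +
      (\<Sum>x\<leftarrow>w. commutator_coord (twist (nilpart n s M)) u v x i) = 0)"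
proof -
  let ?N = "nilpart n s M"
  have gens: "\<phi> ` gens n s \<subseteq> carrier G" using pres by (simp add: has_presentation_def)
  have Q: "q_exps (w @ u) = q_exps (v @ w) \<longleftrightarrow> q_exps u = q_exps v"
    by (auto simp: q_exps_def fun_eq_iff)
  have C: "b_coord ?N (w @ u) i = b_coord ?N (v @ w) i \<longleftrightarrow> b_coord ?N u i - b_coord ?N v i +
      (\<Sum>x\<leftarrow>w. commutator_coord (twist ?N) u v x i) = 0" for i
    unfolding coord_append commutator_coord_def sum_list_subtractf sum_list_swap[of _ v w]
    by auto
  have "word_val G \<phi> w \<otimes> word_val G \<phi> u \<otimes> inv (word_val G \<phi> w) = word_val G \<phi> v \<longleftrightarrow>
    word_val G \<phi> w \<otimes> word_val G \<phi> u = word_val G \<phi> v \<otimes> word_val G \<phi> w"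
    using word_val_closed[OF gens] u v w by (intro inv_solve_right') auto
  also have "\<dots> \<longleftrightarrow> word_val G \<phi> (w @ u) = word_val G \<phi> (v @ w)"
    using word_val_append[OF gens] u v w by simp
  also have "\<dots> \<longleftrightarrow> q_exps (w @ u) = q_exps (v @ w) \<and> (\<forall>i<s. b_coord ?N (w @ u) i = b_coord ?N (v @ w) i)"
    by (rule word_val_eq_iff[OF pres]) (use nil carr u v w in \<open>simp_all add: words_def\<close>)
  finally show ?thesis by (simp only: Q C)
qed

section \<open>Counter programs on Turing machines\<close>

text \<open>While programs that act on one tape of symbols and on integer registers.  One \<open>Step\<close> may write a
  letter, move the head of the tape, and change every register by at most one.  A register will be
  the head position on a tape of its own, so a test sees only whether it is zero; a sign can
  not be tested.\<close>
datatype ('l, 'r) com =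
    Step "'l option" move "'r \<Rightarrow> move"
  | Seq "('l, 'r) com" "('l, 'r) com"
  | Cond "'l cell \<Rightarrow> ('r \<Rightarrow> bool) \<Rightarrow> bool" "('l, 'r) com" "('l, 'r) com"
  | Loop "'l cell \<Rightarrow> ('r \<Rightarrow> bool) \<Rightarrow> bool" "('l, 'r) com"

type_synonym ('l, 'r) store = "'l cell tape \<times> ('r \<Rightarrow> int)"

text \<open>A list of commands, to be executed one after the other, serves as control state.\<close>
fun ctrl :: "('l, 'r) com list \<Rightarrow> 'l cell \<Rightarrow> ('r \<Rightarrow> bool) \<Rightarrow>
    ('l, 'r) com list \<times> 'l option \<times> move \<times> ('r \<Rightarrow> move)" where
  "ctrl [] a z = ([], None, Stay, \<lambda>_. Stay)"
| "ctrl (Step w m d # K) a z = (K, w, m, d)"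
| "ctrl (Seq c c' # K) a z = (c # c' # K, None, Stay, \<lambda>_. Stay)"
| "ctrl (Cond b c c' # K) a z = ((if b a z then c else c') # K, None, Stay, \<lambda>_. Stay)"
| "ctrl (Loop b c # K) a z = (if b a z then c # Loop b c # K else K, None, Stay, \<lambda>_. Stay)"

text \<open>All control states that can occur while \<open>c\<close> is executed in front of \<open>K\<close>.  That they are finitely many is
  what makes them the states of a machine.\<close>
fun stacks :: "('l, 'r) com \<Rightarrow> ('l, 'r) com list \<Rightarrow> ('l, 'r) com list set" where
  "stacks (Step w m d) K = {Step w m d # K}"
| "stacks (Seq c c') K = insert (Seq c c' # K) (stacks c (c' # K) \<union> stacks c' K)"
| "stacks (Cond b c c') K = insert (Cond b c c' # K) (stacks c K \<union> stacks c' K)"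
| "stacks (Loop b c) K = insert (Loop b c # K) (stacks c (Loop b c # K))"

lemma finite_stacks: "finite (stacks c K)"
  by (induction c arbitrary: K) auto

lemma stacks_self: "c # K \<in> stacks c K"
  by (cases c) auto

lemma stacks_closed: "L \<in> stacks c K \<Longrightarrow> fst (ctrl L a z) \<in> insert K (stacks c K)"
proof (induction c arbitrary: K)
  case (Seq c c')
  show ?case
    using Seq.prems Seq.IH(1)[of "c' # K"] Seq.IH(2)[of K] stacks_self[of c "c' # K"] stacks_self[of c' K] by auto
next
  case (Cond b c c')
  show ?case
    using Cond.prems Cond.IH(1)[of K] Cond.IH(2)[of K] stacks_self[of c K] stacks_self[of c' K] by auto
next
  case (Loop b c)
  show ?case
    using Loop.prems Loop.IH[of "Loop b c # K"] stacks_self[of c "Loop b c # K"]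
    by (auto split: if_splits)
qed simp

locale counter_machine =
  fixes A :: "'l set" and rs :: "'r list"
  assumes finite_letters: "finite A"
begin

definition zeros :: "('r \<Rightarrow> int) \<Rightarrow> 'r \<Rightarrow> bool" where
  "zeros r x \<longleftrightarrow> x \<in> set rs \<and> r x = 0"

text \<open>Letters outside of \<open>A\<close> are replaced by a blank, so that every program gives a well-formed machine.\<close>
definition written :: "'l option \<Rightarrow> 'l cell \<Rightarrow> 'l cell" where
  "written w a = (case w of None \<Rightarrow> a | Some l \<Rightarrow> if l \<in> A then Sym l else Blank)"

definition cstep :: "('l, 'r) com list \<times> ('l, 'r) store \<Rightarrow> ('l, 'r) com list \<times> ('l, 'r) store" where
  "cstep = (\<lambda>(K, T, r). case ctrl K (scan T) (zeros r) of (K', w, m, d) \<Rightarrow>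
     (K', act (written w (scan T), m) T, \<lambda>x. r x + offset (d x)))"

text \<open>Quantifying over the rest \<open>K\<close> of the program makes executions composable.\<close>
definition runs :: "('l, 'r) com \<Rightarrow> ('l, 'r) store \<Rightarrow> nat \<Rightarrow> ('l, 'r) store \<Rightarrow> bool" where
  "runs c s t s' \<longleftrightarrow> (\<forall>K. (cstep ^^ t) (c # K, s) = (K, s'))"

text \<open>The mark in cell \<open>0\<close> is never overwritten, so the tape always represents its head position.\<close>
definition counter_tape :: "int \<Rightarrow> 'l cell tape" where
  "counter_tape p = (p, \<lambda>i. if i = 0 then Aux 0 else Blank)"

definition store_tapes :: "('l, 'r) store \<Rightarrow> 'l cell tape list" where
  "store_tapes s = fst s # map (\<lambda>x. counter_tape (snd s x)) rs"

text \<open>The state \<open>None\<close> comes first.  It puts the marks on the counter tapes, which are blank at the beginning.\<close>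
definition compiled :: "(('l, 'r) com list option \<Rightarrow> nat) \<Rightarrow> (nat \<Rightarrow> ('l, 'r) com list option) \<Rightarrow> ('l, 'r) com \<Rightarrow> 'l cell tm" where
  "compiled enc dec c =
     \<lparr> tapes = Suc (length rs),
       states = enc ` insert None (Some ` insert [] (stacks c [])),
       alphabet = insert Blank (insert Sep (insert (Aux 0) (Sym ` A))),
       start = enc None,
       final = enc (Some []),
       delta = (\<lambda>p as. case dec p of
           None \<Rightarrow> (enc (Some [c]), (hd as, Stay) # map (\<lambda>_. (Aux 0, Stay)) rs)
         | Some K \<Rightarrow> (case ctrl K (hd as) (\<lambda>x. (x, Aux 0) \<in> set (zip rs (tl as))) of (K', w, m, d) \<Rightarrow>
             (enc (Some K'), (written w (hd as), m) # map2 (\<lambda>x a. (a, d x)) rs (tl as)))) \<rparr>"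

lemma act_scan: "act (scan T, m) T = (fst T + offset m, snd T)"
  by (simp add: act_def scan_def)

lemma scan_counter_tape: "scan (counter_tape p) = (if p = 0 then Aux 0 else Blank)"
  by (simp add: counter_tape_def scan_def)

lemma zip_map_self: "zip xs (map f xs) = map (\<lambda>x. (x, f x)) xs"
  by (induction xs) auto

text \<open>One machine step simulates one program step.  This includes the final state, where both do
  nothing.\<close>
lemma step_compiled:
  assumes inj: "\<And>S. S \<in> insert None (Some ` insert [] (stacks c [])) \<Longrightarrow> dec (enc S) = S"
    and K: "K \<in> insert [] (stacks c [])"
  shows "step (compiled enc dec c) (enc (Some K), store_tapes s) =
    map_prod (enc \<circ> Some) store_tapes (cstep (K, s))"
proof (cases "K = []")
  case True
  obtain T r where s: "s = (T, r)" by (cases s) auto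
  have "cstep ([], s) = ([], s)" by (simp add: cstep_def s written_def act_scan)
  then show ?thesis using True by (simp add: step_def compiled_def)
next
  case False
  obtain T r where s: "s = (T, r)" by (cases s) auto
  let ?M = "compiled enc dec c"
  have ne: "enc (Some K) \<noteq> final ?M"
  proof
    assume "enc (Some K) = final ?M"
    then have "dec (enc (Some K)) = dec (enc (Some []))" by (simp add: compiled_def)
    then show False using inj[of "Some K"] inj[of "Some []"] K False by auto
  qed
  have as: "map scan (store_tapes s) = scan T # map (\<lambda>x. scan (counter_tape (r x))) rs"
    by (simp add: store_tapes_def s o_def)
  have z: "(\<lambda>x. (x, Aux 0) \<in> (\<lambda>x. (x, scan (counter_tape (r x)))) ` set rs) = zeros r"
    by (auto simp: zip_map_self zeros_def fun_eq_iff image_iff scan_counter_tape split: if_splits)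
  obtain K' w m d where ctrl: "ctrl K (scan T) (zeros r) = (K', w, m, d)" by (metis prod_cases4)
  have "dec (enc (Some K)) = Some K" using inj K by auto
  then have "delta ?M (enc (Some K)) (map scan (store_tapes s)) =
      (enc (Some K'), (written w (scan T), m) # map (\<lambda>x. (scan (counter_tape (r x)), d x)) rs)"
    unfolding as by (simp add: compiled_def z ctrl zip_map_self o_def)
  moreover have "map2 act (map (\<lambda>x. (scan (counter_tape (r x)), d x)) rs) (map (\<lambda>x. counter_tape (r x)) rs) =
      map (\<lambda>x. counter_tape (r x + offset (d x))) rs"
    by (simp add: zip_map_map zip_same_conv_map o_def act_scan) (simp add: counter_tape_def)
  ultimately show ?thesis using ne
    by (simp add: step_def cstep_def s ctrl store_tapes_def)
qed

lemma steps_compiled: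
  assumes inj: "\<And>S. S \<in> insert None (Some ` insert [] (stacks c [])) \<Longrightarrow> dec (enc S) = S"
    and K: "K \<in> insert [] (stacks c [])"
  shows "(step (compiled enc dec c) ^^ t) (enc (Some K), store_tapes s) =
      map_prod (enc \<circ> Some) store_tapes ((cstep ^^ t) (K, s))"
    and "fst ((cstep ^^ t) (K, s)) \<in> insert [] (stacks c [])"
proof (induction t)
  case (Suc t)
  obtain K' s' where t: "(cstep ^^ t) (K, s) = (K', s')" by (cases "(cstep ^^ t) (K, s)") auto
  {
    case 1
    show ?case using Suc step_compiled[where K = K' and s = s', OF inj] by (simp add: t o_def)
  next
    case 2
    have "fst (cstep (K', s')) \<in> insert [] (stacks c [])"
    proof -
      obtain T r where s: "s' = (T, r)" by (cases s') auto
      have "fst (cstep (K', s')) = fst (ctrl K' (scan T) (zeros r))"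
        by (simp add: cstep_def s split: prod.splits)
      moreover have "K' = [] \<or> K' \<in> stacks c []" using Suc(2) t by simp
      ultimately show ?thesis using stacks_closed[of K' c "[]"] by auto
    qed
    then show ?case by (simp add: t)
  }
qed (use K in auto)

text \<open>The additional step is the one that marks the counter tapes.\<close>
theorem compile:
  "\<exists>M. wf_tm M \<and> insert Sep (Sym ` A) \<subseteq> alphabet M \<and>
     (\<forall>x t T r y. runs c (input_tape x, \<lambda>_. 0) t (T, r) \<longrightarrow> tape_holds T y \<longrightarrow>
        tm_outputs M x (Suc t) y)"
proof -
  let ?S = "insert None (Some ` insert [] (stacks c []))"
  have "finite ?S" by (simp add: finite_stacks)
  then obtain enc :: "('l, 'r) com list option \<Rightarrow> nat" where enc: "inj_on enc ?S"
    by (elim exE[OF finite_imp_inj_to_nat_seg] exE conjE) (rule that)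
  define dec where "dec = inv_into ?S enc"
  have inj: "dec (enc S) = S" if "S \<in> ?S" for S
    unfolding dec_def using enc that by (rule inv_into_f_f)
  let ?M = "compiled enc dec c"
  have "wf_tm ?M"
  proof -
    have "case delta ?M p as of (p', acts) \<Rightarrow>
        p' \<in> states ?M \<and> length acts = tapes ?M \<and> fst ` set acts \<subseteq> alphabet ?M"
      if p: "p \<in> states ?M" and as: "length as = tapes ?M" "set as \<subseteq> alphabet ?M" for p as
    proof -
      obtain S where S: "S \<in> ?S" "p = enc S" using p by (auto simp: compiled_def)
      obtain a as' where a: "as = a # as'" "length as' = length rs"
        using as(1) by (cases as) (auto simp: compiled_def)
      show ?thesis
      proof (cases S)
        case None
        then have "dec p = None" using inj S by simp
        then show ?thesis using as a stacks_self[of c "[]"] by (auto simp: compiled_def)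
      next
        case (Some K)
        obtain K' w m d where ctrl: "ctrl K a (\<lambda>x. (x, Aux 0) \<in> set (zip rs as')) = (K', w, m, d)"
          by (metis prod_cases4)
        have "K = [] \<or> K \<in> stacks c []" using S Some by auto
        then have K': "K' = [] \<or> K' \<in> stacks c []"
          using stacks_closed[of K c "[]" a "\<lambda>x. (x, Aux 0) \<in> set (zip rs as')"] ctrl by auto
        have delta: "delta ?M p as =
            (enc (Some K'), (written w a, m) # map2 (\<lambda>x a. (a, d x)) rs as')"
          using inj S Some by (simp add: compiled_def a ctrl)
        have "fst ` set (map2 (\<lambda>x a. (a, d x)) rs as') \<subseteq> set as'"
          by (auto dest: set_zip_rightD)
        moreover have "set as' \<subseteq> alphabet ?M" using as(2) a(1) by simp
        moreover have "written w a \<in> alphabet ?M"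
          using as(2) by (auto simp: a written_def compiled_def split: option.splits)
        moreover have "enc (Some K') \<in> states ?M" using K' by (auto simp: compiled_def)
        ultimately show ?thesis unfolding delta using a(2)
          by (simp add: image_Un) (simp add: compiled_def subset_iff)
      qed
    qed
    then show ?thesis using finite_stacks[of c "[]"] finite_letters
      unfolding wf_tm_def by (auto simp: compiled_def)
  qed
  moreover have "tm_outputs ?M x (Suc t) y"
    if run: "runs c (input_tape x, \<lambda>_. 0) t (T, r)" and y: "tape_holds T y" for x t T r y
  proof -
    have "enc None \<noteq> enc (Some [])" using inj[of None] inj[of "Some []"] by auto
    moreover have "act (Aux 0, Stay) (input_tape []) = counter_tape 0"
      by (auto simp: act_def input_tape_def counter_tape_def)
    moreover have "map2 act (map (\<lambda>_. (Aux 0, Stay)) xs) (replicate (length xs) T') =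
      map (\<lambda>_. act (Aux 0, Stay) T') xs" for xs :: "'r list" and T' :: "'l cell tape"
      by (induction xs) auto
    moreover have "delta ?M (enc None) as = (enc (Some [c]), (hd as, Stay) # map (\<lambda>_. (Aux 0, Stay)) rs)" for as
      using inj[of None] by (simp add: compiled_def)
    ultimately have "step ?M (init ?M x) = (enc (Some [c]), store_tapes (input_tape x, \<lambda>_. 0))"
      by (simp add: init_def step_def store_tapes_def act_scan)
         (simp add: compiled_def step_def store_tapes_def act_scan)
    then have "(step ?M ^^ Suc t) (init ?M x) = (step ?M ^^ t) (enc (Some [c]), store_tapes (input_tape x, \<lambda>_. 0))"
      by (simp add: funpow_Suc_right del: funpow.simps)
    also have "\<dots> = (enc (Some []), store_tapes (T, r))"
      using steps_compiled(1)[where K = "[c]" and t = t, OF inj] stacks_self[of c "[]"] run by (auto simp: runs_def)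
    finally show ?thesis using y by (simp add: tm_outputs_def store_tapes_def) (simp add: compiled_def)
  qed
  moreover have "insert Sep (Sym ` A) \<subseteq> alphabet ?M" by (auto simp: compiled_def)
  ultimately show ?thesis by blast
qed

section \<open>Polynomial-time programs\<close>

definition holds :: "('l cell \<Rightarrow> ('r \<Rightarrow> bool) \<Rightarrow> bool) \<Rightarrow> ('l, 'r) store \<Rightarrow> bool" where
  "holds b s = b (scan (fst s)) (zeros (snd s))"

lemma runs_Step:
  "runs (Step w m d) s 1 (act (written w (scan (fst s)), m) (fst s), \<lambda>x. snd s x + offset (d x))"
  by (cases s) (simp add: runs_def cstep_def)

lemma cstep_stay [simp]:
  "cstep (Seq c c' # K, s) = (c # c' # K, s)"
  "cstep (Cond b c c' # K, s) = ((if holds b s then c else c') # K, s)"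
  "cstep (Loop b c # K, s) = (if holds b s then c # Loop b c # K else K, s)"
  by (cases s; simp add: cstep_def written_def act_scan holds_def)+

lemma runs_Seq:
  assumes "runs c s t s1" "runs c' s1 t' s2"
  shows "runs (Seq c c') s (Suc (t' + t)) s2"
  using assms by (simp add: runs_def funpow_add funpow_Suc_right del: funpow.simps)

lemma runs_Cond:
  assumes "runs (if holds b s then c else c') s t s'"
  shows "runs (Cond b c c') s (Suc t) s'"
  using assms by (simp add: runs_def funpow_Suc_right del: funpow.simps)

lemma runs_Loop_stop: "\<not> holds b s \<Longrightarrow> runs (Loop b c) s 1 s"
  by (simp add: runs_def)

lemma runs_Loop_step:
  assumes "holds b s" "runs c s t s1" "runs (Loop b c) s1 t' s2"
  shows "runs (Loop b c) s (Suc (t' + t)) s2"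
  using assms by (simp add: runs_def funpow_add funpow_Suc_right del: funpow.simps)

text \<open>Total correctness in time polynomial in \<open>N\<close>.  The natural number \<open>N\<close> bounds the quantities on which the
  time depends, and \<open>x\<close> stands for auxiliary data that connect precondition and postcondition.  The degree
  must not depend on either, which is why it is chosen first.  The base \<open>N + 2\<close> absorbs constant factors
  into the exponent.\<close>
definition ptime ::
  "(nat \<Rightarrow> 'x \<Rightarrow> ('l, 'r) store \<Rightarrow> bool) \<Rightarrow> ('l, 'r) com \<Rightarrow>
   (nat \<Rightarrow> 'x \<Rightarrow> ('l, 'r) store \<Rightarrow> ('l, 'r) store \<Rightarrow> bool) \<Rightarrow> bool" where
  "ptime P c U \<longleftrightarrow> (\<exists>D. \<forall>N x s. P N x s \<longrightarrow>
     (\<exists>t s'. t \<le> (N + 2) ^ D \<and> runs c s t s' \<and> U N x s s'))"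

lemma ptimeI:
  "(\<And>N x s. P N x s \<Longrightarrow> \<exists>t s'. t \<le> (N + 2) ^ D \<and> runs c s t s' \<and> U N x s s') \<Longrightarrow> ptime P c U"
  by (auto simp: ptime_def)

lemma ptime_conseq:
  assumes "ptime P c U"
    and "\<And>N x s. P' N x s \<Longrightarrow> \<exists>y. P N y s \<and> (\<forall>s'. U N y s s' \<longrightarrow> U' N x s s')"
  shows "ptime P' c U'"
proof -
  obtain D where D: "\<And>N x s. P N x s \<Longrightarrow> \<exists>t s'. t \<le> (N + 2) ^ D \<and> runs c s t s' \<and> U N x s s'"
    using assms(1) unfolding ptime_def by blast
  show ?thesis
  proof (rule ptimeI)
    fix N x s assume "P' N x s"
    then obtain y where y: "P N y s" "\<And>s'. U N y s s' \<Longrightarrow> U' N x s s'" using assms(2) by blast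
    obtain t s' where "t \<le> (N + 2) ^ D" "runs c s t s'" "U N y s s'" using D[OF y(1)] by blast
    then show "\<exists>t s'. t \<le> (N + 2) ^ D \<and> runs c s t s' \<and> U' N x s s'" using y(2) by blast
  qed
qed

lemma poly_sum_bound:
  fixes t t' N :: nat
  assumes "t \<le> (N + 2) ^ D" "t' \<le> (N + 2) ^ E"
  shows "Suc (t' + t) \<le> (N + 2) ^ (D + E + 2)"
proof -
  have "(N + 2) ^ D \<le> (N + 2) ^ (D + E)" "(N + 2) ^ E \<le> (N + 2) ^ (D + E)"
    by (intro power_increasing; simp)+
  moreover have "1 \<le> (N + 2) ^ (D + E)" by simp
  ultimately have "Suc (t' + t) \<le> 3 * (N + 2) ^ (D + E)" using assms by linarith
  also have "\<dots> \<le> (N + 2) ^ 2 * (N + 2) ^ (D + E)"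
    by (intro mult_right_mono) (auto simp: power2_eq_square)
  also have "\<dots> = (N + 2) ^ (2 + (D + E))" by (simp only: power_add)
  finally show ?thesis by (simp only: add.commute)
qed

text \<open>A bound that is off by a constant factor \<open>C\<close> only affects the degree, since
  \<open>C * N + 2 \<le> (N + 2) ^ (C + 1)\<close>.\<close>
lemma ptime_scale:
  assumes "ptime P c U"
    and "\<And>N x s. P' N x s \<Longrightarrow> P (C * N) x s"
    and "\<And>N x s s'. P' N x s \<Longrightarrow> U (C * N) x s s' \<Longrightarrow> U' N x s s'"
  shows "ptime P' c U'"
proof -
  obtain D where D: "\<And>N x s. P N x s \<Longrightarrow> \<exists>t s'. t \<le> (N + 2) ^ D \<and> runs c s t s' \<and> U N x s s'"
    using assms(1) unfolding ptime_def by blast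
  show ?thesis
  proof (rule ptimeI)
    fix N x s assume P': "P' N x s"
    obtain t s' where t: "t \<le> (C * N + 2) ^ D" "runs c s t s'" "U (C * N) x s s'"
      using D[OF assms(2)[OF P']] by blast
    have "C + 1 \<le> 2 ^ C" by (induction C) auto
    also have "\<dots> \<le> (N + 2) ^ C" by (rule power_mono) auto
    finally have "(N + 2) * (C + 1) \<le> (N + 2) * (N + 2) ^ C" by (rule mult_left_mono) simp
    then have "C * N + 2 \<le> (N + 2) ^ (C + 1)" by (simp add: algebra_simps)
    then have "(C * N + 2) ^ D \<le> ((N + 2) ^ (C + 1)) ^ D" by (rule power_mono) simp
    also have "\<dots> = (N + 2) ^ ((C + 1) * D)" by (simp only: power_mult)
    finally have "t \<le> (N + 2) ^ ((C + 1) * D)" using t(1) by (rule order_trans[rotated])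
    then show "\<exists>t s'. t \<le> (N + 2) ^ ((C + 1) * D) \<and> runs c s t s' \<and> U' N x s s'"
      using t(2) assms(3)[OF P' t(3)] by blast
  qed
qed

lemma ptime_Step:
  assumes "\<And>N x s. P N x s \<Longrightarrow>
    U N x s (act (written w (scan (fst s)), m) (fst s), \<lambda>x. snd s x + offset (d x))"
  shows "ptime P (Step w m d) U"
proof (rule ptimeI)
  fix N x s assume "P N x s"
  then show "\<exists>t s'. t \<le> (N + 2) ^ 0 \<and> runs (Step w m d) s t s' \<and> U N x s s'"
    using runs_Step[of w m d s] assms[of N x s] by (intro exI[of _ 1] exI conjI) auto
qed

lemma ptime_Seq:
  assumes "ptime P c U" "ptime P' c' U'"
    and "\<And>N x s. R N x s \<Longrightarrow> \<exists>y. P N y s \<and> (\<forall>s1. U N y s s1 \<longrightarrow>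
      (\<exists>z. P' N z s1 \<and> (\<forall>s2. U' N z s1 s2 \<longrightarrow> S N x s s2)))"
  shows "ptime R (Seq c c') S"
proof -
  obtain D where D: "\<And>N x s. P N x s \<Longrightarrow> \<exists>t s'. t \<le> (N + 2) ^ D \<and> runs c s t s' \<and> U N x s s'"
    using assms(1) unfolding ptime_def by blast
  obtain E where E: "\<And>N x s. P' N x s \<Longrightarrow> \<exists>t s'. t \<le> (N + 2) ^ E \<and> runs c' s t s' \<and> U' N x s s'"
    using assms(2) unfolding ptime_def by blast
  show ?thesis
  proof (rule ptimeI[where D = "D + E + 2"])
    fix N x s assume "R N x s"
    then obtain y where y: "P N y s" "\<And>s1. U N y s s1 \<Longrightarrow>
      (\<exists>z. P' N z s1 \<and> (\<forall>s2. U' N z s1 s2 \<longrightarrow> S N x s s2))" using assms(3) by blast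
    obtain t s1 where 1: "t \<le> (N + 2) ^ D" "runs c s t s1" "U N y s s1" using D y(1) by blast
    then obtain z where z: "P' N z s1" "\<And>s2. U' N z s1 s2 \<Longrightarrow> S N x s s2" using y(2) by blast
    then obtain t' s2 where 2: "t' \<le> (N + 2) ^ E" "runs c' s1 t' s2" "U' N z s1 s2" using E by blast
    then show "\<exists>t s'. t \<le> (N + 2) ^ (D + E + 2) \<and> runs (Seq c c') s t s' \<and> S N x s s'"
      using runs_Seq[OF 1(2) 2(2)] poly_sum_bound[OF 1(1) 2(1)] z(2) by blast
  qed
qed

lemma ptime_Cond:
  assumes "ptime (\<lambda>N x s. P N x s \<and> holds b s) c U" "ptime (\<lambda>N x s. P N x s \<and> \<not> holds b s) c' U"
  shows "ptime P (Cond b c c') U"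
proof -
  obtain D where D: "\<And>N x s. P N x s \<and> holds b s \<Longrightarrow>
    \<exists>t s'. t \<le> (N + 2) ^ D \<and> runs c s t s' \<and> U N x s s'"
    using assms(1) unfolding ptime_def by blast
  obtain E where E: "\<And>N x s. P N x s \<and> \<not> holds b s \<Longrightarrow>
    \<exists>t s'. t \<le> (N + 2) ^ E \<and> runs c' s t s' \<and> U N x s s'"
    using assms(2) unfolding ptime_def by blast
  show ?thesis
  proof (rule ptimeI[where D = "D + E + 2"])
    fix N x s assume P: "P N x s"
    show "\<exists>t s'. t \<le> (N + 2) ^ (D + E + 2) \<and> runs (Cond b c c') s t s' \<and> U N x s s'"
    proof (cases "holds b s")
      case True
      then obtain t s' where "t \<le> (N + 2) ^ D" "runs c s t s'" "U N x s s'" using D P by blast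
      then have "Suc t \<le> (N + 2) ^ (D + E + 2)" "runs (Cond b c c') s (Suc t) s'"
        using runs_Cond[of b s c c' t s'] True poly_sum_bound[of t N D 0 E] by simp_all
      then show ?thesis using \<open>U N x s s'\<close> by blast
    next
      case False
      then obtain t s' where "t \<le> (N + 2) ^ E" "runs c' s t s'" "U N x s s'" using E P by blast
      then have "Suc t \<le> (N + 2) ^ (D + E + 2)" "runs (Cond b c c') s (Suc t) s'"
        using runs_Cond[of b s c c' t s'] False poly_sum_bound[of 0 N D t E] by simp_all
      then show ?thesis using \<open>U N x s s'\<close> by blast
    qed
  qed
qed

text \<open>The first argument of the invariant \<open>J\<close> is the variant: it decreases in each round, so it bounds
  the number of rounds.\<close>
lemma Loop_iterate:
  fixes J :: "nat \<Rightarrow> ('l, 'r) store \<Rightarrow> bool"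
  assumes step: "\<And>k s. J k s \<Longrightarrow> holds b s \<Longrightarrow> \<exists>t\<le>T. \<exists>k'<k. \<exists>s'. runs c s t s' \<and> J k' s'"
    and J: "J k s"
  shows "\<exists>t s' k'. t \<le> k * Suc T + 1 \<and> runs (Loop b c) s t s' \<and> J k' s' \<and> \<not> holds b s'"
  using J
proof (induction k arbitrary: s rule: less_induct)
  case (less k)
  show ?case
  proof (cases "holds b s")
    case False
    then show ?thesis
      using runs_Loop_stop less.prems by (intro exI[of _ 1] exI[of _ s] exI[of _ k]) auto
  next
    case True
    obtain t k' s1 where t: "t \<le> T" "runs c s t s1" and k': "k' < k" "J k' s1"
      using step[OF less.prems True] by blast
    obtain t' s2 k2 where t': "t' \<le> k' * Suc T + 1" "runs (Loop b c) s1 t' s2"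
      "J k2 s2" "\<not> holds b s2" using less.IH[OF k'] by blast
    have "Suc k' * Suc T \<le> k * Suc T" using k'(1) by (intro mult_right_mono) auto
    then have "Suc (t' + t) \<le> k * Suc T + 1" using t(1) t'(1) by simp
    then show ?thesis using runs_Loop_step[OF True t(2) t'(2)] t'(3,4) by blast
  qed
qed

text \<open>The invariant \<open>J\<close> may refer to the initial store \<open>s0\<close>.  Its argument \<open>k\<close> bounds the number of remaining
  rounds; starting it at \<open>N\<close> or below gives the polynomial time bound.\<close>
lemma ptime_Loop:
  assumes "ptime P c U"
    and start: "\<And>N x s0. R N x s0 \<Longrightarrow> \<exists>k\<le>N. J N x s0 k s0"
    and body: "\<And>N x s0 k s. R N x s0 \<Longrightarrow> J N x s0 k s \<Longrightarrow> holds b s \<Longrightarrow>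
      \<exists>y. P N y s \<and> (\<forall>s'. U N y s s' \<longrightarrow> (\<exists>k'<k. J N x s0 k' s'))"
    and exit: "\<And>N x s0 k s. R N x s0 \<Longrightarrow> J N x s0 k s \<Longrightarrow> \<not> holds b s \<Longrightarrow> S N x s0 s"
  shows "ptime R (Loop b c) S"
proof -
  obtain D where D: "\<And>N x s. P N x s \<Longrightarrow> \<exists>t s'. t \<le> (N + 2) ^ D \<and> runs c s t s' \<and> U N x s s'"
    using assms(1) unfolding ptime_def by blast
  have bound: "k * Suc ((N + 2) ^ D) + 1 \<le> (N + 2) ^ (D + 2)" if "k \<le> N" for k N
  proof -
    have "k * Suc ((N + 2) ^ D) \<le> N * (2 * (N + 2) ^ D)" using that by (intro mult_mono) auto
    moreover have "1 \<le> (N + 2) ^ D" by (rule one_le_power) simp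
    moreover have "(2 * N + 1) * (N + 2) ^ D = N * (2 * (N + 2) ^ D) + (N + 2) ^ D"
      by (simp only: distrib_right mult_1 mult.assoc mult.left_commute[of N])
    ultimately have "k * Suc ((N + 2) ^ D) + 1 \<le> (2 * N + 1) * (N + 2) ^ D"
      by linarith
    also have "\<dots> \<le> (N + 2) ^ 2 * (N + 2) ^ D"
      by (intro mult_right_mono) (auto simp: power2_eq_square)
    also have "\<dots> = (N + 2) ^ (2 + D)" by (simp only: power_add)
    finally show ?thesis by (simp only: add.commute)
  qed
  show ?thesis
  proof (rule ptimeI[where D = "D + 2"])
    fix N x s0 assume R: "R N x s0"
    then obtain k where k: "k \<le> N" "J N x s0 k s0" using start by blast
    have "\<exists>t s' k'. t \<le> k * Suc ((N + 2) ^ D) + 1 \<and> runs (Loop b c) s0 t s' \<and> J N x s0 k' s' \<and> \<not> holds b s'"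
    proof (rule Loop_iterate)
      show "J N x s0 k s0" by (rule k(2))
      fix k s assume "J N x s0 k s" "holds b s"
      then obtain y where y: "P N y s" "\<And>s'. U N y s s' \<Longrightarrow> \<exists>k'<k. J N x s0 k' s'"
        using body[OF R] by blast
      obtain t s' where "t \<le> (N + 2) ^ D" "runs c s t s'" "U N y s s'" using D[OF y(1)] by blast
      then show "\<exists>t\<le>(N + 2) ^ D. \<exists>k'<k. \<exists>s'. runs c s t s' \<and> J N x s0 k' s'" using y(2) by blast
    qed
    then obtain t s' k' where t: "t \<le> k * Suc ((N + 2) ^ D) + 1" "runs (Loop b c) s0 t s'"
      "J N x s0 k' s'" "\<not> holds b s'" by blast
    have "t \<le> (N + 2) ^ (D + 2)" using t(1) bound[OF k(1)] by (rule order_trans)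
    then show "\<exists>t s'. t \<le> (N + 2) ^ (D + 2) \<and> runs (Loop b c) s0 t s' \<and> S N x s0 s'"
      using t(2) exit[OF R t(3,4)] by blast
  qed
qed

abbreviation computes ::
  "(nat \<Rightarrow> ('l, 'r) store \<Rightarrow> bool) \<Rightarrow> ('l, 'r) com \<Rightarrow> (('l, 'r) store \<Rightarrow> ('l, 'r) store) \<Rightarrow> bool" where
  "computes P c f \<equiv> ptime (\<lambda>N (x :: unit) s. P N s) c (\<lambda>N x s s'. s' = f s)"

definition skip :: "('l, 'r) com" where
  "skip = Step None Stay (\<lambda>_. Stay)"

lemma written_None [simp]: "written None a = a"
  by (simp add: written_def)

lemma ptime_skip: "computes (\<lambda>N s. True) skip (\<lambda>s. s)"
  unfolding skip_def by (rule ptime_Step) (simp add: act_scan)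

text \<open>A constant vector is added in unit steps, which all registers take simultaneously.\<close>
definition toward :: "int \<Rightarrow> move" where
  "toward k = (if k > 0 then Go_Right else if k < 0 then Go_Left else Stay)"

primrec add_upto :: "nat \<Rightarrow> ('r \<Rightarrow> int) \<Rightarrow> ('l, 'r) com" where
  "add_upto 0 d = skip"
| "add_upto (Suc k) d = Seq (Step None Stay (\<lambda>x. toward (d x))) (add_upto k (\<lambda>x. d x - sgn (d x)))"

text \<open>The sum of the absolute values is a convenient upper bound for their maximum, the number of unit
  steps that are needed.\<close>
definition add :: "('r \<Rightarrow> int) \<Rightarrow> ('l, 'r) com" where
  "add d = add_upto (nat (\<Sum>x\<in>set rs. \<bar>d x\<bar>)) d"

lemma offset_toward: "offset (toward k) = sgn k"
  by (simp add: toward_def sgn_if)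

lemma ptime_add_upto:
  assumes "\<And>x. \<bar>d x\<bar> \<le> int k"
  shows "computes (\<lambda>N s. True) (add_upto k d) (\<lambda>s. (fst s, \<lambda>x. snd s x + d x))"
  using assms
proof (induction k arbitrary: d)
  case 0
  then have "d = (\<lambda>x. 0)" by auto
  then show ?case using ptime_skip by simp
next
  case (Suc k)
  have "\<bar>d x - sgn (d x)\<bar> \<le> int k" for x using Suc.prems[of x] by (auto simp: sgn_if)
  then have IH: "computes (\<lambda>N s. True) (add_upto k (\<lambda>x. d x - sgn (d x)))
      (\<lambda>s. (fst s, \<lambda>x. snd s x + (d x - sgn (d x))))"
    by (rule Suc.IH)
  have "computes (\<lambda>N s. True) (Step None Stay (\<lambda>x. toward (d x)))
      (\<lambda>s. (fst s, \<lambda>x. snd s x + sgn (d x)))"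
    by (rule ptime_Step) (simp add: act_scan offset_toward)
  then show ?case unfolding add_upto.simps by (rule ptime_Seq[OF _ IH]) simp
qed

lemma ptime_add:
  assumes "\<And>x. x \<notin> set rs \<Longrightarrow> d x = 0"
  shows "computes (\<lambda>N s. True) (add d) (\<lambda>s. (fst s, \<lambda>x. snd s x + d x))"
  unfolding add_def
proof (rule ptime_add_upto)
  fix x
  have "0 \<le> (\<Sum>x\<in>set rs. \<bar>d x\<bar>)" by (simp add: sum_nonneg)
  then show "\<bar>d x\<bar> \<le> int (nat (\<Sum>x\<in>set rs. \<bar>d x\<bar>))"
    using assms[of x] member_le_sum[of x "set rs" "\<lambda>x. \<bar>d x\<bar>"] by (cases "x \<in> set rs") auto
qed

text \<open>If \<open>d x = - 1\<close> and the value of \<open>x\<close> is not negative, this adds to the registers the vector \<open>d\<close>,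
  multiplied by that value.\<close>
definition drain :: "'r \<Rightarrow> ('r \<Rightarrow> int) \<Rightarrow> ('l, 'r) com" where
  "drain x d = Loop (\<lambda>_ z. \<not> z x) (add d)"

lemma ptime_drain:
  assumes "x \<in> set rs" "d x = - 1" "\<And>x. x \<notin> set rs \<Longrightarrow> d x = 0"
  shows "computes (\<lambda>N s. 0 \<le> snd s x \<and> snd s x \<le> int N) (drain x d)
    (\<lambda>s. (fst s, \<lambda>y. snd s y + snd s x * d y))"
  unfolding drain_def
proof (rule ptime_Loop[OF ptime_add[OF assms(3)], where J = "\<lambda>_ _ s0 k s.
    int k \<le> snd s0 x \<and> s = (fst s0, \<lambda>y. snd s0 y + (snd s0 x - int k) * d y)"])
  fix N and s0 :: "('l, 'r) store"
  assume s0: "0 \<le> snd s0 x \<and> snd s0 x \<le> int N"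
  then show "\<exists>k\<le>N. int k \<le> snd s0 x \<and> s0 = (fst s0, \<lambda>y. snd s0 y + (snd s0 x - int k) * d y)"
    by (intro exI[of _ "nat (snd s0 x)"]) auto
  fix k s
  assume J: "int k \<le> snd s0 x \<and> s = (fst s0, \<lambda>y. snd s0 y + (snd s0 x - int k) * d y)"
  {
    assume b: "holds (\<lambda>_ z. \<not> z x) s"
    have "k \<noteq> 0" using J b assms by (auto simp: holds_def zeros_def)
    then show "\<exists>_::unit. True \<and> (\<forall>s'. s' = (fst s, \<lambda>x. snd s x + d x) \<longrightarrow>
        (\<exists>k'<k. int k' \<le> snd s0 x \<and> s' = (fst s0, \<lambda>y. snd s0 y + (snd s0 x - int k') * d y)))"
      using J by (intro exI[of _ "()"] conjI allI impI exI[of _ "k - 1"])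
        (auto simp: fun_eq_iff of_nat_diff algebra_simps)
  next
    assume "\<not> holds (\<lambda>_ z. \<not> z x) s"
    then show "s = (fst s0, \<lambda>y. snd s0 y + snd s0 x * d y)"
      using J assms by (auto simp: holds_def zeros_def)
  }
qed

definition unit_vec :: "'r \<Rightarrow> 'r \<Rightarrow> int" where
  "unit_vec x y = (if x = y then 1 else 0)"

text \<open>The same without losing the value of \<open>x\<close>, which moves to the register \<open>h\<close> and back.\<close>
definition add_multiple :: "'r \<Rightarrow> 'r \<Rightarrow> ('r \<Rightarrow> int) \<Rightarrow> ('l, 'r) com" where
  "add_multiple h x d = Seq (drain x (\<lambda>y. d y - unit_vec x y + unit_vec h y))
     (drain h (\<lambda>y. unit_vec x y - unit_vec h y))"

lemma ptime_add_multiple: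
  assumes "x \<in> set rs" "h \<in> set rs" "h \<noteq> x" "d x = 0" "d h = 0" "\<And>x. x \<notin> set rs \<Longrightarrow> d x = 0"
  shows "computes (\<lambda>N s. 0 \<le> snd s x \<and> snd s x \<le> int N \<and> snd s h = 0) (add_multiple h x d)
    (\<lambda>s. (fst s, \<lambda>y. snd s y + snd s x * d y))"
  unfolding add_multiple_def
  by (rule ptime_Seq[OF ptime_drain ptime_drain])
     (use assms in \<open>auto simp: unit_vec_def fun_eq_iff algebra_simps\<close>)

primrec add_multiples :: "'r \<Rightarrow> ('r \<times> ('r \<Rightarrow> int)) list \<Rightarrow> ('l, 'r) com" where
  "add_multiples h [] = skip"
| "add_multiples h (p # ps) = Seq (add_multiple h (fst p) (snd p)) (add_multiples h ps)"

lemma ptime_add_multiples: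
  assumes "h \<in> set rs"
    and "\<And>x d. (x, d) \<in> set ps \<Longrightarrow> x \<in> set rs \<and> x \<noteq> h \<and> d h = 0 \<and> (\<forall>y. y \<notin> set rs \<longrightarrow> d y = 0)"
    and "\<And>x d x' d'. (x, d) \<in> set ps \<Longrightarrow> (x', d') \<in> set ps \<Longrightarrow> d x' = 0"
  shows "computes (\<lambda>N s. snd s h = 0 \<and> (\<forall>(x, d)\<in>set ps. 0 \<le> snd s x \<and> snd s x \<le> int N)) (add_multiples h ps)
    (\<lambda>s. (fst s, \<lambda>y. snd s y + (\<Sum>(x, d)\<leftarrow>ps. snd s x * d y)))"
  using assms(2-)
proof (induction ps)
  case Nil
  show ?case using ptime_skip by (auto intro: ptime_conseq)
next
  case (Cons p ps)
  obtain x d where p: "p = (x, d)" by force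
  have IH: "computes (\<lambda>N s. snd s h = 0 \<and> (\<forall>(x, d)\<in>set ps. 0 \<le> snd s x \<and> snd s x \<le> int N)) (add_multiples h ps)
    (\<lambda>s. (fst s, \<lambda>y. snd s y + (\<Sum>(x, d)\<leftarrow>ps. snd s x * d y)))"
  proof (rule Cons.IH)
    fix x d assume "(x, d) \<in> set ps"
    then show "x \<in> set rs \<and> x \<noteq> h \<and> d h = 0 \<and> (\<forall>y. y \<notin> set rs \<longrightarrow> d y = 0)"
      using Cons.prems(1)[of x d] by simp
  next
    fix x d x' d' assume "(x, d) \<in> set ps" "(x', d') \<in> set ps"
    then show "d x' = 0" using Cons.prems(2)[of x d x' d'] by simp
  qed
  have pd: "x \<in> set rs" "h \<noteq> x" "d h = 0" "d x = 0" "\<And>y. y \<notin> set rs \<Longrightarrow> d y = 0"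
    using Cons.prems(1)[of x d] Cons.prems(2)[of x d x d] by (auto simp: p)
  have d0: "d x' = 0" if "(x', d') \<in> set ps" for x' d' using Cons.prems(2)[of x d x' d'] that by (auto simp: p)
  have eq: "(\<Sum>(x', d')\<leftarrow>ps. (r x' + c * d x') * d' y) = (\<Sum>(x', d')\<leftarrow>ps. r x' * d' y)" for r c y
    using d0 by (intro arg_cong[of _ _ sum_list] map_cong) auto
  show ?case
    unfolding add_multiples.simps p fst_conv snd_conv
    by (rule ptime_Seq[OF ptime_add_multiple[OF pd(1) assms(1) pd(2) pd(4) pd(3) pd(5)] IH])
       (use pd d0 in \<open>auto simp: p eq add.assoc\<close>)
qed

end

section \<open>Reading the input\<close>

text \<open>\<open>Count b x\<close> is the number of letters \<open>x\<close> in the first (\<open>b = True\<close>) or the second input word, \<open>Residue i\<close> is the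
  left side of the equation of index \<open>i\<close>, which the search tries to make zero, and \<open>Coeff x\<close> is
  the current coefficient of the unknown that belongs to \<open>x\<close>.  Only equality with zero can
  be tested, so an upper bound \<open>R\<close> for \<open>Coeff x\<close> is imposed by holding \<open>R - Coeff x\<close> in \<open>Spare x\<close>.
  \<open>Scratch\<close> is zero between uses.\<close>
datatype 'l reg = Scratch | Residue nat | Count bool 'l | Coeff 'l | Spare 'l

definition registers :: "'l list \<Rightarrow> nat \<Rightarrow> 'l reg list" where
  "registers ls s = Scratch # map Residue [0..<s] @
     concat (map (\<lambda>x. [Count True x, Count False x, Coeff x, Spare x]) ls)"

lemma registers_iff [simp]:
  "Scratch \<in> set (registers ls s)"
  "Residue i \<in> set (registers ls s) \<longleftrightarrow> i < s"
  "Count b x \<in> set (registers ls s) \<longleftrightarrow> x \<in> set ls"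
  "Coeff x \<in> set (registers ls s) \<longleftrightarrow> x \<in> set ls"
  "Spare x \<in> set (registers ls s) \<longleftrightarrow> x \<in> set ls"
  by (cases b) (auto simp: registers_def)

locale conjugator_search =
  fixes ls :: "'l list" and lin :: "'l \<Rightarrow> nat \<Rightarrow> int" and tw :: "'l \<Rightarrow> 'l \<Rightarrow> nat \<Rightarrow> int" and dim :: nat
  assumes distinct_letters: "distinct ls"
begin

sublocale counter_machine "set ls" "registers ls dim"
  by unfold_locales simp

definition on_residue :: "(nat \<Rightarrow> int) \<Rightarrow> 'l reg \<Rightarrow> int" where
  "on_residue f x = (case x of Residue i \<Rightarrow> if i < dim then f i else 0 | _ \<Rightarrow> 0)"

lemma on_residue_simps [simp]:
  "on_residue f (Residue i) = (if i < dim then f i else 0)" "on_residue f Scratch = 0"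
  "on_residue f (Count b x) = 0" "on_residue f (Coeff x) = 0" "on_residue f (Spare x) = 0"
  by (simp_all add: on_residue_def)

lemma on_residue_outside: "y \<notin> set (registers ls dim) \<Longrightarrow> on_residue f y = 0"
  by (cases y) auto

definition counts_ok :: "nat \<Rightarrow> ('l reg \<Rightarrow> int) \<Rightarrow> bool" where
  "counts_ok N r \<longleftrightarrow> r Scratch = 0 \<and> (\<forall>b. \<forall>x\<in>set ls. 0 \<le> r (Count b x) \<and> r (Count b x) \<le> int N)"

text \<open>The twist with all earlier letters of the word is computed from their numbers, which suffices because
  it does not depend on their order.  The second word enters the equations with a negative sign.\<close>
definition read_letter :: "bool \<Rightarrow> 'l \<Rightarrow> ('l, 'l reg) com" where
  "read_letter b y = Seq
     (add_multiples Scratch (map (\<lambda>x. (Count b x, on_residue (\<lambda>i. sgn_of b * tw x y i))) ls))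
     (add (\<lambda>x. on_residue (\<lambda>i. sgn_of b * lin y i) x + unit_vec (Count b y) x))"

definition after_letter :: "bool \<Rightarrow> 'l \<Rightarrow> ('l reg \<Rightarrow> int) \<Rightarrow> 'l reg \<Rightarrow> int" where
  "after_letter b y r z = r z + (\<Sum>x\<leftarrow>ls. r (Count b x) * on_residue (\<lambda>i. sgn_of b * tw x y i) z) +
     (on_residue (\<lambda>i. sgn_of b * lin y i) z + unit_vec (Count b y) z)"

lemma ptime_read_letter:
  assumes "y \<in> set ls"
  shows "computes (\<lambda>N s. counts_ok N (snd s)) (read_letter b y) (\<lambda>s. (fst s, after_letter b y (snd s)))"
proof -
  have 1: "computes (\<lambda>N s. snd s Scratch = 0 \<and>
      (\<forall>(x, d)\<in>set (map (\<lambda>x. (Count b x, on_residue (\<lambda>i. sgn_of b * tw x y i))) ls). 0 \<le> snd s x \<and> snd s x \<le> int N))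
    (add_multiples Scratch (map (\<lambda>x. (Count b x, on_residue (\<lambda>i. sgn_of b * tw x y i))) ls))
    (\<lambda>s. (fst s, \<lambda>z. snd s z + (\<Sum>(x, d)\<leftarrow>map (\<lambda>x. (Count b x, on_residue (\<lambda>i. sgn_of b * tw x y i))) ls. snd s x * d z)))"
    by (rule ptime_add_multiples) (auto simp: on_residue_outside)
  have 2: "computes (\<lambda>N s. True) (add (\<lambda>x. on_residue (\<lambda>i. sgn_of b * lin y i) x + unit_vec (Count b y) x))
    (\<lambda>s. (fst s, \<lambda>z. snd s z + (on_residue (\<lambda>i. sgn_of b * lin y i) z + unit_vec (Count b y) z)))"
    using assms by (intro ptime_add) (auto simp: on_residue_outside unit_vec_def)
  show ?thesis
    unfolding read_letter_def
    by (rule ptime_Seq[OF 1 2]) (auto simp: counts_ok_def after_letter_def[abs_def] o_def)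
qed

primrec dispatch :: "bool \<Rightarrow> 'l list \<Rightarrow> ('l, 'l reg) com" where
  "dispatch b [] = skip"
| "dispatch b (y # ys) = Cond (\<lambda>a _. a = Sym y) (read_letter b y) (dispatch b ys)"

lemma ptime_dispatch:
  assumes "set ys \<subseteq> set ls"
  shows "ptime (\<lambda>N y s. y \<in> set ys \<and> scan (fst s) = Sym y \<and> counts_ok N (snd s)) (dispatch b ys)
    (\<lambda>N y s s'. s' = (fst s, after_letter b y (snd s)))"
  using assms
proof (induction ys)
  case Nil
  show ?case unfolding dispatch.simps by (rule ptime_conseq[OF ptime_skip]) simp
next
  case (Cons a ys)
  have a: "a \<in> set ls" using Cons.prems by simp
  have IH: "ptime (\<lambda>N y s. y \<in> set ys \<and> scan (fst s) = Sym y \<and> counts_ok N (snd s)) (dispatch b ys)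
    (\<lambda>N y s s'. s' = (fst s, after_letter b y (snd s)))"
    using Cons by simp
  show ?case
    unfolding dispatch.simps
  proof (rule ptime_Cond)
    show "ptime (\<lambda>N y s. (y \<in> set (a # ys) \<and> scan (fst s) = Sym y \<and> counts_ok N (snd s)) \<and> holds (\<lambda>c _. c = Sym a) s)
      (read_letter b a) (\<lambda>N y s s'. s' = (fst s, after_letter b y (snd s)))"
      by (rule ptime_conseq[OF ptime_read_letter[OF a]]) (auto simp: holds_def)
    show "ptime (\<lambda>N y s. (y \<in> set (a # ys) \<and> scan (fst s) = Sym y \<and> counts_ok N (snd s)) \<and> \<not> holds (\<lambda>c _. c = Sym a) s)
      (dispatch b ys) (\<lambda>N y s s'. s' = (fst s, after_letter b y (snd s)))"
      by (rule ptime_conseq[OF IH]) (auto simp: holds_def)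
  qed
qed

definition move_head :: "move \<Rightarrow> ('l, 'l reg) com" where
  "move_head m = Step None m (\<lambda>_. Stay)"

definition shift_head :: "int \<Rightarrow> ('l, 'l reg) store \<Rightarrow> ('l, 'l reg) store" where
  "shift_head k s = ((fst (fst s) + k, snd (fst s)), snd s)"

lemma ptime_move_head: "computes (\<lambda>N s. True) (move_head m) (shift_head (offset m))"
  unfolding move_head_def by (rule ptime_Step) (simp add: act_scan shift_head_def)

definition read_word :: "bool \<Rightarrow> ('l, 'l reg) com" where
  "read_word b = Loop (\<lambda>a _. a \<in> Sym ` set ls) (Seq (dispatch b ls) (move_head Go_Right))"

definition after_word :: "bool \<Rightarrow> 'l list \<Rightarrow> ('l reg \<Rightarrow> int) \<Rightarrow> 'l reg \<Rightarrow> int" where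
  "after_word b w r z = r z + (case z of Count c x \<Rightarrow> if b = c then int (count_list w x) else 0
     | _ \<Rightarrow> on_residue (\<lambda>i. sgn_of b * coord lin tw w i) z)"

lemma sum_count_list:
  fixes g :: "'l \<Rightarrow> int"
  assumes "set w \<subseteq> set ls"
  shows "(\<Sum>x\<leftarrow>ls. int (count_list w x) * g x) = (\<Sum>x\<leftarrow>w. g x)"
  using assms
proof (induction w)
  case (Cons a w)
  have "(\<Sum>x\<leftarrow>ls. (if a = x then 1 else 0) * g x) = g a"
    using Cons.prems distinct_letters by (simp add: sum_list_distinct_conv_sum_set if_distrib[of "\<lambda>k. k * _"] cong: if_cong)
  moreover have "(\<Sum>x\<leftarrow>ls. int (count_list (a # w) x) * g x) =
      (\<Sum>x\<leftarrow>ls. (if a = x then 1 else 0) * g x) + (\<Sum>x\<leftarrow>ls. int (count_list w x) * g x)"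
    unfolding sum_list_addf[symmetric]
    by (intro arg_cong[of _ _ sum_list] map_cong) (auto simp: algebra_simps)
  ultimately show ?case using Cons by simp
qed simp

lemma after_letter_word:
  assumes "set w \<subseteq> set ls" "y \<in> set ls" "\<And>x. x \<in> set ls \<Longrightarrow> r (Count b x) = 0"
  shows "after_letter b y (after_word b w r) = after_word b (w @ [y]) r"
proof
  fix z
  have "(\<Sum>x\<leftarrow>ls. after_word b w r (Count b x) * (sgn_of b * tw x y i)) = (\<Sum>x\<leftarrow>ls. int (count_list w x) * (sgn_of b * tw x y i))" for i
    using assms(3) by (intro arg_cong[of _ _ sum_list] map_cong) (auto simp: after_word_def)
  then have "(\<Sum>x\<leftarrow>ls. after_word b w r (Count b x) * (sgn_of b * tw x y i)) = sgn_of b * (\<Sum>x\<leftarrow>w. tw x y i)" for i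
    by (simp add: sum_count_list[OF assms(1)] sum_list_const_mult)
  then show "after_letter b y (after_word b w r) z = after_word b (w @ [y]) r z"
    by (cases z) (auto simp: after_letter_def after_word_def unit_vec_def coord_append algebra_simps)
qed

lemma ptime_read_word:
  "ptime (\<lambda>N w s. set w \<subseteq> set ls \<and> length w \<le> N \<and>
      (\<forall>k<length w. snd (fst s) (fst (fst s) + int k) = Sym (w ! k)) \<and>
      snd (fst s) (fst (fst s) + int (length w)) \<notin> Sym ` set ls \<and>
      counts_ok N (snd s) \<and> (\<forall>x\<in>set ls. snd s (Count b x) = 0)) (read_word b)
    (\<lambda>N w s s'. s' = ((fst (fst s) + int (length w), snd (fst s)), after_word b w (snd s)))"
proof -
  have body: "ptime (\<lambda>N y s. y \<in> set ls \<and> scan (fst s) = Sym y \<and> counts_ok N (snd s)) (Seq (dispatch b ls) (move_head Go_Right))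
    (\<lambda>N y s s'. s' = ((fst (fst s) + 1, snd (fst s)), after_letter b y (snd s)))"
    by (rule ptime_Seq[OF ptime_dispatch[OF order_refl] ptime_move_head]) (auto simp: shift_head_def)
  show ?thesis
    unfolding read_word_def
  proof (rule ptime_Loop[OF body, where J = "\<lambda>_ w s0 k s. \<exists>m. k + m = length w \<and>
      s = ((fst (fst s0) + int m, snd (fst s0)), after_word b (take m w) (snd s0))"])
    fix N w and st :: "('l, 'l reg) store"
    assume pre: "set w \<subseteq> set ls \<and> length w \<le> N \<and>
      (\<forall>k<length w. snd (fst st) (fst (fst st) + int k) = Sym (w ! k)) \<and>
      snd (fst st) (fst (fst st) + int (length w)) \<notin> Sym ` set ls \<and>
      counts_ok N (snd st) \<and> (\<forall>x\<in>set ls. snd st (Count b x) = 0)"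
    obtain p f r where st: "st = ((p, f), r)" by (metis prod.collapse)
    let ?J = "\<lambda>k s. \<exists>m. k + m = length w \<and>
      s = ((fst (fst st) + int m, snd (fst st)), after_word b (take m w) (snd st))"
    have "?J (length w) st"
      by (rule exI[of _ 0]) (auto simp: st after_word_def fun_eq_iff on_residue_def split: reg.split)
    then show "\<exists>k\<le>N. ?J k st" using pre by blast
    fix k st'
    assume "?J k st'"
    then obtain m where m: "k + m = length w" "st' = ((p + int m, f), after_word b (take m w) r)"
      by (auto simp: st)
    {
      assume h: "holds (\<lambda>a _. a \<in> Sym ` set ls) st'"
      have "m \<noteq> length w" using h pre m by (auto simp: holds_def scan_def st)
      then have lt: "m < length w" using m by simp
      have y: "w ! m \<in> set ls" using pre lt by auto
      have tk: "set (take m w) \<subseteq> set ls" using pre set_take_subset[of m w] by blast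
      have "scan (fst st') = Sym (w ! m)" using pre lt by (simp add: m(2) scan_def st)
      moreover have "counts_ok N (snd st')"
      proof -
        have "int (count_list (take m w) x) \<le> int N" for x
          using count_le_length[of "take m w" x] lt pre by simp
        then show ?thesis using pre by (auto simp: m(2) counts_ok_def after_word_def st)
      qed
      moreover have "?J (k - 1) ((fst (fst st') + 1, snd (fst st')), after_letter b (w ! m) (snd st'))"
        using after_letter_word[OF tk y] lt m pre
        by (intro exI[of _ "Suc m"]) (simp add: take_Suc_conv_app_nth st)
      moreover have "k - 1 < k" using m lt by simp
      ultimately show "\<exists>y. (y \<in> set ls \<and> scan (fst st') = Sym y \<and> counts_ok N (snd st')) \<and>
        (\<forall>s'. s' = ((fst (fst st') + 1, snd (fst st')), after_letter b y (snd st')) \<longrightarrow> (\<exists>k'<k. ?J k' s'))"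
        using y by blast
    next
      assume h: "\<not> holds (\<lambda>a _. a \<in> Sym ` set ls) st'"
      have "\<not> m < length w"
      proof
        assume lt: "m < length w"
        then have "w ! m \<in> set ls" using pre by auto
        then show False using h pre lt by (auto simp: m(2) holds_def scan_def st)
      qed
      then show "st' = ((fst (fst st) + int (length w), snd (fst st)), after_word b w (snd st))"
        using m by (simp add: st)
    }
  qed
qed

section \<open>Searching a box of coefficients\<close>

text \<open>The change of the residues when the coefficient of \<open>x\<close> grows by one: the commutator
  of \<open>x\<close> with the two input words, computed from the numbers of their letters.\<close>
definition direction :: "('l reg \<Rightarrow> int) \<Rightarrow> 'l \<Rightarrow> nat \<Rightarrow> int" where
  "direction r x i = (\<Sum>y\<leftarrow>ls. r (Count True y) * tw x y i) - (\<Sum>y\<leftarrow>ls. r (Count False y) * tw y x i)"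

text \<open>The registers after the coefficients have been changed by \<open>y\<close>.\<close>
definition shifted :: "('l reg \<Rightarrow> int) \<Rightarrow> ('l \<Rightarrow> int) \<Rightarrow> 'l reg \<Rightarrow> int" where
  "shifted r y z = r z + (case z of
       Residue i \<Rightarrow> if i < dim then \<Sum>x\<in>set ls. y x * direction r x i else 0
     | Coeff x \<Rightarrow> if x \<in> set ls then y x else 0
     | Spare x \<Rightarrow> if x \<in> set ls then - y x else 0
     | _ \<Rightarrow> 0)"

lemma direction_shifted [simp]: "direction (shifted r y) = direction r"
  by (simp add: direction_def fun_eq_iff shifted_def)

lemma shifted_shifted: "shifted (shifted r y) y' = shifted r (\<lambda>x. y x + y' x)"
proof
  fix z show "shifted (shifted r y) y' z = shifted r (\<lambda>x. y x + y' x) z"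
    by (cases z) (simp_all add: shifted_def[of "shifted r y"] , simp_all add: shifted_def distrib_right sum.distrib)
qed

lemma shifted_cong: "(\<And>x. x \<in> set ls \<Longrightarrow> y x = y' x) \<Longrightarrow> shifted r y = shifted r y'"
  by (auto simp: shifted_def fun_eq_iff split: reg.split intro!: sum.cong)

lemma shifted_zero [simp]: "shifted r (\<lambda>x. 0) = r"
  by (auto simp: shifted_def fun_eq_iff split: reg.split)

lemma shifted_simps [simp]:
  "shifted r y Scratch = r Scratch" "shifted r y (Count b x) = r (Count b x)"
  "x \<in> set ls \<Longrightarrow> shifted r y (Coeff x) = r (Coeff x) + y x"
  "x \<in> set ls \<Longrightarrow> shifted r y (Spare x) = r (Spare x) - y x"
  "i < dim \<Longrightarrow> shifted r y (Residue i) = r (Residue i) + (\<Sum>x\<in>set ls. y x * direction r x i)"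
  by (simp_all add: shifted_def)

lemma counts_ok_shifted [simp]: "counts_ok N (shifted r y) = counts_ok N r"
  by (simp add: counts_ok_def)

definition shift_along :: "int \<Rightarrow> 'l \<Rightarrow> ('l, 'l reg) com" where
  "shift_along k x = Seq
     (add_multiples Scratch
        (map (\<lambda>y. (Count True y, on_residue (\<lambda>i. k * tw x y i))) ls @
         map (\<lambda>y. (Count False y, on_residue (\<lambda>i. - k * tw y x i))) ls))
     (add (\<lambda>z. k * (unit_vec (Coeff x) z - unit_vec (Spare x) z)))"

lemma ptime_shift_along:
  assumes "x \<in> set ls"
  shows "computes (\<lambda>N s. counts_ok N (snd s)) (shift_along k x)
    (\<lambda>s. (fst s, shifted (snd s) (\<lambda>x'. if x' = x then k else 0)))"
proof -
  let ?ps = "map (\<lambda>y. (Count True y, on_residue (\<lambda>i. k * tw x y i))) ls @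
         map (\<lambda>y. (Count False y, on_residue (\<lambda>i. - k * tw y x i))) ls"
  have 1: "computes (\<lambda>N s. snd s Scratch = 0 \<and> (\<forall>(x, d)\<in>set ?ps. 0 \<le> snd s x \<and> snd s x \<le> int N))
    (add_multiples Scratch ?ps) (\<lambda>s. (fst s, \<lambda>z. snd s z + (\<Sum>(x, d)\<leftarrow>?ps. snd s x * d z)))"
    by (rule ptime_add_multiples) (auto simp: on_residue_outside)
  have 2: "computes (\<lambda>N s. True) (add (\<lambda>z. k * (unit_vec (Coeff x) z - unit_vec (Spare x) z)))
    (\<lambda>s. (fst s, \<lambda>z. snd s z + k * (unit_vec (Coeff x) z - unit_vec (Spare x) z)))"
    using assms by (intro ptime_add) (auto simp: unit_vec_def)
  have eq: "r z + (\<Sum>(x, d)\<leftarrow>?ps. r x * d z) + k * (unit_vec (Coeff x) z - unit_vec (Spare x) z) =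
      shifted r (\<lambda>x'. if x' = x then k else 0) z" for r z
  proof (cases z)
    case (Residue i)
    have "(\<Sum>x'\<in>set ls. (if x' = x then k else 0) * direction r x' i) = k * direction r x i"
      using assms by (simp add: if_distrib[of "\<lambda>k. k * _"] cong: if_cong)
    also have "\<dots> = (\<Sum>y\<leftarrow>ls. r (Count True y) * (k * tw x y i)) + (\<Sum>y\<leftarrow>ls. r (Count False y) * (- k * tw y x i))"
      unfolding direction_def right_diff_distrib sum_list_const_mult[symmetric]
        sum_list_subtractf[symmetric] sum_list_addf[symmetric]
      by (simp add: algebra_simps)
    finally show ?thesis by (simp add: Residue unit_vec_def o_def shifted_def)
  qed (auto simp: unit_vec_def shifted_def o_def assms)
  show ?thesis
    unfolding shift_along_def
    by (rule ptime_Seq[OF 1 2]) (auto simp: counts_ok_def eq[symmetric] fun_eq_iff)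
qed

definition solved :: "('l reg \<Rightarrow> int) \<Rightarrow> bool" where
  "solved r \<longleftrightarrow> (\<forall>i<dim. r (Residue i) = 0)"

definition solved_test :: "('l reg \<Rightarrow> bool) \<Rightarrow> bool" where
  "solved_test z \<longleftrightarrow> (\<forall>i<dim. z (Residue i))"

lemma solved_test_zeros [simp]: "solved_test (zeros r) = solved r"
  by (simp add: solved_test_def solved_def zeros_def)

text \<open>Nested loops over the coefficients of the letters in the list.  The loops stop as soon as all residues
  are zero, and then leave the solution in the registers; after an unsuccessful pass the
  last loop restores the old values, so that the enclosing loop can continue from them.\<close>
primrec search :: "'l list \<Rightarrow> ('l, 'l reg) com" where
  "search [] = skip"
| "search (x # xs) = Seq (search xs) (Seq
     (Loop (\<lambda>_ z. \<not> solved_test z \<and> \<not> z (Spare x)) (Seq (shift_along 1 x) (search xs)))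
     (Loop (\<lambda>_ z. \<not> solved_test z \<and> \<not> z (Coeff x)) (shift_along (- 1) x)))"

definition box :: "'l list \<Rightarrow> ('l reg \<Rightarrow> int) \<Rightarrow> ('l \<Rightarrow> int) \<Rightarrow> bool" where
  "box xs r y \<longleftrightarrow> (\<forall>x. 0 \<le> y x) \<and> (\<forall>x\<in>set xs. y x \<le> r (Spare x)) \<and> (\<forall>x. x \<notin> set xs \<longrightarrow> y x = 0)"

definition ready :: "nat \<Rightarrow> 'l list \<Rightarrow> ('l reg \<Rightarrow> int) \<Rightarrow> bool" where
  "ready N xs r \<longleftrightarrow> counts_ok N r \<and>
     (\<forall>x\<in>set xs. r (Coeff x) = 0 \<and> 0 \<le> r (Spare x) \<and> r (Spare x) \<le> int N)"

text \<open>Either a solution has been found, or the registers are unchanged and the box contains none.\<close>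
lemma ptime_search:
  assumes "distinct xs" "set xs \<subseteq> set ls"
  shows "ptime (\<lambda>N (_ :: unit) s. ready N xs (snd s)) (search xs)
    (\<lambda>N _ s s'. \<exists>y. box xs (snd s) y \<and> s' = (fst s, shifted (snd s) y) \<and>
      (solved (snd s') \<or> y = (\<lambda>x. 0) \<and> (\<forall>y'. box xs (snd s) y' \<longrightarrow> \<not> solved (shifted (snd s) y'))))"
  using assms
proof (induction xs)
  case Nil
  have "box [] r y \<longleftrightarrow> y = (\<lambda>x. 0)" for r y by (auto simp: box_def)
  then show ?case
    unfolding search.simps by (intro ptime_conseq[OF ptime_skip]) auto
next
  case (Cons x xs)
  have x: "x \<in> set ls" "x \<notin> set xs" "distinct xs" "set xs \<subseteq> set ls" using Cons.prems by auto
  note IH = Cons.IH[OF x(3,4)]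
  let ?u = "\<lambda>k x'. if x' = x then k else 0 :: int"
  \<comment> \<open>During the loop that increases the coefficient of \<open>x\<close>: nothing was found up to its current value.\<close>
  define free where "free r y \<longleftrightarrow> (\<forall>y'. box (x # xs) r y' \<and> y' x \<le> y x \<longrightarrow> \<not> solved (shifted r y'))"
    for r and y :: "'l \<Rightarrow> int"
  define state where "state s0 s y \<longleftrightarrow> box (x # xs) (snd s0) y \<and> s = (fst s0, shifted (snd s0) y) \<and>
      (solved (snd s) \<or> (\<forall>x'. x' \<noteq> x \<longrightarrow> y x' = 0) \<and> free (snd s0) y)"
    for s0 s :: "('l, 'l reg) store" and y
  have first: "ptime (\<lambda>N (_ :: unit) s. ready N (x # xs) (snd s)) (search xs)
    (\<lambda>N _ s s'. \<exists>y. state s s' y)"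
  proof (rule ptime_conseq[OF IH], intro exI[of _ "()"] conjI allI impI)
    fix N and s s' :: "('l, 'l reg) store"
    assume r: "ready N (x # xs) (snd s)"
    then show "ready N xs (snd s)" by (simp add: ready_def)
    assume "\<exists>y. box xs (snd s) y \<and> s' = (fst s, shifted (snd s) y) \<and>
      (solved (snd s') \<or> y = (\<lambda>x. 0) \<and> (\<forall>y'. box xs (snd s) y' \<longrightarrow> \<not> solved (shifted (snd s) y')))"
    then obtain y where y: "box xs (snd s) y" "s' = (fst s, shifted (snd s) y)"
      "solved (snd s') \<or> y = (\<lambda>x. 0) \<and> (\<forall>y'. box xs (snd s) y' \<longrightarrow> \<not> solved (shifted (snd s) y'))" by blast
    have "box (x # xs) (snd s) y" using y(1) r by (auto simp: box_def ready_def)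
    moreover have "free (snd s) y" if "y = (\<lambda>x. 0)" "\<forall>y'. box xs (snd s) y' \<longrightarrow> \<not> solved (shifted (snd s) y')"
      unfolding free_def
    proof (intro allI impI)
      fix y' assume y': "box (x # xs) (snd s) y' \<and> y' x \<le> y x"
      then have "0 \<le> y' x" "y' x \<le> 0" using that(1) by (auto simp: box_def)
      then have "y' x = 0" by simp
      then have "box xs (snd s) y'" using y' by (auto simp: box_def)
      then show "\<not> solved (shifted (snd s) y')" using that(2) by blast
    qed
    ultimately show "\<exists>y. state s s' y" using y by (auto simp: state_def)
  qed
  have up_body: "ptime (\<lambda>N s0 s. ready N (x # xs) (snd s0) \<and> (\<exists>y. state s0 s y \<and> y x < snd s0 (Spare x)) \<and> \<not> solved (snd s))
      (Seq (shift_along 1 x) (search xs))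
      (\<lambda>N s0 s s'. \<exists>y y'. state s0 s y \<and> state s0 s' y' \<and> y' x = y x + 1)"
  proof (rule ptime_Seq[OF ptime_shift_along[OF x(1)] IH])
    fix N and s0 s :: "('l, 'l reg) store"
    assume pre: "ready N (x # xs) (snd s0) \<and> (\<exists>y. state s0 s y \<and> y x < snd s0 (Spare x)) \<and> \<not> solved (snd s)"
    then obtain y where y: "state s0 s y" "y x < snd s0 (Spare x)" by blast
    let ?r = "snd s0"
    have st: "s = (fst s0, shifted ?r y)" and yx: "\<And>x'. x' \<noteq> x \<Longrightarrow> y x' = 0" and "free ?r y" and "box (x # xs) ?r y"
      using y(1) pre by (auto simp: state_def)
    define y1 where "y1 = (\<lambda>x'. y x' + ?u 1 x')"
    have s1: "(fst s, shifted (snd s) (?u 1)) = (fst s0, shifted ?r y1)"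
      by (simp add: st shifted_shifted y1_def)
    have y1: "y1 x' = 0" "shifted ?r y1 (Spare x') = ?r (Spare x')" "shifted ?r y1 (Coeff x') = ?r (Coeff x')"
      if "x' \<in> set xs" for x'
      using that x yx[of x'] by (auto simp: y1_def)
    have rdy: "ready N xs (shifted ?r y1)"
      using pre y1 by (auto simp: ready_def)
    have "\<exists>y y'. state s0 s y \<and> state s0 s2 y' \<and> y' x = y x + 1"
      if post: "box xs (shifted ?r y1) y2" "s2 = (fst s0, shifted (shifted ?r y1) y2)"
        "solved (snd s2) \<or> y2 = (\<lambda>x. 0) \<and> (\<forall>y'. box xs (shifted ?r y1) y' \<longrightarrow> \<not> solved (shifted (shifted ?r y1) y'))"
      for y2 s2
    proof -
      define y3 where "y3 = (\<lambda>x'. y1 x' + y2 x')"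
      have y3x: "y3 x = y x + 1" using post(1) x(2) by (auto simp: y3_def y1_def box_def)
      have "box (x # xs) ?r y3"
      proof -
        have "0 \<le> y3 x'" for x' using \<open>box (x # xs) ?r y\<close> post(1) by (auto simp: y3_def y1_def box_def)
        moreover have "y3 x' \<le> ?r (Spare x')" if "x' \<in> set (x # xs)" for x'
        proof (cases "x' = x")
          case True then show ?thesis using y3x y(2) by simp
        next
          case False
          then show ?thesis using that post(1) y1[of x'] by (auto simp: y3_def box_def)
        qed
        moreover have "y3 x' = 0" if "x' \<notin> set (x # xs)" for x'
          using that yx[of x'] post(1) by (auto simp: y3_def y1_def box_def)
        ultimately show ?thesis by (auto simp: box_def)
      qed
      moreover have "s2 = (fst s0, shifted ?r y3)"
        by (simp add: post(2) shifted_shifted y3_def)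
      moreover have "(\<forall>x'. x' \<noteq> x \<longrightarrow> y3 x' = 0) \<and> free ?r y3" if ns: "\<not> solved (snd s2)"
      proof
        have y2: "y2 = (\<lambda>x. 0)" "\<And>y'. box xs (shifted ?r y1) y' \<Longrightarrow> \<not> solved (shifted (shifted ?r y1) y')"
          using post(3) ns by auto
        show "\<forall>x'. x' \<noteq> x \<longrightarrow> y3 x' = 0" using yx by (auto simp: y3_def y1_def y2)
        show "free ?r y3"
          unfolding free_def
        proof (intro allI impI)
          fix y' assume y': "box (x # xs) ?r y' \<and> y' x \<le> y3 x"
          show "\<not> solved (shifted ?r y')"
          proof (cases "y' x \<le> y x")
            case True
            then show ?thesis using \<open>free ?r y\<close> y' by (simp add: free_def)
          next
            case False
            then have "y' x = y1 x" using y' y3x by (simp add: y1_def)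
            then have "(\<lambda>x'. y1 x' + (y'(x := 0)) x') = y'" using yx by (auto simp: y1_def)
            then have "shifted (shifted ?r y1) (y'(x := 0)) = shifted ?r y'"
              by (simp only: shifted_shifted)
            moreover have "box xs (shifted ?r y1) (y'(x := 0))"
              using y' y1 x(2) by (auto simp: box_def)
            ultimately show ?thesis using y2(2)[of "y'(x := 0)"] by simp
          qed
        qed
      qed
      ultimately have "state s0 s2 y3" by (auto simp: state_def)
      then show ?thesis using y(1) y3x by blast
    qed
    then show "\<exists>ya. counts_ok N (snd s) \<and> (\<forall>s1. s1 = (fst s, shifted (snd s) (\<lambda>x'. if x' = x then 1 else 0)) \<longrightarrow>
       (\<exists>z. ready N xs (snd s1) \<and> (\<forall>s2. (\<exists>y. box xs (snd s1) y \<and> s2 = (fst s1, shifted (snd s1) y) \<and>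
          (solved (snd s2) \<or> y = (\<lambda>x. 0) \<and> (\<forall>y'. box xs (snd s1) y' \<longrightarrow> \<not> solved (shifted (snd s1) y')))) \<longrightarrow>
          (\<exists>y y'. state s0 s y \<and> state s0 s2 y' \<and> y' x = y x + 1))))"
      using rdy pre unfolding s1 by (auto simp: st ready_def)
  qed
  have state_Spare: "snd s (Spare x) = snd s0 (Spare x) - y x"
    and state_Coeff: "snd s0 (Coeff x) = 0 \<Longrightarrow> snd s (Coeff x) = y x" if "state s0 s y" for s0 s y
    using that x(1) by (auto simp: state_def)
  have up: "ptime (\<lambda>N s0 s. ready N (x # xs) (snd s0) \<and> (\<exists>y. state s0 s y))
      (Loop (\<lambda>_ z. \<not> solved_test z \<and> \<not> z (Spare x)) (Seq (shift_along 1 x) (search xs)))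
      (\<lambda>N s0 s s'. \<exists>y. state s0 s' y \<and> (solved (snd s') \<or> y x = snd s0 (Spare x)))"
  proof (rule ptime_Loop[OF up_body, where J = "\<lambda>_ s0 _ k s. \<exists>y. state s0 s y \<and> k = nat (snd s0 (Spare x) - y x)"])
    fix N and s0 s :: "('l, 'l reg) store"
    let ?J = "\<lambda>k s. \<exists>y. state s0 s y \<and> k = nat (snd s0 (Spare x) - y x)"
    assume pre: "ready N (x # xs) (snd s0) \<and> (\<exists>y. state s0 s y)"
    then obtain y0 where y0: "state s0 s y0" by blast
    have "0 \<le> y0 x" "snd s0 (Spare x) \<le> int N" using y0 pre by (auto simp: state_def box_def ready_def)
    then have "nat (snd s0 (Spare x) - y0 x) \<le> N" by linarith
    then show "\<exists>k\<le>N. ?J k s" using y0 by blast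
    fix k s' assume "?J k s'"
    then obtain y where y: "state s0 s' y" "k = nat (snd s0 (Spare x) - y x)" by blast
    {
      assume h: "holds (\<lambda>_ z. \<not> solved_test z \<and> \<not> z (Spare x)) s'"
      have "y x \<le> snd s0 (Spare x)" using y(1) by (auto simp: state_def box_def)
      moreover have ns: "\<not> solved (snd s')" "snd s' (Spare x) \<noteq> 0"
        using h x(1) by (auto simp: holds_def zeros_def)
      ultimately have lt: "y x < snd s0 (Spare x)" using state_Spare[OF y(1)] by simp
      have "\<exists>k'<k. ?J k' s2" if post: "\<exists>y y'. state s0 s' y \<and> state s0 s2 y' \<and> y' x = y x + 1" for s2
      proof -
        obtain y1 y2 where y12: "state s0 s' y1" "state s0 s2 y2" "y2 x = y1 x + 1" using post by blast
        have "y1 x = y x" using state_Spare[OF y(1)] state_Spare[OF y12(1)] by simp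
        then have "nat (snd s0 (Spare x) - y2 x) < k" using y12(3) y(2) lt by simp
        then show ?thesis using y12(2) by blast
      qed
      then show "\<exists>s0'. (ready N (x # xs) (snd s0') \<and> (\<exists>y. state s0' s' y \<and> y x < snd s0' (Spare x)) \<and> \<not> solved (snd s')) \<and>
          (\<forall>s2. (\<exists>y y'. state s0' s' y \<and> state s0' s2 y' \<and> y' x = y x + 1) \<longrightarrow> (\<exists>k'<k. ?J k' s2))"
        using pre y(1) ns(1) lt by (intro exI[of _ s0] conjI allI impI) auto
    next
      assume "\<not> holds (\<lambda>_ z. \<not> solved_test z \<and> \<not> z (Spare x)) s'"
      then have "solved (snd s') \<or> snd s' (Spare x) = 0" by (auto simp: holds_def zeros_def)
      then have "solved (snd s') \<or> y x = snd s0 (Spare x)" using state_Spare[OF y(1)] by auto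
      then show "\<exists>y. state s0 s' y \<and> (solved (snd s') \<or> y x = snd s0 (Spare x))" using y by blast
    }
  qed
  \<comment> \<open>During the loop that restores the coefficient of \<open>x\<close>: a residue of zero may only be left over from an
    earlier success, and then the loop does nothing.\<close>
  define failed where "failed r \<longleftrightarrow> (\<forall>y'. box (x # xs) r y' \<longrightarrow> \<not> solved (shifted r y'))" for r
  define down_state where "down_state s0 s y \<longleftrightarrow> box (x # xs) (snd s0) y \<and> s = (fst s0, shifted (snd s0) y) \<and>
      (solved (snd s) \<or> (\<forall>x'. x' \<noteq> x \<longrightarrow> y x' = 0) \<and> failed (snd s0))"
    for s0 s :: "('l, 'l reg) store" and y
  have down: "ptime (\<lambda>N s0 s. ready N (x # xs) (snd s0) \<and> (\<exists>y. down_state s0 s y))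
      (Loop (\<lambda>_ z. \<not> solved_test z \<and> \<not> z (Coeff x)) (shift_along (- 1) x))
      (\<lambda>N s0 s s'. \<exists>y. down_state s0 s' y \<and> (solved (snd s') \<or> y x = 0))"
  proof (rule ptime_Loop[OF ptime_shift_along[OF x(1)], where J = "\<lambda>_ s0 _ k s. \<exists>y. down_state s0 s y \<and> k = nat (y x)"])
    fix N and s0 s :: "('l, 'l reg) store"
    let ?J = "\<lambda>k s. \<exists>y. down_state s0 s y \<and> k = nat (y x)"
    assume pre: "ready N (x # xs) (snd s0) \<and> (\<exists>y. down_state s0 s y)"
    have coeff: "snd s' (Coeff x) = y x" if "down_state s0 s' y" for s' y
      using that x(1) pre by (auto simp: down_state_def ready_def)
    obtain y0 where y0: "down_state s0 s y0" using pre by blast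
    have "y0 x \<le> snd s0 (Spare x)" "snd s0 (Spare x) \<le> int N" using y0 pre by (auto simp: down_state_def box_def ready_def)
    then have "nat (y0 x) \<le> N" by linarith
    then show "\<exists>k\<le>N. ?J k s" using y0 by blast
    fix k s' assume "?J k s'"
    then obtain y where y: "down_state s0 s' y" "k = nat (y x)" by blast
    {
      assume h: "holds (\<lambda>_ z. \<not> solved_test z \<and> \<not> z (Coeff x)) s'"
      have ns: "\<not> solved (snd s')" "snd s' (Coeff x) \<noteq> 0" using h x(1) by (auto simp: holds_def zeros_def)
      have s': "s' = (fst s0, shifted (snd s0) y)" and bx: "box (x # xs) (snd s0) y"
        and yx: "\<And>x'. x' \<noteq> x \<Longrightarrow> y x' = 0" and f: "failed (snd s0)"
        using y(1) ns(1) by (auto simp: down_state_def)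
      have "0 < y x" using bx ns(2) coeff[OF y(1)] by (auto simp: box_def order_less_le)
      define y2 where "y2 = (\<lambda>x'. y x' + ?u (- 1) x')"
      have s2: "(fst s', shifted (snd s') (?u (- 1))) = (fst s0, shifted (snd s0) y2)"
        by (simp add: s' shifted_shifted y2_def)
      have "box (x # xs) (snd s0) y2" using bx \<open>0 < y x\<close> by (auto simp: box_def y2_def)
      then have "down_state s0 (fst s0, shifted (snd s0) y2) y2" using f yx by (auto simp: down_state_def y2_def)
      moreover have "nat (y2 x) < k" using \<open>0 < y x\<close> y(2) by (simp add: y2_def)
      ultimately have "\<exists>k'<k. ?J k' (fst s', shifted (snd s') (?u (- 1)))" unfolding s2 by blast
      then show "\<exists>_::unit. counts_ok N (snd s') \<and>
          (\<forall>s2. s2 = (fst s', shifted (snd s') (\<lambda>x'. if x' = x then - 1 else 0)) \<longrightarrow> (\<exists>k'<k. ?J k' s2))"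
        using pre by (auto simp: s' ready_def)
    next
      assume "\<not> holds (\<lambda>_ z. \<not> solved_test z \<and> \<not> z (Coeff x)) s'"
      then have "solved (snd s') \<or> snd s' (Coeff x) = 0" by (auto simp: holds_def zeros_def)
      then show "\<exists>y. down_state s0 s' y \<and> (solved (snd s') \<or> y x = 0)" using y(1) coeff[OF y(1)] by auto
    }
  qed
  have up_down: "ptime (\<lambda>N s0 s. ready N (x # xs) (snd s0) \<and> (\<exists>y. state s0 s y))
      (Seq (Loop (\<lambda>_ z. \<not> solved_test z \<and> \<not> z (Spare x)) (Seq (shift_along 1 x) (search xs)))
        (Loop (\<lambda>_ z. \<not> solved_test z \<and> \<not> z (Coeff x)) (shift_along (- 1) x)))
      (\<lambda>N s0 s s'. \<exists>y. down_state s0 s' y \<and> (solved (snd s') \<or> y x = 0))"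
  proof (rule ptime_Seq[OF up down])
    fix N and s0 s :: "('l, 'l reg) store"
    assume pre: "ready N (x # xs) (snd s0) \<and> (\<exists>y. state s0 s y)"
    have "\<exists>y. down_state s0 s1 y" if post: "\<exists>y. state s0 s1 y \<and> (solved (snd s1) \<or> y x = snd s0 (Spare x))" for s1
    proof -
      obtain y where y: "state s0 s1 y" "solved (snd s1) \<or> y x = snd s0 (Spare x)" using post by blast
      have "failed (snd s0)" if "\<not> solved (snd s1)"
      proof -
        have "free (snd s0) y" "y x = snd s0 (Spare x)" using y that by (auto simp: state_def)
        then show ?thesis by (auto simp: failed_def free_def box_def)
      qed
      then have "down_state s0 s1 y" using y(1) by (auto simp: state_def down_state_def)
      then show ?thesis by blast
    qed
    then show "\<exists>y. (ready N (x # xs) (snd y) \<and> (\<exists>ya. state y s ya)) \<and>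
        (\<forall>s1. (\<exists>ya. state y s1 ya \<and> (solved (snd s1) \<or> ya x = snd y (Spare x))) \<longrightarrow>
          (\<exists>z. (ready N (x # xs) (snd z) \<and> (\<exists>y. down_state z s1 y)) \<and>
            (\<forall>s2. (\<exists>y. down_state z s2 y \<and> (solved (snd s2) \<or> y x = 0)) \<longrightarrow>
              (\<exists>y. down_state s0 s2 y \<and> (solved (snd s2) \<or> y x = 0)))))"
      using pre by (intro exI[of _ s0] conjI allI impI) auto
  qed
  show ?case
    unfolding search.simps
  proof (rule ptime_Seq[OF first up_down])
    fix N and s :: "('l, 'l reg) store"
    assume pre: "ready N (x # xs) (snd s)"
    have "\<exists>y. box (x # xs) (snd s) y \<and> s2 = (fst s, shifted (snd s) y) \<and>
      (solved (snd s2) \<or> y = (\<lambda>x. 0) \<and> (\<forall>y'. box (x # xs) (snd s) y' \<longrightarrow> \<not> solved (shifted (snd s) y')))"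
      if post: "\<exists>y. down_state s s2 y \<and> (solved (snd s2) \<or> y x = 0)" for s2
    proof -
      obtain y where y: "down_state s s2 y" "solved (snd s2) \<or> y x = 0" using post by blast
      then have "solved (snd s2) \<or> y = (\<lambda>x. 0) \<and> failed (snd s)"
        unfolding down_state_def fun_eq_iff by metis
      then show ?thesis using y(1) unfolding down_state_def failed_def by blast
    qed
    then show "\<exists>_::unit. ready N (x # xs) (snd s) \<and> (\<forall>s1. (\<exists>y. state s s1 y) \<longrightarrow>
        (\<exists>z. (ready N (x # xs) (snd z) \<and> (\<exists>y. state z s1 y)) \<and>
          (\<forall>s2. (\<exists>y. down_state z s2 y \<and> (solved (snd s2) \<or> y x = 0)) \<longrightarrow>
            (\<exists>y. box (x # xs) (snd s) y \<and> s2 = (fst s, shifted (snd s) y) \<and>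
              (solved (snd s2) \<or> y = (\<lambda>x. 0) \<and> (\<forall>y'. box (x # xs) (snd s) y' \<longrightarrow> \<not> solved (shifted (snd s) y')))))))"
      using pre by (intro exI[of _ "()"] conjI allI impI exI[of _ s]) auto
  qed
qed

section \<open>The conjugator as output\<close>

definition spares :: "'l reg \<Rightarrow> int" where
  "spares z = (\<Sum>x\<in>set ls. unit_vec (Spare x) z)"

lemma spares_simps [simp]:
  "spares Scratch = 0" "spares (Residue i) = 0" "spares (Count b x) = 0" "spares (Coeff x) = 0"
  "spares (Spare x) = (if x \<in> set ls then 1 else 0)"
  by (simp_all add: spares_def unit_vec_def)

text \<open>Boxes of increasing size are searched, so the program does not have to compute a bound for the solution.
  Its running time is still polynomial in any such bound, because the first successful box is not larger.\<close>
definition solve :: "('l, 'l reg) com" where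
  "solve = Loop (\<lambda>_ z. \<not> solved_test z) (Seq (add spares) (search ls))"

lemma ptime_solve:
  "ptime (\<lambda>N (_ :: unit) s. counts_ok N (snd s) \<and> (\<forall>x\<in>set ls. snd s (Coeff x) = 0 \<and> snd s (Spare x) = 0) \<and>
      (\<exists>y. (\<forall>x\<in>set ls. 0 \<le> y x \<and> y x \<le> int N) \<and> solved (shifted (snd s) y))) solve
    (\<lambda>N _ s s'. \<exists>y. (\<forall>x\<in>set ls. 0 \<le> y x \<and> y x \<le> int N \<and> snd s' (Coeff x) = y x) \<and>
      solved (shifted (snd s) y) \<and> fst s' = fst s)"
proof -
  have add: "computes (\<lambda>N s. True) (add spares) (\<lambda>s. (fst s, \<lambda>z. snd s z + spares z))"
  proof (rule ptime_add)
    fix z show "z \<notin> set (registers ls dim) \<Longrightarrow> spares z = 0" by (cases z) auto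
  qed
  have body: "ptime (\<lambda>N (_ :: unit) s. ready N ls (\<lambda>z. snd s z + spares z)) (Seq (add spares) (search ls))
    (\<lambda>N _ s s'. \<exists>y. box ls (\<lambda>z. snd s z + spares z) y \<and> s' = (fst s, shifted (\<lambda>z. snd s z + spares z) y) \<and>
      (solved (snd s') \<or> y = (\<lambda>x. 0) \<and>
        (\<forall>y'. box ls (\<lambda>z. snd s z + spares z) y' \<longrightarrow> \<not> solved (shifted (\<lambda>z. snd s z + spares z) y'))))"
    by (rule ptime_Seq[OF add ptime_search[OF distinct_letters order_refl]]) auto
  have dir: "direction (\<lambda>z. r z + c * spares z) = direction r" for r c
    by (simp add: direction_def fun_eq_iff)
  have shift: "shifted (\<lambda>z. r z + c * spares z) y = (\<lambda>z. shifted r y z + c * spares z)" for r c y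
  proof
    fix z show "shifted (\<lambda>z. r z + c * spares z) y z = shifted r y z + c * spares z"
      by (cases z) (simp_all add: shifted_def dir)
  qed
  have sol: "solved (\<lambda>z. r z + c * spares z) = solved r" for r c
    by (simp add: solved_def)
  define bounded where "bounded R y \<longleftrightarrow> (\<forall>x. 0 \<le> y x) \<and> (\<forall>x\<in>set ls. y x \<le> int R) \<and> (\<forall>x. x \<notin> set ls \<longrightarrow> y x = 0)"
    for R :: nat and y :: "'l \<Rightarrow> int"
  define failed where "failed R r \<longleftrightarrow> (\<forall>y. bounded R y \<longrightarrow> \<not> solved (shifted r y))" for R r
  define invar where "invar N s0 k s \<longleftrightarrow> (\<exists>R y. k + R = N \<and> bounded R y \<and>
      fst s = fst s0 \<and> snd s = (\<lambda>z. shifted (snd s0) y z + int R * spares z) \<and>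
      (solved (snd s) \<or> y = (\<lambda>x. 0) \<and> failed R (snd s0)))" for N k and s0 s :: "('l, 'l reg) store"
  show ?thesis
    unfolding solve_def
  proof (rule ptime_Loop[OF body, where J = "\<lambda>N _ s0 k s. invar N s0 k s"])
    fix N and s0 :: "('l, 'l reg) store"
    assume pre: "counts_ok N (snd s0) \<and> (\<forall>x\<in>set ls. snd s0 (Coeff x) = 0 \<and> snd s0 (Spare x) = 0) \<and>
      (\<exists>y. (\<forall>x\<in>set ls. 0 \<le> y x \<and> y x \<le> int N) \<and> solved (shifted (snd s0) y))"
    have zero: "y = (\<lambda>x. 0)" if y: "bounded 0 y" for y
    proof
      fix x
      show "y x = 0"
      proof (cases "x \<in> set ls")
        case True
        then have "0 \<le> y x" "y x \<le> int 0" using y unfolding bounded_def by blast+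
        then show ?thesis by simp
      qed (use y in \<open>auto simp: bounded_def\<close>)
    qed
    have "shifted (snd s0) y = snd s0" if "bounded 0 y" for y
      unfolding zero[OF that] by (rule shifted_zero)
    then have "failed 0 (snd s0)" if "\<not> solved (snd s0)" using that by (simp add: failed_def)
    moreover have "bounded 0 (\<lambda>x. 0)" by (simp add: bounded_def)
    ultimately have "invar N s0 N s0"
      unfolding invar_def by (intro exI[of _ 0] exI[of _ "\<lambda>x. 0"]) auto
    then show "\<exists>k\<le>N. invar N s0 k s0" by blast
    fix k s assume "invar N s0 k s"
    then obtain R y where R: "k + R = N" and y: "bounded R y" and fst_s: "fst s = fst s0"
      and s: "snd s = (\<lambda>z. shifted (snd s0) y z + int R * spares z)"
      and free: "solved (snd s) \<or> y = (\<lambda>x. 0) \<and> failed R (snd s0)"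
      unfolding invar_def by blast
    {
      assume "holds (\<lambda>_ z. \<not> solved_test z) s"
      then have "\<not> solved (snd s)" by (simp add: holds_def)
      then have y0: "y = (\<lambda>x. 0)" and free: "failed R (snd s0)"
        using free by blast+
      obtain ys where ys: "\<forall>x\<in>set ls. 0 \<le> ys x \<and> ys x \<le> int N" "solved (shifted (snd s0) ys)"
        using pre by blast
      have "R \<noteq> N"
      proof
        assume "R = N"
        define y' where "y' = (\<lambda>x. if x \<in> set ls then ys x else 0)"
        have "bounded R y'" using ys(1) \<open>R = N\<close> by (auto simp: y'_def bounded_def)
        moreover have "shifted (snd s0) y' = shifted (snd s0) ys" by (rule shifted_cong) (simp add: y'_def)
        ultimately show False using free ys(2) by (auto simp: failed_def)
      qed
      then have k: "k \<noteq> 0" "Suc R \<le> N" using R by auto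
      let ?r = "\<lambda>z. snd s0 z + int (Suc R) * spares z"
      have r: "(\<lambda>z. snd s z + spares z) = ?r" by (simp add: s y0 algebra_simps)
      have box: "box ls ?r y' \<longleftrightarrow> bounded (Suc R) y'" for y' using pre by (simp add: box_def bounded_def)
      have rdy: "ready N ls ?r" using pre k(2) by (auto simp: ready_def counts_ok_def)
      have fail: "(\<forall>y'. box ls ?r y' \<longrightarrow> \<not> solved (shifted ?r y')) \<longleftrightarrow> failed (Suc R) (snd s0)"
        unfolding box shift sol failed_def ..
      have "invar N s0 (k - 1) s2" if post: "box ls ?r y2" "s2 = (fst s, shifted ?r y2)"
        "solved (snd s2) \<or> y2 = (\<lambda>x. 0) \<and> failed (Suc R) (snd s0)" for s2 y2
        unfolding invar_def
      proof (intro exI[of _ "Suc R"] exI[of _ y2] conjI)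
        show "k - 1 + Suc R = N" using R k(1) by simp
        show "bounded (Suc R) y2" using post(1) unfolding box .
        show "fst s2 = fst s0" by (simp only: post(2) fst_conv fst_s)
        show "snd s2 = (\<lambda>z. shifted (snd s0) y2 z + int (Suc R) * spares z)"
          by (simp only: post(2) snd_conv shift)
        show "solved (snd s2) \<or> y2 = (\<lambda>x. 0) \<and> failed (Suc R) (snd s0)" by (rule post(3))
      qed
      moreover have "k - 1 < k" using k(1) by simp
      ultimately have "\<exists>k'<k. invar N s0 k' s2" if "\<exists>y. box ls ?r y \<and> s2 = (fst s, shifted ?r y) \<and>
          (solved (snd s2) \<or> y = (\<lambda>x. 0) \<and> failed (Suc R) (snd s0))" for s2
        using that by blast
      then show "\<exists>_::unit. ready N ls (\<lambda>z. snd s z + spares z) \<and>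
          (\<forall>s2. (\<exists>y. box ls (\<lambda>z. snd s z + spares z) y \<and> s2 = (fst s, shifted (\<lambda>z. snd s z + spares z) y) \<and>
            (solved (snd s2) \<or> y = (\<lambda>x. 0) \<and> (\<forall>y'. box ls (\<lambda>z. snd s z + spares z) y' \<longrightarrow>
              \<not> solved (shifted (\<lambda>z. snd s z + spares z) y')))) \<longrightarrow> (\<exists>k'<k. invar N s0 k' s2))"
        unfolding r fail using rdy by simp
    next
      assume "\<not> holds (\<lambda>_ z. \<not> solved_test z) s"
      then have "solved (snd s)" by (simp add: holds_def)
      then have "solved (shifted (snd s0) y)" by (simp add: s sol)
      moreover have "y x \<le> int N" if "x \<in> set ls" for x
      proof -
        have "y x \<le> int R" using y that by (simp add: bounded_def)
        then show ?thesis using R by simp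
      qed
      ultimately show "\<exists>y. (\<forall>x\<in>set ls. 0 \<le> y x \<and> y x \<le> int N \<and> snd s (Coeff x) = y x) \<and>
          solved (shifted (snd s0) y) \<and> fst s = fst s0"
        using y pre fst_s by (intro exI[of _ y]) (simp add: s bounded_def)
    }
  qed
qed

definition put_letter :: "'l \<Rightarrow> 'l cell tape \<Rightarrow> 'l cell tape" where
  "put_letter x T = act (Sym x, Go_Right) T"

definition put_word :: "'l list \<Rightarrow> 'l cell tape \<Rightarrow> 'l cell tape" where
  "put_word w T = fold put_letter w T"

lemma put_word_append: "put_word (u @ v) T = put_word v (put_word u T)"
  by (simp add: put_word_def)

lemma put_word_eq:
  "put_word w (p, f) = (p + int (length w), \<lambda>i. if p \<le> i \<and> i < p + int (length w) then Sym (w ! nat (i - p)) else f i)"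
proof (induction w rule: rev_induct)
  case (snoc x w)
  have "put_word (w @ [x]) (p, f) = put_letter x (put_word w (p, f))" by (simp add: put_word_def)
  also have "\<dots> = (p + int (length (w @ [x])), \<lambda>i. if p \<le> i \<and> i < p + int (length (w @ [x])) then Sym ((w @ [x]) ! nat (i - p)) else f i)"
    unfolding snoc by (auto simp: put_letter_def act_def fun_eq_iff nth_append)
  finally show ?case .
qed (auto simp: put_word_def fun_eq_iff)

primrec emit :: "'l list \<Rightarrow> ('l, 'l reg) com" where
  "emit [] = skip"
| "emit (x # xs) = Seq
     (Loop (\<lambda>_ z. \<not> z (Coeff x)) (Step (Some x) Go_Right (\<lambda>z. if z = Coeff x then Go_Left else Stay)))
     (emit xs)"

text \<open>The order in which the letters appear is irrelevant for the equations, so powers of the letters in a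
  fixed order suffice as conjugators.\<close>
definition word_of :: "('l \<Rightarrow> nat) \<Rightarrow> 'l list \<Rightarrow> 'l list" where
  "word_of y xs = concat (map (\<lambda>x. replicate (y x) x) xs)"

lemma ptime_emit:
  assumes "distinct xs" "set xs \<subseteq> set ls"
  shows "ptime (\<lambda>N (_ :: unit) s. \<forall>x\<in>set xs. 0 \<le> snd s (Coeff x) \<and> snd s (Coeff x) \<le> int N) (emit xs)
    (\<lambda>N _ s s'. fst s' = put_word (word_of (\<lambda>x. nat (snd s (Coeff x))) xs) (fst s))"
  using assms
proof (induction xs)
  case Nil
  show ?case unfolding emit.simps by (rule ptime_conseq[OF ptime_skip]) (simp add: word_of_def put_word_def)
next
  case (Cons x xs)
  have x: "x \<in> set ls" "x \<notin> set xs" "distinct xs" "set xs \<subseteq> set ls" using Cons.prems by auto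
  note IH = Cons.IH[OF x(3,4)]
  have step: "computes (\<lambda>N s. True) (Step (Some x) Go_Right (\<lambda>z. if z = Coeff x then Go_Left else Stay))
      (\<lambda>s. (put_letter x (fst s), \<lambda>z. snd s z - unit_vec (Coeff x) z))"
    by (rule ptime_Step) (auto simp: written_def put_letter_def x unit_vec_def fun_eq_iff)
  have loop: "computes (\<lambda>N s. 0 \<le> snd s (Coeff x) \<and> snd s (Coeff x) \<le> int N)
      (Loop (\<lambda>_ z. \<not> z (Coeff x)) (Step (Some x) Go_Right (\<lambda>z. if z = Coeff x then Go_Left else Stay)))
      (\<lambda>s. (put_word (replicate (nat (snd s (Coeff x))) x) (fst s), (snd s)(Coeff x := 0)))"
  proof -
    define invar where "invar s0 k s \<longleftrightarrow> (\<exists>m. int k + int m = snd s0 (Coeff x) \<and>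
      s = (put_word (replicate m x) (fst s0), (snd s0)(Coeff x := int k)))" for k and s0 s :: "('l, 'l reg) store"
    show ?thesis
    proof (rule ptime_Loop[OF step, where J = "\<lambda>_ _ s0 k s. invar s0 k s"])
      fix N and s0 :: "('l, 'l reg) store"
      assume pre: "0 \<le> snd s0 (Coeff x) \<and> snd s0 (Coeff x) \<le> int N"
      then have "invar s0 (nat (snd s0 (Coeff x))) s0" "nat (snd s0 (Coeff x)) \<le> N"
        by (auto simp: put_word_def invar_def)
      then show "\<exists>k\<le>N. invar s0 k s0" by blast
      fix k s assume "invar s0 k s"
      then obtain m where m: "int k + int m = snd s0 (Coeff x)"
        "s = (put_word (replicate m x) (fst s0), (snd s0)(Coeff x := int k))" unfolding invar_def by blast
      {
        assume "holds (\<lambda>_ z. \<not> z (Coeff x)) s"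
        then have "k \<noteq> 0" using x by (simp add: m(2) holds_def zeros_def)
        have "put_letter x (fst s) = put_word (replicate (Suc m) x) (fst s0)"
          by (simp add: m(2) put_word_def replicate_append_same[symmetric] del: replicate.simps)
        then have "invar s0 (k - 1) (put_letter x (fst s), \<lambda>z. snd s z - unit_vec (Coeff x) z)"
          unfolding invar_def
          using m \<open>k \<noteq> 0\<close> by (intro exI[of _ "Suc m"]) (auto simp: fun_eq_iff unit_vec_def of_nat_diff)
        moreover have "k - 1 < k" using \<open>k \<noteq> 0\<close> by simp
        ultimately show "\<exists>_::unit. True \<and> (\<forall>s'. s' = (put_letter x (fst s), \<lambda>z. snd s z - unit_vec (Coeff x) z) \<longrightarrow>
            (\<exists>k'<k. invar s0 k' s'))"
          by blast
      next
        assume "\<not> holds (\<lambda>_ z. \<not> z (Coeff x)) s"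
        then have "k = 0" using x by (simp add: m(2) holds_def zeros_def)
        then show "s = (put_word (replicate (nat (snd s0 (Coeff x))) x) (fst s0), (snd s0)(Coeff x := 0))"
          using m by (simp flip: m(1))
      }
    qed
  qed
  show ?case
    unfolding emit.simps
  proof (rule ptime_Seq[OF loop IH])
    fix N and s :: "('l, 'l reg) store"
    assume pre: "\<forall>x\<in>set (x # xs). 0 \<le> snd s (Coeff x) \<and> snd s (Coeff x) \<le> int N"
    have "map (\<lambda>x'. replicate (nat (((snd s)(Coeff x := 0)) (Coeff x'))) x') xs = map (\<lambda>x'. replicate (nat (snd s (Coeff x'))) x') xs"
      using x(2) by (intro map_cong) auto
    then have "put_word (word_of (\<lambda>x'. nat (((snd s)(Coeff x := 0)) (Coeff x'))) xs) (put_word (replicate (nat (snd s (Coeff x))) x) (fst s)) =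
        put_word (word_of (\<lambda>x. nat (snd s (Coeff x))) (x # xs)) (fst s)"
      by (simp add: word_of_def put_word_append cong: map_cong)
    moreover have "\<forall>x'\<in>set xs. 0 \<le> ((snd s)(Coeff x := 0)) (Coeff x') \<and> ((snd s)(Coeff x := 0)) (Coeff x') \<le> int N"
      using pre by auto
    ultimately show "\<exists>_::unit. (0 \<le> snd s (Coeff x) \<and> snd s (Coeff x) \<le> int N) \<and>
      (\<forall>s1. s1 = (put_word (replicate (nat (snd s (Coeff x))) x) (fst s), (snd s)(Coeff x := 0)) \<longrightarrow>
        (\<exists>_::unit. (\<forall>x\<in>set xs. 0 \<le> snd s1 (Coeff x) \<and> snd s1 (Coeff x) \<le> int N) \<and>
          (\<forall>s2. fst s2 = put_word (word_of (\<lambda>x. nat (snd s1 (Coeff x))) xs) (fst s1) \<longrightarrow>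
            fst s2 = put_word (word_of (\<lambda>x. nat (snd s (Coeff x))) (x # xs)) (fst s))))"
      using pre by auto
  qed
qed

text \<open>The output is written to the right of the input, separated from it by a single blank cell, and that
  cell is where the way back ends.\<close>
definition rewind :: "('l, 'l reg) com" where
  "rewind = Loop (\<lambda>a _. a \<noteq> Blank) (move_head Go_Left)"

lemma ptime_rewind:
  "ptime (\<lambda>N m s. m \<le> N \<and> (\<forall>j<m. snd (fst s) (fst (fst s) - int j) \<noteq> Blank) \<and> snd (fst s) (fst (fst s) - int m) = Blank)
    rewind (\<lambda>N m s s'. s' = shift_head (- int m) s)"
  unfolding rewind_def
proof (rule ptime_Loop[OF ptime_move_head, where J = "\<lambda>_ m s0 k s. \<exists>j. k + j = m \<and> s = shift_head (- int j) s0"])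
  fix N m and s0 :: "('l, 'l reg) store"
  let ?J = "\<lambda>k s. \<exists>j. k + j = m \<and> s = shift_head (- int j) s0"
  assume pre: "m \<le> N \<and> (\<forall>j<m. snd (fst s0) (fst (fst s0) - int j) \<noteq> Blank) \<and> snd (fst s0) (fst (fst s0) - int m) = Blank"
  have "?J m s0" by (intro exI[of _ 0]) (simp add: shift_head_def)
  then show "\<exists>k\<le>N. ?J k s0" using pre by blast
  fix k s assume "?J k s"
  then obtain j where j: "k + j = m" "s = shift_head (- int j) s0" by blast
  {
    assume "holds (\<lambda>a _. a \<noteq> Blank) s"
    then have "j \<noteq> m" using pre by (auto simp: j(2) holds_def scan_def shift_head_def)
    then have "k - 1 < k" "?J (k - 1) (shift_head (offset Go_Left) s)"
      using j by (auto intro!: exI[of _ "Suc j"] simp: shift_head_def)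
    then show "\<exists>_::unit. True \<and> (\<forall>s'. s' = shift_head (offset Go_Left) s \<longrightarrow> (\<exists>k'<k. ?J k' s'))" by blast
  next
    assume h: "\<not> holds (\<lambda>a _. a \<noteq> Blank) s"
    have "\<not> j < m"
    proof
      assume "j < m"
      then have "snd (fst s0) (fst (fst s0) - int j) \<noteq> Blank" using pre by blast
      then show False using h by (simp add: j(2) holds_def scan_def shift_head_def)
    qed
    then have "j = m" using j(1) by simp
    then show "s = shift_head (- int m) s0" using j(2) by simp
  }
qed

definition reading :: "('l, 'l reg) com" where
  "reading = Seq (read_word True) (Seq (move_head Go_Right) (Seq (read_word False) (move_head Go_Right)))"

definition after_reading :: "'l list \<Rightarrow> 'l list \<Rightarrow> ('l, 'l reg) store" where
  "after_reading u v = ((int (length u + length v) + 2, snd (input_tape (encode_pair u v))),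
     after_word False v (after_word True u (\<lambda>_. 0)))"

lemma encode_pair_nth:
  "snd (input_tape (encode_pair u v)) (int k) =
    (if k < length u then Sym (u ! k) else if k = length u then Sep
     else if k \<le> length u + length v then Sym (v ! (k - Suc (length u))) else Blank)"
  by (auto simp: input_tape_def encode_pair_def nth_append nth_Cons')

definition letters_ok :: "nat \<Rightarrow> 'l list \<times> 'l list \<Rightarrow> bool" where
  "letters_ok N x \<longleftrightarrow> set (fst x) \<subseteq> set ls \<and> set (snd x) \<subseteq> set ls \<and> length (fst x) \<le> N \<and> length (snd x) \<le> N"

lemma ptime_reading:
  "ptime (\<lambda>N x s. s = (input_tape (encode_pair (fst x) (snd x)), \<lambda>_. 0) \<and> letters_ok N x) reading
    (\<lambda>N x s s'. s' = after_reading (fst x) (snd x))"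
proof -
  let ?f = "\<lambda>x. snd (input_tape (encode_pair (fst x) (snd x)))"
  let ?s1 = "\<lambda>x. ((int (length (fst x)) + 1, ?f x), after_word True (fst x) (\<lambda>_. 0))"
  have second: "ptime (\<lambda>N x s. s = ?s1 x \<and> letters_ok N x)
    (Seq (read_word False) (move_head Go_Right)) (\<lambda>N x s s'. s' = after_reading (fst x) (snd x))"
  proof (rule ptime_Seq[OF ptime_read_word ptime_move_head])
    fix N x and s :: "('l, 'l reg) store"
    assume pre: "s = ?s1 x \<and> letters_ok N x"
    have cell: "?f x (int (length (fst x)) + 1 + int k) =
        (if k < length (snd x) then Sym (snd x ! k) else Blank)" for k
      using encode_pair_nth[of "fst x" "snd x" "Suc (length (fst x) + k)"] by (simp add: add_ac Suc_le_eq)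
    have "int (count_list (fst x) a) \<le> int N" for a
      using count_le_length[of "fst x" a] pre by (simp add: letters_ok_def)
    then have "counts_ok N (snd s)" using pre by (auto simp: counts_ok_def after_word_def)
    then show "\<exists>w. (set w \<subseteq> set ls \<and> length w \<le> N \<and>
        (\<forall>k<length w. snd (fst s) (fst (fst s) + int k) = Sym (w ! k)) \<and>
        snd (fst s) (fst (fst s) + int (length w)) \<notin> Sym ` set ls \<and>
        counts_ok N (snd s) \<and> (\<forall>x\<in>set ls. snd s (Count False x) = 0)) \<and>
      (\<forall>s1. s1 = ((fst (fst s) + int (length w), snd (fst s)), after_word False w (snd s)) \<longrightarrow>
        (\<exists>_::unit. True \<and> (\<forall>s2. s2 = shift_head (offset Go_Right) s1 \<longrightarrow> s2 = after_reading (fst x) (snd x))))"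
      using pre by (intro exI[of _ "snd x"])
        (auto simp: cell after_word_def[of True] shift_head_def after_reading_def letters_ok_def)
  qed
  have tail: "ptime (\<lambda>N x s. s = shift_head (- 1) (?s1 x) \<and> letters_ok N x)
    (Seq (move_head Go_Right) (Seq (read_word False) (move_head Go_Right)))
    (\<lambda>N x s s'. s' = after_reading (fst x) (snd x))"
  proof (rule ptime_Seq[OF ptime_move_head second])
    fix N x and s :: "('l, 'l reg) store"
    assume "s = shift_head (- 1) (?s1 x) \<and> letters_ok N x"
    then have "shift_head (offset Go_Right) s = ?s1 x \<and> letters_ok N x" by (simp add: shift_head_def)
    then show "\<exists>_::unit. True \<and> (\<forall>s1. s1 = shift_head (offset Go_Right) s \<longrightarrow>
        (\<exists>z. (s1 = ?s1 z \<and> letters_ok N z) \<and>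
          (\<forall>s2. s2 = after_reading (fst z) (snd z) \<longrightarrow> s2 = after_reading (fst x) (snd x))))"
      by blast
  qed
  show ?thesis
    unfolding reading_def
  proof (rule ptime_Seq[OF ptime_read_word tail])
    fix N x and s :: "('l, 'l reg) store"
    assume pre: "s = (input_tape (encode_pair (fst x) (snd x)), \<lambda>_. 0) \<and> letters_ok N x"
    have T: "fst (input_tape (encode_pair (fst x) (snd x))) = 0" by (simp add: input_tape_def)
    have "counts_ok N (snd s)" using pre by (simp add: counts_ok_def)
    then have "set (fst x) \<subseteq> set ls \<and> length (fst x) \<le> N \<and>
        (\<forall>k<length (fst x). snd (fst s) (fst (fst s) + int k) = Sym (fst x ! k)) \<and>
        snd (fst s) (fst (fst s) + int (length (fst x))) \<notin> Sym ` set ls \<and>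
        counts_ok N (snd s) \<and> (\<forall>x\<in>set ls. snd s (Count True x) = 0)"
      using pre by (auto simp: encode_pair_nth T letters_ok_def)
    moreover have "((fst (fst s) + int (length (fst x)), snd (fst s)), after_word True (fst x) (snd s)) =
        shift_head (- 1) (?s1 x)"
      using pre by (simp add: T shift_head_def)
    ultimately show "\<exists>w. (set w \<subseteq> set ls \<and> length w \<le> N \<and>
        (\<forall>k<length w. snd (fst s) (fst (fst s) + int k) = Sym (w ! k)) \<and>
        snd (fst s) (fst (fst s) + int (length w)) \<notin> Sym ` set ls \<and>
        counts_ok N (snd s) \<and> (\<forall>x\<in>set ls. snd s (Count True x) = 0)) \<and>
      (\<forall>s1. s1 = ((fst (fst s) + int (length w), snd (fst s)), after_word True w (snd s)) \<longrightarrow>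
        (\<exists>z. (s1 = shift_head (- 1) (?s1 z) \<and> letters_ok N z) \<and>
          (\<forall>s2. s2 = after_reading (fst z) (snd z) \<longrightarrow> s2 = after_reading (fst x) (snd x))))"
      using pre by (intro exI[of _ "fst x"] conjI allI impI exI[of _ x]) simp_all
  qed
qed

definition go_to_output :: "('l, 'l reg) com" where
  "go_to_output = Seq (move_head Go_Left) (Seq rewind (move_head Go_Right))"

lemma ptime_go_to_output:
  "ptime (\<lambda>N w s. length w \<le> N \<and> (\<exists>p f. fst s = put_word w (p, f) \<and> (\<forall>i\<ge>p - 1. f i = Blank)))
    go_to_output (\<lambda>N w s s'. tape_holds (fst s') w)"
proof -
  have rest: "ptime (\<lambda>N m s. m \<le> N \<and> (\<forall>j<m. snd (fst s) (fst (fst s) - int j) \<noteq> Blank) \<and> snd (fst s) (fst (fst s) - int m) = Blank)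
      (Seq rewind (move_head Go_Right)) (\<lambda>N m s s'. s' = shift_head (1 - int m) s)"
    by (rule ptime_Seq[OF ptime_rewind ptime_move_head]) (auto simp: shift_head_def)
  show ?thesis
    unfolding go_to_output_def
  proof (rule ptime_Seq[OF ptime_move_head rest])
    fix N w and s :: "('l, 'l reg) store"
    assume "length w \<le> N \<and> (\<exists>p f. fst s = put_word w (p, f) \<and> (\<forall>i\<ge>p - 1. f i = Blank))"
    then obtain p f where w: "length w \<le> N" "fst s = put_word w (p, f)" "\<And>i. i \<ge> p - 1 \<Longrightarrow> f i = Blank" by blast
    have "tape_holds (fst (shift_head (1 - int (length w)) (shift_head (- 1) s))) w"
      by (auto simp: tape_holds_def shift_head_def w(2,3) put_word_eq)
    then show "\<exists>_::unit. True \<and> (\<forall>s1. s1 = shift_head (offset Go_Left) s \<longrightarrow>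
        (\<exists>m. (m \<le> N \<and> (\<forall>j<m. snd (fst s1) (fst (fst s1) - int j) \<noteq> Blank) \<and> snd (fst s1) (fst (fst s1) - int m) = Blank) \<and>
          (\<forall>s2. s2 = shift_head (1 - int m) s1 \<longrightarrow> tape_holds (fst s2) w)))"
      using w(1) by (intro exI[of _ "()"] conjI allI impI exI[of _ "length w"]) (auto simp: shift_head_def w(2,3) put_word_eq)
  qed
qed

text \<open>The linear system for the coefficients \<open>y\<close> of a conjugator from \<open>u\<close> to \<open>v\<close>.\<close>
definition conj_problem :: "'l list \<Rightarrow> 'l list \<Rightarrow> ('l \<Rightarrow> int) \<Rightarrow> bool" where
  "conj_problem u v y \<longleftrightarrow> (\<forall>i<dim. coord lin tw u i - coord lin tw v i +
     (\<Sum>x\<in>set ls. y x * commutator_coord tw u v x i) = 0)"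

lemma solved_after_reading:
  assumes "set u \<subseteq> set ls" "set v \<subseteq> set ls"
  shows "solved (shifted (snd (after_reading u v)) y) \<longleftrightarrow> conj_problem u v y"
proof -
  have "direction (snd (after_reading u v)) x i = commutator_coord tw u v x i" for x i
    using assms by (simp add: direction_def after_reading_def after_word_def commutator_coord_def sum_count_list)
  then show ?thesis
    by (simp add: solved_def conj_problem_def shifted_def) (simp add: after_reading_def after_word_def)
qed

definition solver :: "('l, 'l reg) com" where
  "solver = Seq reading (Seq solve (Seq (emit ls) go_to_output))"

lemma length_word_of: "length (word_of y xs) = (\<Sum>x\<leftarrow>xs. y x)"
  by (induction xs) (auto simp: word_of_def)

lemma ptime_solver:
  "ptime (\<lambda>N x s. s = (input_tape (encode_pair (fst x) (snd x)), \<lambda>_. 0) \<and> letters_ok N x \<and>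
      (\<exists>y. (\<forall>a\<in>set ls. 0 \<le> y a \<and> y a \<le> int N) \<and> conj_problem (fst x) (snd x) y))
    solver
    (\<lambda>N x s s'. \<exists>y :: 'l \<Rightarrow> nat. conj_problem (fst x) (snd x) (int \<circ> y) \<and> tape_holds (fst s') (word_of y ls))"
proof -
  have emit: "ptime (\<lambda>N y s. (\<forall>x\<in>set ls. snd s (Coeff x) = int (y x) \<and> y x \<le> N) \<and> (\<forall>i\<ge>fst (fst s) - 1. snd (fst s) i = Blank))
      (Seq (emit ls) go_to_output) (\<lambda>N y s s'. tape_holds (fst s') (word_of y ls))"
  proof (rule ptime_scale[where C = "Suc (length ls)"])
    show "ptime (\<lambda>N y s. (\<forall>x\<in>set ls. snd s (Coeff x) = int (y x) \<and> y x \<le> N) \<and> (\<Sum>x\<leftarrow>ls. y x) \<le> N \<and> (\<forall>i\<ge>fst (fst s) - 1. snd (fst s) i = Blank))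
      (Seq (emit ls) go_to_output) (\<lambda>N y s s'. tape_holds (fst s') (word_of y ls))"
    proof (rule ptime_Seq[OF ptime_emit[OF distinct_letters order_refl] ptime_go_to_output])
      fix N y and s :: "('l, 'l reg) store"
      assume pre: "(\<forall>x\<in>set ls. snd s (Coeff x) = int (y x) \<and> y x \<le> N) \<and> (\<Sum>x\<leftarrow>ls. y x) \<le> N \<and>
        (\<forall>i\<ge>fst (fst s) - 1. snd (fst s) i = Blank)"
      have "nat (snd s (Coeff x)) = y x" if "x \<in> set ls" for x using pre that by simp
      then have eq: "word_of (\<lambda>x. nat (snd s (Coeff x))) ls = word_of y ls"
        by (simp add: word_of_def cong: map_cong)
      have "length (word_of y ls) \<le> N" using pre by (simp add: length_word_of)
      moreover have "\<exists>p f. put_word (word_of y ls) (fst s) = put_word (word_of y ls) (p, f) \<and> (\<forall>i\<ge>p - 1. f i = Blank)"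
        using pre by (intro exI[of _ "fst (fst s)"] exI[of _ "snd (fst s)"]) simp
      ultimately show "\<exists>_::unit. (\<forall>x\<in>set ls. 0 \<le> snd s (Coeff x) \<and> snd s (Coeff x) \<le> int N) \<and>
          (\<forall>s1. fst s1 = put_word (word_of (\<lambda>x. nat (snd s (Coeff x))) ls) (fst s) \<longrightarrow>
            (\<exists>w. (length w \<le> N \<and> (\<exists>p f. fst s1 = put_word w (p, f) \<and> (\<forall>i\<ge>p - 1. f i = Blank))) \<and>
              (\<forall>s2. tape_holds (fst s2) w \<longrightarrow> tape_holds (fst s2) (word_of y ls))))"
        unfolding eq using pre by (intro exI[of _ "()"] conjI allI impI exI[of _ "word_of y ls"]) simp_all
    qed
    fix N y and s :: "('l, 'l reg) store"
    assume pre: "(\<forall>x\<in>set ls. snd s (Coeff x) = int (y x) \<and> y x \<le> N) \<and> (\<forall>i\<ge>fst (fst s) - 1. snd (fst s) i = Blank)"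
    then have "(\<Sum>x\<leftarrow>ls. y x) \<le> (\<Sum>x\<leftarrow>ls. N)" by (intro sum_list_mono) auto
    then have "(\<Sum>x\<leftarrow>ls. y x) \<le> length ls * N" by (simp add: sum_list_triv)
    then show "(\<forall>x\<in>set ls. snd s (Coeff x) = int (y x) \<and> y x \<le> Suc (length ls) * N) \<and>
        (\<Sum>x\<leftarrow>ls. y x) \<le> Suc (length ls) * N \<and> (\<forall>i\<ge>fst (fst s) - 1. snd (fst s) i = Blank)"
      using pre by (auto intro: trans_le_add1)
  qed
  have solve: "ptime (\<lambda>N x s. s = after_reading (fst x) (snd x) \<and> letters_ok N x \<and>
      (\<exists>y. (\<forall>a\<in>set ls. 0 \<le> y a \<and> y a \<le> int N) \<and> conj_problem (fst x) (snd x) y))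
    (Seq solve (Seq (emit ls) go_to_output))
    (\<lambda>N x s s'. \<exists>y :: 'l \<Rightarrow> nat. conj_problem (fst x) (snd x) (int \<circ> y) \<and> tape_holds (fst s') (word_of y ls))"
  proof (rule ptime_Seq[OF ptime_solve emit])
    fix N x and s :: "('l, 'l reg) store"
    assume pre: "s = after_reading (fst x) (snd x) \<and> letters_ok N x \<and>
      (\<exists>y. (\<forall>a\<in>set ls. 0 \<le> y a \<and> y a \<le> int N) \<and> conj_problem (fst x) (snd x) y)"
    define u v where "u = fst x" and "v = snd x"
    have uv: "set u \<subseteq> set ls" "set v \<subseteq> set ls" "length u \<le> N" "length v \<le> N" and s: "s = after_reading u v"
      using pre by (auto simp: u_def v_def letters_ok_def)
    obtain y0 where y0: "\<forall>x\<in>set ls. 0 \<le> y0 x \<and> y0 x \<le> int N" "conj_problem u v y0"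
      using pre by (auto simp: u_def v_def)
    let ?s = "after_reading u v"
    have "int (count_list u x) \<le> int N" "int (count_list v x) \<le> int N" for x
      using count_le_length[of u x] count_le_length[of v x] uv(3,4) by simp_all
    then have cnt: "counts_ok N (snd ?s)" by (auto simp: counts_ok_def after_reading_def after_word_def)
    have blank: "snd (fst ?s) i = Blank" if "i \<ge> fst (fst ?s) - 1" for i
    proof -
      have "i = int (nat i)" "nat i > length u + length v" using that by (auto simp: after_reading_def)
      then show ?thesis using encode_pair_nth[of u v "nat i"] by (simp add: after_reading_def)
    qed
    have "\<exists>y'. ((\<forall>x\<in>set ls. snd s1 (Coeff x) = int (y' x) \<and> y' x \<le> N) \<and> (\<forall>i\<ge>fst (fst s1) - 1. snd (fst s1) i = Blank)) \<and>
        conj_problem u v (int \<circ> y')"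
      if y: "\<forall>x\<in>set ls. 0 \<le> y x \<and> y x \<le> int N \<and> snd s1 (Coeff x) = y x" "solved (shifted (snd ?s) y)" "fst s1 = fst ?s" for s1 y
    proof (intro exI[of _ "\<lambda>x. nat (y x)"] conjI)
      show "\<forall>x\<in>set ls. snd s1 (Coeff x) = int (nat (y x)) \<and> nat (y x) \<le> N" using y(1) by auto
      show "\<forall>i\<ge>fst (fst s1) - 1. snd (fst s1) i = Blank" using blank y(3) by simp
      have "conj_problem u v y" using y(2) solved_after_reading[OF uv(1,2)] by simp
      moreover have "(\<Sum>x\<in>set ls. y x * g x) = (\<Sum>x\<in>set ls. (int \<circ> (\<lambda>x. nat (y x))) x * g x)" for g
        using y(1) by (intro sum.cong) auto
      ultimately show "conj_problem u v (int \<circ> (\<lambda>x. nat (y x)))" unfolding conj_problem_def by simp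
    qed
    moreover have "\<exists>y. (\<forall>x\<in>set ls. 0 \<le> y x \<and> y x \<le> int N) \<and> solved (shifted (snd ?s) y)"
      using y0 solved_after_reading[OF uv(1,2)] by blast
    moreover have "\<forall>x\<in>set ls. snd ?s (Coeff x) = 0 \<and> snd ?s (Spare x) = 0"
      by (simp add: after_reading_def after_word_def)
    ultimately show "\<exists>_::unit. (counts_ok N (snd s) \<and> (\<forall>x\<in>set ls. snd s (Coeff x) = 0 \<and> snd s (Spare x) = 0) \<and>
        (\<exists>y. (\<forall>x\<in>set ls. 0 \<le> y x \<and> y x \<le> int N) \<and> solved (shifted (snd s) y))) \<and>
      (\<forall>s1. (\<exists>y. (\<forall>x\<in>set ls. 0 \<le> y x \<and> y x \<le> int N \<and> snd s1 (Coeff x) = y x) \<and>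
          solved (shifted (snd s) y) \<and> fst s1 = fst s) \<longrightarrow>
        (\<exists>z. ((\<forall>x\<in>set ls. snd s1 (Coeff x) = int (z x) \<and> z x \<le> N) \<and> (\<forall>i\<ge>fst (fst s1) - 1. snd (fst s1) i = Blank)) \<and>
          (\<forall>s2. tape_holds (fst s2) (word_of z ls) \<longrightarrow>
            (\<exists>y. conj_problem (fst x) (snd x) (int \<circ> y) \<and> tape_holds (fst s2) (word_of y ls)))))"
      unfolding s u_def[symmetric] v_def[symmetric] using cnt by (intro exI[of _ "()"] conjI) (blast+)
  qed
  show ?thesis
    unfolding solver_def
  proof (rule ptime_Seq[OF ptime_reading solve])
    fix N x and s :: "('l, 'l reg) store"
    assume "s = (input_tape (encode_pair (fst x) (snd x)), \<lambda>_. 0) \<and> letters_ok N x \<and>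
      (\<exists>y. (\<forall>a\<in>set ls. 0 \<le> y a \<and> y a \<le> int N) \<and> conj_problem (fst x) (snd x) y)"
    then show "\<exists>x'. (s = (input_tape (encode_pair (fst x') (snd x')), \<lambda>_. 0) \<and> letters_ok N x') \<and>
      (\<forall>s1. s1 = after_reading (fst x') (snd x') \<longrightarrow>
        (\<exists>z. (s1 = after_reading (fst z) (snd z) \<and> letters_ok N z \<and>
          (\<exists>y. (\<forall>a\<in>set ls. 0 \<le> y a \<and> y a \<le> int N) \<and> conj_problem (fst z) (snd z) y)) \<and>
          (\<forall>s2. (\<exists>y. conj_problem (fst z) (snd z) (int \<circ> y) \<and> tape_holds (fst s2) (word_of y ls)) \<longrightarrow>
            (\<exists>y. conj_problem (fst x) (snd x) (int \<circ> y) \<and> tape_holds (fst s2) (word_of y ls)))))"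
      by (intro exI[of _ x] conjI allI impI) simp_all
  qed
qed

theorem search_machine:
  "\<exists>M D. wf_tm M \<and> insert Sep (Sym ` set ls) \<subseteq> alphabet M \<and>
     (\<forall>N u v y. set u \<subseteq> set ls \<longrightarrow> set v \<subseteq> set ls \<longrightarrow> length u \<le> N \<longrightarrow> length v \<le> N \<longrightarrow>
        (\<forall>x\<in>set ls. 0 \<le> y x \<and> y x \<le> int N) \<longrightarrow> conj_problem u v y \<longrightarrow>
        (\<exists>t z. t \<le> Suc ((N + 2) ^ D) \<and> conj_problem u v (int \<circ> z) \<and>
          tm_outputs M (encode_pair u v) t (word_of z ls)))"
proof -
  obtain M where M: "wf_tm M" "insert Sep (Sym ` set ls) \<subseteq> alphabet M"
    "\<forall>x t T r y. runs solver (input_tape x, \<lambda>_. 0) t (T, r) \<longrightarrow> tape_holds T y \<longrightarrow> tm_outputs M x (Suc t) y"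
    using compile[of solver] by (elim exE conjE) (rule that)
  obtain D where D: "\<forall>N x s. s = (input_tape (encode_pair (fst x) (snd x)), \<lambda>_. 0) \<and> letters_ok N x \<and>
      (\<exists>y. (\<forall>a\<in>set ls. 0 \<le> y a \<and> y a \<le> int N) \<and> conj_problem (fst x) (snd x) y) \<longrightarrow>
     (\<exists>t s'. t \<le> (N + 2) ^ D \<and> runs solver s t s' \<and>
       (\<exists>y :: 'l \<Rightarrow> nat. conj_problem (fst x) (snd x) (int \<circ> y) \<and> tape_holds (fst s') (word_of y ls)))"
    using ptime_solver unfolding ptime_def by (elim exE) (rule that)
  have key: "\<exists>t z. t \<le> Suc ((N + 2) ^ D) \<and> conj_problem u v (int \<circ> z) \<and> tm_outputs M (encode_pair u v) t (word_of z ls)"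
    if "set u \<subseteq> set ls" "set v \<subseteq> set ls" "length u \<le> N" "length v \<le> N"
      "\<forall>x\<in>set ls. 0 \<le> y x \<and> y x \<le> int N" "conj_problem u v y" for N u v y
  proof -
    let ?s = "(input_tape (encode_pair u v), \<lambda>_. 0) :: ('l, 'l reg) store"
    have "?s = (input_tape (encode_pair (fst (u, v)) (snd (u, v))), \<lambda>_. 0) \<and> letters_ok N (u, v) \<and>
        (\<exists>y. (\<forall>a\<in>set ls. 0 \<le> y a \<and> y a \<le> int N) \<and> conj_problem (fst (u, v)) (snd (u, v)) y)"
      using that by (intro conjI exI[of _ y]) (simp_all add: letters_ok_def)
    from D[rule_format, OF this] obtain t s' where t: "t \<le> (N + 2) ^ D" "runs solver ?s t s'"
      "\<exists>y :: 'l \<Rightarrow> nat. conj_problem u v (int \<circ> y) \<and> tape_holds (fst s') (word_of y ls)"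
      unfolding fst_conv snd_conv by blast
    then obtain z where z: "conj_problem u v (int \<circ> z)" "tape_holds (fst s') (word_of z ls)" by blast
    have "runs solver ?s t (fst s', snd s')" using t(2) by simp
    from M(3)[rule_format, OF this z(2)] have "tm_outputs M (encode_pair u v) (Suc t) (word_of z ls)" .
    moreover have "Suc t \<le> Suc ((N + 2) ^ D)" using t(1) by simp
    ultimately show ?thesis using z(1) by blast
  qed
  show ?thesis
    by (rule exI[of _ M], rule exI[of _ D], intro conjI M(1,2) allI impI, rule key)
qed

end

section \<open>Small conjugators\<close>

definition letters :: "nat \<Rightarrow> nat \<Rightarrow> (gen \<times> bool) list" where
  "letters n s = List.product (map Q [0..<n] @ map B [0..<s]) [True, False]"

lemma set_letters: "set (letters n s) = gens n s \<times> UNIV"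
  by (auto simp: letters_def gens_def)

lemma distinct_letters: "distinct (letters n s)"
  unfolding letters_def by (intro distinct_product) (auto simp: distinct_map inj_on_def)

lemma sum_letters:
  fixes f :: "gen \<times> bool \<Rightarrow> int"
  shows "(\<Sum>x\<in>set (letters n s). f x) = (\<Sum>g\<in>gens n s. f (g, True) + f (g, False))"
proof -
  have "(\<Sum>x\<in>set (letters n s). f x) = (\<Sum>g\<in>gens n s. \<Sum>e\<in>UNIV. f (g, e))"
    by (simp add: set_letters sum.cartesian_product)
  then show ?thesis by (simp add: UNIV_bool add.commute)
qed

lemma finite_gens: "finite (gens n s)"
  by (simp add: gens_def)

lemma card_gens: "card (gens n s) \<le> n + s"
  unfolding gens_def by (rule order_trans[OF card_Un_le]) (auto intro!: add_mono card_image_le[THEN order_trans])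

text \<open>The unknown of an inverse letter is redundant over the integers; it is there because the search runs over
  nonnegative coefficients.\<close>
lemma commutator_coord_flip:
  "commutator_coord (twist N) u v (g, False) i = - commutator_coord (twist N) u v (g, True) i"
proof -
  have "(\<Sum>y\<leftarrow>w. - h y) = - (\<Sum>y\<leftarrow>w. h y)" for w and h :: "gen \<times> bool \<Rightarrow> int"
    by (induction w) simp_all
  then show ?thesis by (simp add: commutator_coord_def twist_False)
qed

definition gen_count :: "gen word \<Rightarrow> gen \<Rightarrow> int" where
  "gen_count w g = (\<Sum>x\<leftarrow>w. if fst x = g then sgn_of (snd x) else 0)"

lemma sum_gen_count:
  assumes "w \<in> words (gens n s)" "\<And>g. f (g, False) = - f (g, True)"
  shows "(\<Sum>x\<leftarrow>w. f x) = (\<Sum>g\<in>gens n s. gen_count w g * f (g, True))"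
  using assms(1)
proof (induction w)
  case (Cons x w)
  obtain h e where x: "x = (h, e)" by force
  have h: "h \<in> gens n s" and w: "w \<in> words (gens n s)" using Cons.prems by (auto simp: words_def x)
  have "(\<Sum>g\<in>gens n s. (if fst x = g then sgn_of (snd x) else 0) * f (g, True)) = f x"
    using h finite_gens assms(2) by (cases e) (simp_all add: x if_distrib[of "\<lambda>k. k * _"] sum.delta' cong: if_cong)
  then show ?case using Cons.IH[OF w] by (simp add: gen_count_def distrib_right sum.distrib)
qed (simp add: gen_count_def)

lemma abs_sum_list_le:
  fixes f :: "'a \<Rightarrow> int"
  assumes "\<And>x. \<bar>f x\<bar> \<le> c"
  shows "\<bar>\<Sum>x\<leftarrow>w. f x\<bar> \<le> c * int (length w)"
proof (induction w)
  case (Cons a w)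
  then show ?case using assms[of a] by (simp add: distrib_left)
qed simp

lemma abs_coord_le:
  assumes "\<And>x. \<bar>lin x i\<bar> \<le> 1" "\<And>x y. \<bar>tw x y i\<bar> \<le> c" 
  shows "\<bar>coord lin tw w i\<bar> \<le> int (length w) * (1 + c * int (length w))"
proof (induction w)
  case (Cons x w)
  have c: "0 \<le> c" using assms(2)[of x x] by linarith
  have "\<bar>\<Sum>y\<leftarrow>w. tw x y i\<bar> \<le> c * int (length w)" using assms(2) by (rule abs_sum_list_le)
  moreover have "int (length w) * (1 + c * int (length w)) + 1 + c * int (length w) \<le>
      int (length (x # w)) * (1 + c * int (length (x # w)))"
    using c by (simp add: algebra_simps)
  ultimately show ?case using Cons.IH assms(1)[of x] by simp
qed simp

lemma abs_twist_le: 
  "\<bar>twist (nilpart n s M) x y i\<bar> \<le> (\<Sum>l<n. \<Sum>i<s. \<Sum>j<s. \<bar>nilpart n s M l i j\<bar>)" (is "_ \<le> ?c")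
proof -
  have "0 \<le> ?c" by (intro sum_nonneg) simp
  have "\<bar>nilpart n s M l i j\<bar> \<le> ?c" for l j
  proof (cases "l < n \<and> i < s \<and> j < s")
    case True
    have "\<bar>nilpart n s M l i j\<bar> \<le> (\<Sum>j<s. \<bar>nilpart n s M l i j\<bar>)"
      using True by (intro member_le_sum) auto
    also have "\<dots> \<le> (\<Sum>i<s. \<Sum>j<s. \<bar>nilpart n s M l i j\<bar>)"
      using True by (intro member_le_sum[where f = "\<lambda>i. \<Sum>j<s. \<bar>nilpart n s M l i j\<bar>"]) (auto intro: sum_nonneg)
    also have "\<dots> \<le> ?c"
      using True by (intro member_le_sum[where f = "\<lambda>l. \<Sum>i<s. \<Sum>j<s. \<bar>nilpart n s M l i j\<bar>"]) (auto intro!: sum_nonneg)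
    finally show ?thesis .
  next
    case False
    then have "nilpart n s M l i j = 0" by (auto simp: nilpart_def)
    then show ?thesis using \<open>0 \<le> ?c\<close> by simp
  qed
  then show ?thesis using \<open>0 \<le> ?c\<close>
    by (cases x; cases "fst x"; cases y; cases "fst y") (auto simp: abs_mult sgn_of_def)
qed

text \<open>The exponent sums of the generators in any conjugator are an integer solution of the linear system, so
  there is a small one.  Its positive and negative parts are the coefficients of the generators and of
  their inverses.\<close>
lemma small_conjugator:
  fixes n s :: nat and M :: "nat \<Rightarrow> int mat"
  shows "\<exists>c. \<forall>u v w. w \<in> words (gens n s) \<longrightarrow>
      (\<forall>i<s. b_coord (nilpart n s M) u i - b_coord (nilpart n s M) v i +
        (\<Sum>x\<leftarrow>w. commutator_coord (twist (nilpart n s M)) u v x i) = 0) \<longrightarrow>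
      (\<exists>y. (\<forall>x. 0 \<le> y x \<and> y x \<le> int ((c * (1 + (length u + length v)) ^ 2) ^ pivot_exponent s)) \<and>
        (\<forall>i<s. b_coord (nilpart n s M) u i - b_coord (nilpart n s M) v i +
          (\<Sum>x\<in>set (letters n s). y x * commutator_coord (twist (nilpart n s M)) u v x i) = 0))"
proof -
  let ?N = "nilpart n s M"
  define W where "W = (\<Sum>l<n. \<Sum>i<s. \<Sum>j<s. \<bar>?N l i j\<bar>)"
  have W: "0 \<le> W" unfolding W_def by (intro sum_nonneg) simp
  define c where "c = nat W + n + s + 2"
  have "\<exists>y. (\<forall>x. 0 \<le> y x \<and> y x \<le> int ((c * (1 + (length u + length v)) ^ 2) ^ pivot_exponent s)) \<and>
        (\<forall>i<s. b_coord ?N u i - b_coord ?N v i +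
          (\<Sum>x\<in>set (letters n s). y x * commutator_coord (twist ?N) u v x i) = 0)"
    if w: "w \<in> words (gens n s)"
      and sol: "\<And>i. i < s \<Longrightarrow> b_coord ?N u i - b_coord ?N v i + (\<Sum>x\<leftarrow>w. commutator_coord (twist ?N) u v x i) = 0"
    for u v w
  proof -
    define f where "f = commutator_coord (twist ?N) u v"
    define L where "L = int (length u) + int (length v)"
    \<comment> \<open>The coordinates of \<open>u\<close> and \<open>v\<close> are sums over pairs of letters, hence a quadratic bound.\<close>
    define H where "H = int c * (1 + L) ^ 2"
    have flip: "f (g, False) i = - f (g, True) i" for g i by (simp add: f_def commutator_coord_flip)
    have L: "0 \<le> L" by (simp add: L_def)
    have one: "1 \<le> (1 + L) ^ 2" using L by simp
    have cW: "int c = W + int n + int s + 2" using W by (simp add: c_def)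
    have lin: "\<bar>b_exp x i\<bar> \<le> 1" for x i by (cases x; cases "fst x") (auto simp: sgn_of_def)
    have tw: "\<bar>twist ?N x y i\<bar> \<le> W" for x y i unfolding W_def by (rule abs_twist_le)
    have cH: "int c \<le> H" unfolding H_def using one by (simp add: mult_le_cancel_left1)
    have WH: "L * (1 + W * L) \<le> H"
    proof -
      have "L * (1 + W * L) \<le> (1 + W) * (1 + L) ^ 2" using L W by (simp add: power2_eq_square algebra_simps)
      also have "\<dots> \<le> H" unfolding H_def using cW by (intro mult_right_mono) auto
      finally show ?thesis .
    qed
    have "\<exists>x'. (\<forall>i<s. (\<Sum>g\<in>gens n s. f (g, True) i * x' g) = b_coord ?N v i - b_coord ?N u i) \<and>
        (\<forall>g\<in>gens n s. 1 dvd x' g - gen_count w g) \<and> (\<forall>g\<in>gens n s. \<bar>x' g\<bar> \<le> H ^ pivot_exponent s)"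
    proof (rule small_integer_solution)
      show "finite (gens n s)" by (rule finite_gens)
      show "2 \<le> H" "int (card (gens n s)) \<le> H" "1 \<le> (1::int)" "1 \<le> H"
        using cH cW W card_gens[of n s] by linarith+
      fix i assume i: "i < s"
      have u: "\<bar>\<Sum>y\<leftarrow>u. twist ?N x y i\<bar> \<le> W * int (length u)" and v: "\<bar>\<Sum>y\<leftarrow>v. twist ?N y x i\<bar> \<le> W * int (length v)" for x
        using tw by (intro abs_sum_list_le; simp)+
      have "W * L \<le> H"
      proof -
        have "W * L \<le> int c * (1 + L) ^ 2"
          using L W cW one by (intro mult_mono) (auto simp: power2_eq_square algebra_simps)
        then show ?thesis by (simp add: H_def)
      qed
      then show "\<bar>f (g, True) i\<bar> \<le> H" if "g \<in> gens n s" for g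
        using u[of "(g, True)"] v[of "(g, True)"] unfolding f_def commutator_coord_def L_def
        by (simp add: distrib_left)
      have len: "int k * (1 + W * int k) \<le> int k * (1 + W * L)" if "int k \<le> L" for k
        using that W by (intro mult_left_mono add_left_mono) auto
      have "\<bar>b_coord ?N u i\<bar> \<le> int (length u) * (1 + W * L)"
        using order_trans[OF abs_coord_le[of b_exp i "twist ?N" W u, OF lin tw] len[of "length u"]] by (simp add: L_def)
      moreover have "\<bar>b_coord ?N v i\<bar> \<le> int (length v) * (1 + W * L)"
        using order_trans[OF abs_coord_le[of b_exp i "twist ?N" W v, OF lin tw] len[of "length v"]] by (simp add: L_def)
      ultimately have "\<bar>b_coord ?N v i - b_coord ?N u i\<bar> \<le> L * (1 + W * L)"
        unfolding L_def by (simp add: distrib_right)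
      then show "\<bar>b_coord ?N v i - b_coord ?N u i\<bar> \<le> H" using WH by linarith
      have "(\<Sum>x\<leftarrow>w. f x i) = (\<Sum>g\<in>gens n s. gen_count w g * f (g, True) i)"
        using w flip by (rule sum_gen_count)
      then show "(\<Sum>g\<in>gens n s. f (g, True) i * gen_count w g) = b_coord ?N v i - b_coord ?N u i"
        using sol[OF i] by (simp add: f_def mult.commute)
    qed
    then obtain x' where x': "\<And>i. i < s \<Longrightarrow> (\<Sum>g\<in>gens n s. f (g, True) i * x' g) = b_coord ?N v i - b_coord ?N u i"
      "\<And>g. g \<in> gens n s \<Longrightarrow> \<bar>x' g\<bar> \<le> H ^ pivot_exponent s" by blast
    define y where "y x = (if fst x \<in> gens n s then max 0 (sgn_of (snd x) * x' (fst x)) else 0)" for x :: "gen \<times> bool"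
    have Hc: "int ((c * (1 + (length u + length v)) ^ 2) ^ pivot_exponent s) = H ^ pivot_exponent s"
      by (simp add: H_def L_def)
    have "0 \<le> H" using cH by linarith
    then have "0 \<le> y x \<and> y x \<le> H ^ pivot_exponent s" for x
      using x'(2)[of "fst x"] by (cases "snd x") (auto simp: y_def)
    moreover have "b_coord ?N u i - b_coord ?N v i + (\<Sum>x\<in>set (letters n s). y x * f x i) = 0" if "i < s" for i
    proof -
      have "(\<Sum>x\<in>set (letters n s). y x * f x i) = (\<Sum>g\<in>gens n s. y (g, True) * f (g, True) i + y (g, False) * f (g, False) i)"
        by (rule sum_letters)
      also have "\<dots> = (\<Sum>g\<in>gens n s. f (g, True) i * x' g)"
        by (rule sum.cong) (auto simp: y_def flip max_def algebra_simps)
      finally show ?thesis using x'(1)[OF that] by simp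
    qed
    ultimately show ?thesis unfolding Hc f_def by blast
  qed
  then show ?thesis by blast
qed

lemma sum_word_of:
  fixes f :: "'l \<Rightarrow> int"
  shows "(\<Sum>x\<leftarrow>concat (map (\<lambda>x. replicate (y x) x) xs). f x) = (\<Sum>x\<leftarrow>xs. int (y x) * f x)"
  by (induction xs) (simp_all add: sum_list_replicate)

theorem theorem3p8:
  fixes G :: "('g, 'm) monoid_scheme"
    and \<phi> :: "gen \<Rightarrow> 'g"
    and n s s\<^sub>1 s\<^sub>2 :: nat
    and M :: "nat \<Rightarrow> int mat"
  assumes "family_presentation G \<phi> n s M"
    and "s\<^sub>1 + s\<^sub>2 = s"
    and "\<forall>l<n. M l \<in> Gamma s\<^sub>1 s\<^sub>2"
  shows "conj_search_poly_time G \<phi> (gens n s)"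
proof -
  let ?N = "nilpart n s M"
  have pres: "has_presentation G \<phi> (gens n s) (family_relations n s M)"
    and carr: "\<And>l. l < n \<Longrightarrow> M l \<in> carrier_mat s s"
    using assms(1) by (auto simp: family_presentation_def)
  interpret group G using pres by (simp add: has_presentation_def)
  have gens: "\<phi> ` gens n s \<subseteq> carrier G" using pres by (simp add: has_presentation_def)
  have nil: "?N l i j * ?N t j k = 0" if "l < n" "t < n" for l t i j k
  proof (rule ccontr)
    assume "?N l i j * ?N t j k \<noteq> 0"
    then have "s\<^sub>1 \<le> j" "j < s\<^sub>1"
      using nilpart_Gamma[of M l s\<^sub>1 s\<^sub>2 n i j] nilpart_Gamma[of M t s\<^sub>1 s\<^sub>2 n j k] assms(2,3) that by auto
    then show False by simp
  qed
  interpret search: conjugator_search "letters n s" b_exp "twist ?N" s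
    by unfold_locales (rule distinct_letters)
  have conj_iff: "word_val G \<phi> w \<otimes>\<^bsub>G\<^esub> word_val G \<phi> u \<otimes>\<^bsub>G\<^esub> inv\<^bsub>G\<^esub> (word_val G \<phi> w) = word_val G \<phi> v \<longleftrightarrow>
      q_exps u = q_exps v \<and> (\<forall>i<s. b_coord ?N u i - b_coord ?N v i +
        (\<Sum>x\<leftarrow>w. commutator_coord (twist ?N) u v x i) = 0)"
    if "u \<in> words (gens n s)" "v \<in> words (gens n s)" "w \<in> words (gens n s)" for u v w
    using nil carr that by (rule conjugator_iff[OF pres])
  obtain c where c: "\<forall>u v w. w \<in> words (gens n s) \<longrightarrow>
      (\<forall>i<s. b_coord ?N u i - b_coord ?N v i + (\<Sum>x\<leftarrow>w. commutator_coord (twist ?N) u v x i) = 0) \<longrightarrow>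
      (\<exists>y. (\<forall>x. 0 \<le> y x \<and> y x \<le> int ((c * (1 + (length u + length v)) ^ 2) ^ pivot_exponent s)) \<and>
        search.conj_problem u v y)"
    using small_conjugator[of n s M] unfolding search.conj_problem_def by blast
  obtain T D where T: "wf_tm T" "insert Sep (Sym ` set (letters n s)) \<subseteq> alphabet T"
    and run: "\<forall>N u v y. set u \<subseteq> set (letters n s) \<longrightarrow> set v \<subseteq> set (letters n s) \<longrightarrow> length u \<le> N \<longrightarrow> length v \<le> N \<longrightarrow>
        (\<forall>x\<in>set (letters n s). 0 \<le> y x \<and> y x \<le> int N) \<longrightarrow> search.conj_problem u v y \<longrightarrow>
        (\<exists>t z. t \<le> Suc ((N + 2) ^ D) \<and> search.conj_problem u v (int \<circ> z) \<and>
          tm_outputs T (encode_pair u v) t (search.word_of z (letters n s)))"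
    using search.search_machine by (elim exE conjE) (rule that)
  \<comment> \<open>The search needs \<open>N\<close> to bound the coefficients of a small conjugator and the lengths of both words;
    the sum of these two bounds is taken for \<open>N\<close>.\<close>
  define p :: "nat poly" where
    "p = (([:c:] * [:1, 1:] ^ 2) ^ pivot_exponent s + [:0, 1:] + [:2:]) ^ D + 1"
  have p: "poly p L = Suc ((((c * (1 + L) ^ 2) ^ pivot_exponent s + L) + 2) ^ D)" for L
    by (simp add: p_def)
  have "\<exists>t w. t \<le> poly p (length u + length v) \<and> w \<in> words (gens n s) \<and>
      tm_outputs T (encode_pair u v) t w \<and>
      word_val G \<phi> w \<otimes>\<^bsub>G\<^esub> word_val G \<phi> u \<otimes>\<^bsub>G\<^esub> inv\<^bsub>G\<^esub> (word_val G \<phi> w) = word_val G \<phi> v"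
    if u: "u \<in> words (gens n s)" and v: "v \<in> words (gens n s)"
      and conj: "conjugate_in G (word_val G \<phi> u) (word_val G \<phi> v)" for u v
  proof -
    have set_words: "set w \<subseteq> set (letters n s) \<longleftrightarrow> w \<in> words (gens n s)" for w
      by (auto simp: set_letters words_def)
    obtain h where h: "h \<in> carrier G" "h \<otimes>\<^bsub>G\<^esub> word_val G \<phi> u \<otimes>\<^bsub>G\<^esub> inv\<^bsub>G\<^esub> h = word_val G \<phi> v"
      using conj by (auto simp: conjugate_in_def)
    obtain w where w: "w \<in> words (gens n s)" "word_val G \<phi> w = h"
      using pres h(1) unfolding has_presentation_def by blast
    have eq: "q_exps u = q_exps v"
      and sol: "\<forall>i<s. b_coord ?N u i - b_coord ?N v i + (\<Sum>x\<leftarrow>w. commutator_coord (twist ?N) u v x i) = 0"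
      using conj_iff[OF u v w(1)] h(2) w(2) by auto
    define L where "L = length u + length v"
    define K where "K = (c * (1 + L) ^ 2) ^ pivot_exponent s + L"
    obtain y where y: "\<And>x. 0 \<le> y x" "\<And>x. y x \<le> int ((c * (1 + L) ^ 2) ^ pivot_exponent s)" "search.conj_problem u v y"
      using c[rule_format, OF w(1)] sol unfolding L_def by blast
    have "y x \<le> int K" for x using y(2)[of x] by (simp add: K_def)
    then obtain t z where t: "t \<le> Suc ((K + 2) ^ D)" "search.conj_problem u v (int \<circ> z)"
      "tm_outputs T (encode_pair u v) t (search.word_of z (letters n s))"
      using run[rule_format, of u v K y] y u v unfolding set_words by (auto simp: K_def L_def)
    define w' where "w' = search.word_of z (letters n s)"
    have w': "w' \<in> words (gens n s)"
      unfolding w'_def search.word_of_def set_words[symmetric] by auto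
    have "(\<Sum>x\<leftarrow>w'. f x) = (\<Sum>x\<in>set (letters n s). int (z x) * f x)" for f :: "gen \<times> bool \<Rightarrow> int"
      unfolding w'_def search.word_of_def sum_word_of
      using distinct_letters by (rule sum_list_distinct_conv_sum_set)
    then have "word_val G \<phi> w' \<otimes>\<^bsub>G\<^esub> word_val G \<phi> u \<otimes>\<^bsub>G\<^esub> inv\<^bsub>G\<^esub> (word_val G \<phi> w') = word_val G \<phi> v"
      using conj_iff[OF u v w'] eq t(2) by (simp add: search.conj_problem_def)
    moreover have "t \<le> poly p (length u + length v)" using t(1) by (simp add: p K_def L_def)
    ultimately show ?thesis using w' t(3) unfolding w'_def by blast
  qed
  then show ?thesis
    unfolding conj_search_poly_time_def using T by (intro exI[of _ T] exI[of _ p]) (auto simp: set_letters)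
qed

end
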